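(* Let $\xi$ be a positive random variable that satisfies $\mathbb{E}\big(\xi e^{c(\log \xi)^{1/2}}\mathbb{1}_{\{\xi\ge 1\}}\big)<\infty$ for some constant $c>8\sqrt{\log 96}$. Then there is a critical point $p_c\in(0,1)$, depending on the law of $\xi$ only, such that for $p<p_c$ we have $$\mathbb{P}_p^{\Lambda}\big((0,0)\leftrightarrow\infty\big)=0\quad\text{for }\mu_\xi\text{-almost all }\Lambda,$$ and for $p>p_c$ we have $$\mathbb{P}_p^{\Lambda}\big((0,0)\leftrightarrow\infty\big)>0\quad\text{for }\mu_\xi\text{-almost all }\Lambda.$$
   Context: $\mathbb{Z}_+$ denotes the nonnegative integers and $\mathbb{Z}_+^*=\mathbb{Z}_+\setminus\{0\}$. Let $\{\xi_k\}_{k\ge1}$ be i.i.d. copies of $\xi$. The environment is the increasing random sequence $\Lambda=\{x_k : k\in\mathbb{Z}_+\}\subset\mathbb{R}$ with $x_0=0$ and $x_k=x_{k-1}+\xi_k$ for $k\in\mathbb{Z}_+^*$; $\mu_\xi$ denotes its law. Given $\Lambda$, let $\mathcal{L}_\Lambda=(V_\Lambda,E_\Lambda)$ be the graph with vertex set $V_\Lambda=\Lambda\times\mathbb{Z}_+$ and edge set $E_\Lambda=\{\langle (x_i,n),(x_j,m)\rangle : |i-j|+|n-m|=1,\ x_i,x_j\in\Lambda,\ n,m\in\mathbb{Z}_+\}$. For $p\in[0,1]$, $\mathbb{P}_p^\Lambda$ is the probability measure on $\{0,1\}^{E_\Lambda}$ under which edges are independent and each edge $e=\langle v_1,v_2\rangle$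 is open (takes value $1$) with probability $p^{|e|}$, where $|e|=\|v_1-v_2\|$ is the Euclidean length of $e$, and closed otherwise. (Equivalently, on $\mathbb{Z}_+^2$, vertical edges are open with probability $p$ and the horizontal edges $\langle(i,j),(i+1,j)\rangle$ are open with probability $p^{\xi_{i+1}}$, independently given $(\xi_k)$.) $\{(0,0)\leftrightarrow\infty\}$ is the event that there is an infinite open path starting at $(0,0)$ using only open edges. *)

theory Defs
  imports "HOL-Probability.Probability"
begin

primrec partial_sums :: "(nat \<Rightarrow> real) \<Rightarrow> nat \<Rightarrow> real" where
  "partial_sums \<xi> 0 = 0"
| "partial_sums \<xi> (Suc k) = partial_sums \<xi> k + \<xi> (Suc k)"

(* The law of the random environment (x_k) when the increments \<xi>_1, \<xi>_2, ... are i.i.d. with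
   law \<nu>.  An environment is represented by the sequence x rather than by its range; the
   realisation of the increments is immaterial, see environment_law_iid. *)
definition environment_law :: "real measure \<Rightarrow> (nat \<Rightarrow> real) measure" where
  "environment_law \<nu> =
     distr (Pi\<^sub>M {1..} (\<lambda>_. \<nu>)) (Pi\<^sub>M UNIV (\<lambda>_. borel)) partial_sums"

lemma partial_sums_measurable:
  assumes "sets \<nu> = sets borel"
  shows "partial_sums \<in> measurable (Pi\<^sub>M {1..} (\<lambda>_. \<nu>)) (Pi\<^sub>M UNIV (\<lambda>_. borel))"
proof -
  have comp: "(\<lambda>\<xi>. \<xi> (Suc k)) \<in> borel_measurable (Pi\<^sub>M {1..} (\<lambda>_. \<nu>))" for k
  proof -
    have "(\<lambda>\<xi>. \<xi> (Suc k)) \<in> measurable (Pi\<^sub>M {1..} (\<lambda>_. \<nu>)) \<nu>"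
      by (rule measurable_component_singleton) simp
    then show ?thesis
      using measurable_cong_sets[OF refl assms] by blast
  qed
  have "(\<lambda>\<xi>. partial_sums \<xi> k) \<in> borel_measurable (Pi\<^sub>M {1..} (\<lambda>_. \<nu>))" for k
  proof (induction k)
    case (Suc k)
    then show ?case
      unfolding partial_sums.simps by (intro borel_measurable_add comp)
  qed simp
  then have "(\<lambda>\<xi>. \<lambda>k\<in>UNIV. partial_sums \<xi> k)
      \<in> measurable (Pi\<^sub>M {1..} (\<lambda>_. \<nu>)) (Pi\<^sub>M UNIV (\<lambda>_. borel))"
    by (intro measurable_restrict) auto
  then show ?thesis
    by (simp add: restrict_UNIV)
qed

lemma partial_sums_cong:
  "(\<And>i. 1 \<le> i \<Longrightarrow> f i = g i) \<Longrightarrow> partial_sums f k = partial_sums g k"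
  by (induction k) auto

lemma environment_law_iid:
  assumes "prob_space M"
    and indep: "prob_space.indep_vars M (\<lambda>_. borel) X {1::nat..}"
    and law: "\<And>k. 1 \<le> k \<Longrightarrow> distr M borel (X k) = \<nu>"
  shows "distr M (Pi\<^sub>M UNIV (\<lambda>_. borel)) (\<lambda>\<omega>. partial_sums (\<lambda>k. X k \<omega>)) = environment_law \<nu>"
proof -
  interpret prob_space M by fact
  have rv: "X k \<in> borel_measurable M" if "k \<in> {1..}" for k
    using indep that unfolding indep_vars_def by auto
  have sets_nu: "sets \<nu> = sets borel"
    using law[of 1] by (metis order_refl sets_distr)
  define Y where "Y \<omega> = (\<lambda>k\<in>{1..}. X k \<omega>)" for \<omega>
  have sets_PiM: "sets (Pi\<^sub>M {1..} (\<lambda>_. \<nu>)) = sets (Pi\<^sub>M {1::nat..} (\<lambda>_. borel))"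
    by (intro sets_PiM_cong) (auto simp: sets_nu)
  have Y: "Y \<in> measurable M (Pi\<^sub>M {1..} (\<lambda>_. borel))"
    unfolding Y_def by (intro measurable_restrict rv)
  have "distr M (Pi\<^sub>M {1..} (\<lambda>_. borel)) Y = Pi\<^sub>M {1..} (\<lambda>k. distr M borel (X k))"
    using indep_vars_iff_distr_eq_PiM'[of "{1::nat..}" X "\<lambda>_. borel"] rv indep
    unfolding Y_def by auto
  also have "\<dots> = Pi\<^sub>M {1..} (\<lambda>_. \<nu>)"
    by (intro PiM_cong) (auto simp: law)
  finally have YY: "distr M (Pi\<^sub>M {1..} (\<lambda>_. borel)) Y = Pi\<^sub>M {1..} (\<lambda>_. \<nu>)" .
  have ps: "partial_sums \<in> measurable (Pi\<^sub>M {1..} (\<lambda>_. borel)) (Pi\<^sub>M UNIV (\<lambda>_. borel))"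
    by (rule partial_sums_measurable) simp
  have "environment_law \<nu> = distr M (Pi\<^sub>M UNIV (\<lambda>_. borel)) (partial_sums \<circ> Y)"
    unfolding environment_law_def YY[symmetric] by (rule distr_distr[OF ps Y])
  moreover have "partial_sums \<circ> Y = (\<lambda>\<omega>. partial_sums (\<lambda>k. X k \<omega>))"
    by (auto simp: fun_eq_iff Y_def intro!: partial_sums_cong)
  ultimately show ?thesis by simp
qed

type_synonym vertex = "real \<times> real"

definition lattice_vertices :: "(nat \<Rightarrow> real) \<Rightarrow> vertex set" where
  "lattice_vertices x = range x \<times> \<nat>"

definition lattice_edges :: "(nat \<Rightarrow> real) \<Rightarrow> vertex set set" where
  "lattice_edges x =
     {{(x i, real n), (x j, real m)} | i j n m. \<bar>int i - int j\<bar> + \<bar>int n - int m\<bar> = 1}"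

(* An edge is the set of its two end points, so its Euclidean length is its diameter. *)
definition edge_length :: "vertex set \<Rightarrow> real" where
  "edge_length e = diameter e"

lemma edge_length_doubleton: "edge_length {u, v} = dist u v"
proof -
  have "diameter {u, v} \<le> dist u v"
    by (rule diameter_le) (auto simp flip: dist_norm simp: dist_commute)
  moreover have "dist u v \<le> diameter {u, v}"
    by (rule diameter_bounded_bound) auto
  ultimately show ?thesis
    by (simp add: edge_length_def)
qed

definition percolation :: "real \<Rightarrow> (nat \<Rightarrow> real) \<Rightarrow> (vertex set \<Rightarrow> bool) measure" where
  "percolation p x =
     Pi\<^sub>M (lattice_edges x) (\<lambda>e. measure_pmf (bernoulli_pmf (p powr edge_length e)))"

(* Injectivity makes the path self-avoiding; without it, walking back and forth along a single
   open edge would count as an infinite open path. *)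
definition infinite_open_path ::
    "(nat \<Rightarrow> real) \<Rightarrow> (vertex set \<Rightarrow> bool) \<Rightarrow> vertex \<Rightarrow> (nat \<Rightarrow> vertex) \<Rightarrow> bool" where
  "infinite_open_path x \<omega> v \<gamma> \<longleftrightarrow>
     \<gamma> 0 = v \<and> range \<gamma> \<subseteq> lattice_vertices x \<and> inj \<gamma> \<and>
     (\<forall>k. {\<gamma> k, \<gamma> (Suc k)} \<in> lattice_edges x \<and> \<omega> {\<gamma> k, \<gamma> (Suc k)})"

definition connected_to_infinity ::
    "real \<Rightarrow> (nat \<Rightarrow> real) \<Rightarrow> (vertex set \<Rightarrow> bool) set" where
  "connected_to_infinity p x =
     {\<omega> \<in> space (percolation p x). \<exists>\<gamma>. infinite_open_path x \<omega> (0, 0) \<gamma>}"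

end

theory Submission
  imports Defs
begin

text \<open>
  The theorem rests on one estimate about a random field on the quarter plane. Call it a column
  model: bonds are independent, the horizontal bonds between columns \<open>i\<close> and \<open>i + 1\<close> are open with
  probability \<open>w i\<close>, and the vertical bonds of column \<open>i\<close> are closed with probability \<open>exp (- X i)\<close>,
  where the pairs \<open>(w i, X i)\<close> are i.i.d. If \<open>w\<close> and \<open>X\<close> are usually tiny and \<open>X\<close> has a small mean
  and a tail slightly lighter than integrability requires, then almost surely the events
  \<open>escape\<close>, that an open path leaves the \<open>m\<close>-th box of a fixed sequence of boxes, have summable
  probabilities (\<open>AE_escape_prob\<close>).

  For \<open>p\<close> near 0 the lattice itself is such a model, with \<open>w i = p powr \<xi>\<close> and \<open>X\<close> the constant
  \<open>- ln (1 - p)\<close>; an infinite cluster of the origin escapes from every box, hence has probability 0.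
  For \<open>p\<close> near 1 the closed bonds of the planar dual are such a model, with \<open>w i = 1 - p\<close> and
  \<open>X i = \<xi> ln (1 / p)\<close>: a long horizontal gap is a long vertical highway for closed dual paths. If the
  cluster of the origin is finite, a closed dual path joins the bottom of the quarter plane to its
  left side (\<open>finite_cluster_dual_path\<close>, a parity argument). Forcing the left side to be open up to
  a large height makes such a path escape from one of the large boxes, which is unlikely; so
  percolation has positive probability.

  The estimate is proved by induction over scales of width \<open>width n = 4 ^ n\<^sup>2\<close>. A block is good if
  both crossing it horizontally and moving vertically by \<open>height\<close> in it and its neighbour cost
  \<open>exp (- c n * width n)\<close> with \<open>c n\<close> decreasing to 1. A block of the next scale contains
  \<open>ratio n\<close> blocks and is good as soon as its bad blocks lie next to each other and no short window
  of columns carries a large sum of \<open>X\<close> (\<open>not_bad_good\<close>). Crossing it means crossing the good runs on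
  both sides of the bad place. To move vertically inside it, a path must cross a buffer of good
  blocks, or stay inside a good run, or stay in a window around the bad place, where every level has
  all its vertical bonds closed with probability at least \<open>exp (- threshold n)\<close>. The loss in \<open>c n\<close> is
  summable because the heights grow like the exponential of only a fraction \<open>2 ^ - n\<close> of the width.
  On the side of the environment, a bad block needs two separated bad blocks, which squares the
  probability, or one untypical window (\<open>prob_bad\<close>). Apart from the integrability of \<open>\<xi>\<close>, the
  moment hypothesis enters only in the second case, through \<open>tail_bound\<close>, and the induction
  closes with probability \<open>2 ^ (- 12 n)\<close> for a bad block.

  Between the two phases the dichotomy is almost sure: dropping the first increment can only destroy
  percolation, so by stationarity the event that percolation has positive probability agrees up to
  null sets with a tail event of the increments (\<open>theta_zero_one\<close>).
\<close>

section \<open>Independence in product measures\<close>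

lemma PiM_coordinates_indep_vars:
  assumes "\<And>i. i \<in> I \<Longrightarrow> prob_space (M i)" "I \<noteq> {}"
  shows "prob_space.indep_vars (Pi\<^sub>M I M) M (\<lambda>i \<omega>. \<omega> i) I"
proof -
  interpret prob_space "Pi\<^sub>M I M" by (rule prob_space_PiM) fact
  have "distr (Pi\<^sub>M I M) (Pi\<^sub>M I M) (\<lambda>\<omega>. \<lambda>i\<in>I. \<omega> i) = distr (Pi\<^sub>M I M) (Pi\<^sub>M I M) (\<lambda>\<omega>. \<omega>)"
    by (intro distr_cong) (auto simp: space_PiM)
  also have "\<dots> = Pi\<^sub>M I M" by simp
  also have "\<dots> = Pi\<^sub>M I (\<lambda>i. distr (Pi\<^sub>M I M) (M i) (\<lambda>\<omega>. \<omega> i))"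
    by (intro PiM_cong refl) (simp add: distr_PiM_component assms)
  finally show ?thesis
    by (subst indep_vars_iff_distr_eq_PiM') (use assms in auto)
qed

lemma PiM_reindexed_coordinates_indep_vars:
  assumes "\<And>i. i \<in> I \<Longrightarrow> prob_space (M i)" "I \<noteq> {}" "inj_on \<phi> J" "\<phi> ` J \<subseteq> I"
  shows "prob_space.indep_vars (Pi\<^sub>M I M) (\<lambda>j. M (\<phi> j)) (\<lambda>j \<omega>. \<omega> (\<phi> j)) J"
proof -
  interpret prob_space "Pi\<^sub>M I M" by (rule prob_space_PiM) fact
  have "indep_vars (\<lambda>j. Pi\<^sub>M {\<phi> j} M) (\<lambda>j \<omega>. restrict (\<lambda>i. \<omega> i) {\<phi> j}) J"
    by (rule indep_vars_restrict[OF PiM_coordinates_indep_vars[OF assms(1,2)]])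
       (use assms(3,4) in \<open>auto simp: disjoint_family_on_def inj_on_def\<close>)
  then have "indep_vars (\<lambda>j. M (\<phi> j)) (\<lambda>j \<omega>. restrict (\<lambda>i. \<omega> i) {\<phi> j} (\<phi> j)) J"
    by (rule indep_vars_compose2) (rule measurable_component_singleton, simp)
  then show ?thesis by simp
qed

definition determined_by :: "'i set \<Rightarrow> ('i \<Rightarrow> 'a) set \<Rightarrow> bool" where
  "determined_by J A \<longleftrightarrow> (\<forall>\<omega> \<omega>'. (\<forall>i\<in>J. \<omega> i = \<omega>' i) \<longrightarrow> \<omega> \<in> A \<longrightarrow> \<omega>' \<in> A)"

lemma determined_by_iff:
  "determined_by J A \<Longrightarrow> (\<And>i. i \<in> J \<Longrightarrow> \<omega> i = \<omega>' i) \<Longrightarrow> \<omega> \<in> A \<longleftrightarrow> \<omega>' \<in> A"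
  unfolding determined_by_def by metis

lemma determined_by_restrict_space:
  assumes A: "A \<in> sets (Pi\<^sub>M I M)" and J: "J \<subseteq> I" and "\<And>i. i \<in> I \<Longrightarrow> prob_space (M i)"
    and D: "A = space (Pi\<^sub>M I M) \<inter> D" "determined_by J D"
  shows "\<exists>A' \<in> sets (Pi\<^sub>M J M). A = (\<lambda>\<omega>. restrict \<omega> J) -` A' \<inter> space (Pi\<^sub>M I M)"
proof -
  have "space (M i) \<noteq> {}" if "i \<in> I" for i
    using assms(3)[OF that] by (rule prob_space.not_empty)
  then have "(SOME x. x \<in> space (M i)) \<in> space (M i)" if "i \<in> I" for i
    using that by (simp add: some_in_eq)
  then obtain d where d: "\<And>i. i \<in> I \<Longrightarrow> d i \<in> space (M i)" by (rule that)
  \<comment> \<open>extend a configuration on \<open>J\<close> by fixed values outside \<open>J\<close>\<close>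
  let ?f = "\<lambda>\<eta>. \<lambda>i\<in>I. if i \<in> J then \<eta> i else d i"
  have f: "?f \<in> measurable (Pi\<^sub>M J M) (Pi\<^sub>M I M)"
  proof (rule measurable_restrict)
    fix i assume i: "i \<in> I"
    show "(\<lambda>x. if i \<in> J then x i else d i) \<in> measurable (Pi\<^sub>M J M) (M i)"
      by (cases "i \<in> J") (use d i in \<open>auto intro: measurable_component_singleton\<close>)
  qed
  have eq: "\<omega> \<in> A \<longleftrightarrow> ?f (restrict \<omega> J) \<in> A" if "\<omega> \<in> space (Pi\<^sub>M I M)" for \<omega>
  proof -
    have "restrict \<omega> J \<in> space (Pi\<^sub>M J M)"
      using that J by (auto simp: space_PiM)
    then have sp: "?f (restrict \<omega> J) \<in> space (Pi\<^sub>M I M)"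
      using f by (rule measurable_space[rotated])
    have "\<omega> \<in> D \<longleftrightarrow> ?f (restrict \<omega> J) \<in> D"
      by (rule determined_by_iff[OF D(2)]) (use J in auto)
    then show ?thesis using that sp D(1) by auto
  qed
  show ?thesis
  proof (rule bexI)
    show "?f -` A \<inter> space (Pi\<^sub>M J M) \<in> sets (Pi\<^sub>M J M)"
      by (rule measurable_sets[OF f A])
    show "A = (\<lambda>\<omega>. restrict \<omega> J) -` (?f -` A \<inter> space (Pi\<^sub>M J M)) \<inter> space (Pi\<^sub>M I M)"
    proof -
      have "restrict \<omega> J \<in> space (Pi\<^sub>M J M)" if "\<omega> \<in> space (Pi\<^sub>M I M)" for \<omega>
        using that J by (auto simp: space_PiM)
      then show ?thesis using eq sets.sets_into_space[OF A] by blast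
    qed
  qed
qed

text \<open>Restricting a configuration to two disjoint sets of coordinates gives independent variables, and
  an event that is determined by a set of coordinates is a preimage under the corresponding
  restriction.\<close>

lemma PiM_prob_Int_determined:
  assumes prob: "\<And>i. i \<in> I \<Longrightarrow> prob_space (M i)" and "I \<noteq> {}"
    and A: "space (Pi\<^sub>M I M) \<inter> A \<in> sets (Pi\<^sub>M I M)" "determined_by J A" "J \<subseteq> I"
    and B: "space (Pi\<^sub>M I M) \<inter> B \<in> sets (Pi\<^sub>M I M)" "determined_by K B" "K \<subseteq> I"
    and disj: "J \<inter> K = {}"
  shows "measure (Pi\<^sub>M I M) (space (Pi\<^sub>M I M) \<inter> A \<inter> B)
    = measure (Pi\<^sub>M I M) (space (Pi\<^sub>M I M) \<inter> A) * measure (Pi\<^sub>M I M) (space (Pi\<^sub>M I M) \<inter> B)"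
proof -
  interpret prob_space "Pi\<^sub>M I M" by (rule prob_space_PiM) fact
  obtain A' where A': "A' \<in> sets (Pi\<^sub>M J M)"
      "space (Pi\<^sub>M I M) \<inter> A = (\<lambda>\<omega>. restrict \<omega> J) -` A' \<inter> space (Pi\<^sub>M I M)"
    using determined_by_restrict_space[OF A(1,3) prob refl A(2)] by blast
  obtain B' where B': "B' \<in> sets (Pi\<^sub>M K M)"
      "space (Pi\<^sub>M I M) \<inter> B = (\<lambda>\<omega>. restrict \<omega> K) -` B' \<inter> space (Pi\<^sub>M I M)"
    using determined_by_restrict_space[OF B(1,3) prob refl B(2)] by blast
  have "indep_var (Pi\<^sub>M J M) (\<lambda>\<omega>. restrict (\<lambda>i. \<omega> i) J) (Pi\<^sub>M K M) (\<lambda>\<omega>. restrict (\<lambda>i. \<omega> i) K)"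
    by (rule indep_var_restrict[OF PiM_coordinates_indep_vars[OF prob \<open>I \<noteq> {}\<close>] disj A(3) B(3)])
  from indep_varD[OF this A'(1) B'(1)]
  have "prob (((\<lambda>\<omega>. (restrict \<omega> J, restrict \<omega> K)) -` (A' \<times> B')) \<inter> space (Pi\<^sub>M I M))
     = prob (space (Pi\<^sub>M I M) \<inter> A) * prob (space (Pi\<^sub>M I M) \<inter> B)"
    using A'(2) B'(2) by simp
  also have "((\<lambda>\<omega>. (restrict \<omega> J, restrict \<omega> K)) -` (A' \<times> B')) \<inter> space (Pi\<^sub>M I M)
     = (space (Pi\<^sub>M I M) \<inter> A) \<inter> (space (Pi\<^sub>M I M) \<inter> B)"
    unfolding A'(2) B'(2) by auto
  also have "\<dots> = space (Pi\<^sub>M I M) \<inter> A \<inter> B" by auto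
  finally show ?thesis .
qed

text \<open>The form in which product measures are recognised below: a family of independent variables with
  the prescribed laws has the product law.\<close>

lemma distr_PiM_independent:
  assumes "prob_space N" "I \<noteq> {}"
    and ind: "prob_space.indep_vars N M' X I"
    and law: "\<And>i. i \<in> I \<Longrightarrow> distr N (M' i) (X i) = M i"
  shows "distr N (Pi\<^sub>M I M) (\<lambda>\<omega>. \<lambda>i\<in>I. X i \<omega>) = Pi\<^sub>M I M"
proof -
  interpret N: prob_space N by fact
  have rv: "X i \<in> measurable N (M' i)" if "i \<in> I" for i
    using ind that unfolding N.indep_vars_def by auto
  have sets: "sets (Pi\<^sub>M I M) = sets (Pi\<^sub>M I M')"
    by (intro sets_PiM_cong refl) (simp flip: law)
  have "distr N (Pi\<^sub>M I M) (\<lambda>\<omega>. \<lambda>i\<in>I. X i \<omega>) = distr N (Pi\<^sub>M I M') (\<lambda>\<omega>. \<lambda>i\<in>I. X i \<omega>)"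
    by (intro distr_cong refl sets)
  also have "\<dots> = Pi\<^sub>M I (\<lambda>i. distr N (M' i) (X i))"
    using N.indep_vars_iff_distr_eq_PiM'[OF \<open>I \<noteq> {}\<close> rv] ind by auto
  also have "\<dots> = Pi\<^sub>M I M" by (intro PiM_cong refl law)
  finally show ?thesis .
qed

section \<open>Paths and crossings\<close>

type_synonym site = "nat \<times> nat"
text \<open>The bond \<open>(i, n, True)\<close> leads from \<open>(i, n)\<close> to the right, the bond
  \<open>(i, n, False)\<close> leads upwards.\<close>

type_synonym bond = "nat \<times> nat \<times> bool"

fun bond_start :: "bond \<Rightarrow> site" where
  "bond_start (i, n, b) = (i, n)"

fun bond_end :: "bond \<Rightarrow> site" where
  "bond_end (i, n, b) = (if b then (Suc i, n) else (i, Suc n))"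

definition linked :: "(bond \<Rightarrow> bool) \<Rightarrow> site \<Rightarrow> site \<Rightarrow> bool" where
  "linked \<omega> u v \<longleftrightarrow> (\<exists>e. \<omega> e \<and> (bond_start e = u \<and> bond_end e = v \<or> bond_start e = v \<and> bond_end e = u))"

definition conn :: "(bond \<Rightarrow> bool) \<Rightarrow> site set \<Rightarrow> site \<Rightarrow> site \<Rightarrow> bool" where
  "conn \<omega> S u v \<longleftrightarrow> u \<in> S \<and> (u, v) \<in> {(x, y). x \<in> S \<and> y \<in> S \<and> linked \<omega> x y}\<^sup>*"

definition bonds_within :: "site set \<Rightarrow> bond set" where
  "bonds_within S = {e. bond_start e \<in> S \<and> bond_end e \<in> S}"

lemma linked_sym: "linked \<omega> u v \<Longrightarrow> linked \<omega> v u"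
  unfolding linked_def by blast

lemma linked_coords:
  assumes "linked \<omega> u v"
  shows "fst v \<le> Suc (fst u)" "fst u \<le> Suc (fst v)" "snd v \<le> Suc (snd u)" "snd u \<le> Suc (snd v)"
  using assms unfolding linked_def by (auto split: if_splits)

lemma conn_in: "conn \<omega> S u v \<Longrightarrow> u \<in> S \<and> v \<in> S"
proof -
  assume a: "conn \<omega> S u v"
  then have "(u, v) \<in> {(x, y). x \<in> S \<and> y \<in> S \<and> linked \<omega> x y}\<^sup>*" "u \<in> S"
    unfolding conn_def by auto
  then show ?thesis by (induction rule: rtrancl_induct) auto
qed

lemma conn_refl: "u \<in> S \<Longrightarrow> conn \<omega> S u u"
  unfolding conn_def by auto

lemma conn_step: "conn \<omega> S u v \<Longrightarrow> linked \<omega> v x \<Longrightarrow> x \<in> S \<Longrightarrow> conn \<omega> S u x"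
  using conn_in[of \<omega> S u v] unfolding conn_def
  by (auto intro: rtrancl.rtrancl_into_rtrancl)

lemma conn_induct [consumes 1, case_names refl step]:
  assumes "conn \<omega> S u v" "P u"
    and "\<And>v x. conn \<omega> S u v \<Longrightarrow> linked \<omega> v x \<Longrightarrow> x \<in> S \<Longrightarrow> P v \<Longrightarrow> P x"
  shows "P v"
proof -
  have uS: "u \<in> S" and path: "(u, v) \<in> {(x, y). x \<in> S \<and> y \<in> S \<and> linked \<omega> x y}\<^sup>*"
    using assms(1) unfolding conn_def by auto
  from path show ?thesis
  proof (induction rule: rtrancl_induct)
    case base
    show ?case by fact
  next
    case (step y z)
    then show ?case using assms(3)[of y z] uS by (auto simp: conn_def)
  qed
qed

lemma conn_trans: "conn \<omega> S u v \<Longrightarrow> conn \<omega> S v x \<Longrightarrow> conn \<omega> S u x"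
  unfolding conn_def by auto

lemma conn_sym:
  assumes "conn \<omega> S u v"
  shows "conn \<omega> S v u"
  using assms
proof (induction rule: conn_induct)
  case refl
  show ?case using conn_in[OF assms] by (simp add: conn_refl)
next
  case (step v x)
  have "conn \<omega> S x v"
    using conn_step[OF conn_refl[OF step(3)] linked_sym[OF step(2)]] conn_in[OF step(1)] by auto
  then show ?case using step(4) by (rule conn_trans)
qed

lemma conn_mono:
  assumes "conn \<omega> S u v" "S \<subseteq> T"
  shows "conn \<omega> T u v"
  using assms(1)
proof (induction rule: conn_induct)
  case refl
  show ?case using conn_in[OF assms(1)] assms(2) by (auto intro: conn_refl)
next
  case (step v x)
  then show ?case using assms(2) by (auto intro: conn_step)
qed

lemma conn_mono_config:
  assumes "conn \<omega> S u v" "\<And>e. e \<in> bonds_within S \<Longrightarrow> \<omega> e \<Longrightarrow> \<omega>' e"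
  shows "conn \<omega>' S u v"
  using assms(1)
proof (induction rule: conn_induct)
  case refl
  show ?case using assms(1) by (simp add: conn_def)
next
  case (step v x)
  have "v \<in> S" using conn_in[OF step(1)] by simp
  then have "linked \<omega>' v x"
    using step(2,3) assms(2) unfolding linked_def bonds_within_def by blast
  then show ?case using step by (auto intro: conn_step)
qed

lemma conn_cong_config:
  assumes "\<And>e. e \<in> bonds_within S \<Longrightarrow> \<omega> e = \<omega>' e"
  shows "conn \<omega> S u v \<longleftrightarrow> conn \<omega>' S u v"
  using conn_mono_config[of \<omega> S u v \<omega>'] conn_mono_config[of \<omega>' S u v \<omega>] assms by blast

text \<open>Take the piece of the path between its last entrance into the region above level \<open>a\<close> and its
  next visit to level \<open>b\<close>; a coordinate that changes by at most one per step cannot jump over a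
  level.\<close>

lemma conn_crosses_strip:
  fixes f :: "site \<Rightarrow> nat"
  assumes path: "conn \<omega> S u v" and f: "\<And>x y. linked \<omega> x y \<Longrightarrow> f y \<le> Suc (f x)"
    and ab: "f u \<le> a" "b \<le> f v" "a \<le> b"
  shows "\<exists>u' v'. conn \<omega> (S \<inter> {x. a \<le> f x \<and> f x \<le> b}) u' v' \<and> f u' = a \<and> f v' = b"
proof -
  have "a \<le> f v \<longrightarrow> (\<exists>u'. f u' = a \<and> conn \<omega> (S \<inter> {x. a \<le> f x}) u' v)"
    using path
  proof (induction rule: conn_induct)
    case refl
    show ?case
    proof
      assume "a \<le> f u"
      then have "f u = a" using ab by simp
      then show "\<exists>u'. f u' = a \<and> conn \<omega> (S \<inter> {x. a \<le> f x}) u' u"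
        using conn_in[OF path] by (intro exI[of _ u]) (auto intro: conn_refl)
    qed
  next
    case (step v x)
    show ?case
    proof
      assume ax: "a \<le> f x"
      show "\<exists>u'. f u' = a \<and> conn \<omega> (S \<inter> {x. a \<le> f x}) u' x"
      proof (cases "a \<le> f v")
        case True
        then obtain u' where "f u' = a" "conn \<omega> (S \<inter> {x. a \<le> f x}) u' v" using step by blast
        then have "f u' = a \<and> conn \<omega> (S \<inter> {x. a \<le> f x}) u' x"
          using step ax by (auto intro: conn_step)
        then show ?thesis by blast
      next
        case False
        then have "f x = a" using f[OF step(2)] ax by simp
        then have "f x = a \<and> conn \<omega> (S \<inter> {x. a \<le> f x}) x x"
          using step by (auto intro: conn_refl)
        then show ?thesis by blast
      qed
    qed
  qed
  then obtain u' where u': "f u' = a" "conn \<omega> (S \<inter> {x. a \<le> f x}) u' v" using ab by auto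
  let ?T = "S \<inter> {x. a \<le> f x \<and> f x \<le> b}"
  have "conn \<omega> ?T u' v \<or> (\<exists>v'. f v' = b \<and> conn \<omega> ?T u' v')"
    using u'(2)
  proof (induction rule: conn_induct)
    case refl
    then show ?case using conn_in[OF u'(2)] u'(1) ab by (auto intro: conn_refl)
  next
    case (step v x)
    show ?case
    proof (cases "conn \<omega> ?T u' v")
      case True
      show ?thesis
      proof (cases "f x \<le> b")
        case True
        then have "conn \<omega> ?T u' x"
          using step(2,3) \<open>conn \<omega> ?T u' v\<close> by (auto intro: conn_step)
        then show ?thesis by blast
      next
        case False
        then have "f v = b" using f[OF step(2)] conn_in[OF True] by auto
        then show ?thesis using True by blast
      qed
    qed (use step in blast)
  qed
  moreover have "f v = b" if "conn \<omega> ?T u' v"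
    using conn_in[OF that] ab by auto
  ultimately show ?thesis using u'(1) by blast
qed

text \<open>An empty range of columns counts as crossed, so that crossings of consecutive column ranges
  multiply without exceptions.\<close>

definition hcross :: "nat \<Rightarrow> nat \<Rightarrow> nat \<Rightarrow> nat \<Rightarrow> (bond \<Rightarrow> bool) set" where
  "hcross a b y k = {\<omega>. a < b \<longrightarrow>
     (\<exists>u v. conn \<omega> ({a..<b} \<times> {y..<y + k}) u v \<and> fst u = a \<and> Suc (fst v) = b)}"

definition vcross :: "nat \<Rightarrow> nat \<Rightarrow> nat \<Rightarrow> nat \<Rightarrow> (bond \<Rightarrow> bool) set" where
  "vcross a b y k = {\<omega>. 
     (\<exists>u v. conn \<omega> ({a..<b} \<times> {y..<y + k}) u v \<and> snd u = y \<and> Suc (snd v) = y + k)}"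

lemma hcrossI:
  assumes "conn \<omega> S u v" "fst u \<le> a" "b \<le> Suc (fst v)"
    and S: "\<And>x. x \<in> S \<Longrightarrow> a \<le> fst x \<Longrightarrow> fst x < b \<Longrightarrow> y \<le> snd x \<and> snd x < y + k"
  shows "\<omega> \<in> hcross a b y k"
proof (cases "a < b")
  case True
  then obtain u' v' where uv: "conn \<omega> (S \<inter> {x. a \<le> fst x \<and> fst x \<le> b - 1}) u' v'"
      "fst u' = a" "fst v' = b - 1"
    using conn_crosses_strip[OF assms(1), of fst a "b - 1"] assms linked_coords by fastforce
  have "S \<inter> {x. a \<le> fst x \<and> fst x \<le> b - 1} \<subseteq> {a..<b} \<times> {y..<y + k}"
    using S True by force
  then have "conn \<omega> ({a..<b} \<times> {y..<y + k}) u' v'" using uv(1) conn_mono by blast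
  moreover have "Suc (fst v') = b" using uv True by simp
  ultimately show ?thesis using uv True unfolding hcross_def by blast
qed (simp add: hcross_def)

lemma vcrossI:
  assumes "conn \<omega> S u v" "snd u \<le> y" "y + k \<le> Suc (snd v)" "0 < k"
    and S: "\<And>x. x \<in> S \<Longrightarrow> y \<le> snd x \<Longrightarrow> snd x < y + k \<Longrightarrow> a \<le> fst x \<and> fst x < b"
  shows "\<omega> \<in> vcross a b y k"
proof -
  obtain u' v' where uv: "conn \<omega> (S \<inter> {x. y \<le> snd x \<and> snd x \<le> y + k - 1}) u' v'"
      "snd u' = y" "snd v' = y + k - 1"
    using conn_crosses_strip[OF assms(1), of snd y "y + k - 1"] assms linked_coords by fastforce
  have "S \<inter> {x. y \<le> snd x \<and> snd x \<le> y + k - 1} \<subseteq> {a..<b} \<times> {y..<y + k}"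
    using S assms(4) by force
  then have "conn \<omega> ({a..<b} \<times> {y..<y + k}) u' v'" using uv(1) conn_mono by blast
  moreover have "Suc (snd v') = y + k" using uv assms(4) by simp
  ultimately show ?thesis using uv unfolding vcross_def by blast
qed

lemma hcross_determined: "determined_by (bonds_within ({a..<b} \<times> {y..<y + k})) (hcross a b y k)"
  unfolding determined_by_def hcross_def using conn_cong_config by blast

lemma vcross_determined: "determined_by (bonds_within ({a..<b} \<times> {y..<y + k})) (vcross a b y k)"
  unfolding determined_by_def vcross_def using conn_cong_config by blast

lemma bonds_within_disjoint: "S \<inter> T = {} \<Longrightarrow> bonds_within S \<inter> bonds_within T = {}"
  unfolding bonds_within_def by blast

abbreviation configs :: "(bond \<Rightarrow> bool) measure" where
  "configs \<equiv> Pi\<^sub>M UNIV (\<lambda>_. count_space UNIV)"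

definition bern :: "(bond \<Rightarrow> real) \<Rightarrow> (bond \<Rightarrow> bool) measure" where
  "bern r = Pi\<^sub>M UNIV (\<lambda>e. measure_pmf (bernoulli_pmf (r e)))"

lemma space_configs [simp]: "space configs = UNIV"
  by (simp add: space_PiM)

lemma sets_bern [measurable_cong, simp]: "sets (bern r) = sets configs"
  unfolding bern_def by (intro sets_PiM_cong) simp_all

lemma space_bern [simp]: "space (bern r) = UNIV"
  by (simp add: bern_def space_PiM)

lemma prob_space_bern: "prob_space (bern r)"
  unfolding bern_def by (intro prob_space_PiM) (rule prob_space_measure_pmf)

interpretation bern: prob_space "bern r" for r
  by (rule prob_space_bern)

lemma open_bond_measurable [measurable]: "Measurable.pred configs (\<lambda>\<omega>. \<omega> e)"
  by simp

lemma bond_event_measurable: "{\<omega>. \<omega> e = b} \<in> sets configs"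
proof -
  have "{\<omega> \<in> space configs. \<omega> e = b} \<in> sets configs" by measurable
  then show ?thesis by simp
qed

lemma cylinder_measurable:
  assumes "finite F"
  shows "{\<omega>. \<forall>e\<in>F. \<omega> e = b} \<in> sets configs"
proof -
  have "countable F" using assms by (rule countable_finite)
  then have "{\<omega> \<in> space configs. \<forall>e\<in>F. \<omega> e = b} \<in> sets configs" by measurable
  then show ?thesis by simp
qed

lemma linked_measurable [measurable]: "Measurable.pred configs (\<lambda>\<omega>. linked \<omega> u v)"
  unfolding linked_def by measurable

lemma conn_measurable [measurable]: "Measurable.pred configs (\<lambda>\<omega>. conn \<omega> S u v)"
proof -
  have *: "Measurable.pred configs (\<lambda>\<omega>. (u, v) \<in> {(x, y). x \<in> S \<and> y \<in> S \<and> linked \<omega> x y} ^^ n)" for n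
  proof (induction n arbitrary: v)
    case (Suc n)
    have "((u, v) \<in> {(x, y). x \<in> S \<and> y \<in> S \<and> linked \<omega> x y} ^^ Suc n) =
      (\<exists>z. (u, z) \<in> {(x, y). x \<in> S \<and> y \<in> S \<and> linked \<omega> x y} ^^ n \<and> z \<in> S \<and> v \<in> S \<and> linked \<omega> z v)" for \<omega>
      by (auto simp: relcomp_unfold)
    then show ?case using Suc by simp
  qed simp
  show ?thesis
    unfolding conn_def rtrancl_power using * by measurable
qed

lemma hcross_measurable [measurable]: "hcross a b y k \<in> sets configs"
proof -
  have "{\<omega> \<in> space configs. a < b \<longrightarrow>
     (\<exists>u v. conn \<omega> ({a..<b} \<times> {y..<y + k}) u v \<and> fst u = a \<and> Suc (fst v) = b)} \<in> sets configs"
    by measurable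
  then show ?thesis by (simp add: hcross_def)
qed

lemma vcross_measurable [measurable]: "vcross a b y k \<in> sets configs"
proof -
  have "{\<omega> \<in> space configs. 
     (\<exists>u v. conn \<omega> ({a..<b} \<times> {y..<y + k}) u v \<and> snd u = y \<and> Suc (snd v) = y + k)} \<in> sets configs"
    by measurable
  then show ?thesis by (simp add: vcross_def)
qed

lemma bern_prob_Int:
  assumes "A \<in> sets configs" "determined_by J A" "B \<in> sets configs" "determined_by K B" "J \<inter> K = {}"
  shows "measure (bern r) (A \<inter> B) = measure (bern r) A * measure (bern r) B"
proof -
  have "sets (Pi\<^sub>M UNIV (\<lambda>e. measure_pmf (bernoulli_pmf (r e)))) = sets configs"
    using sets_bern[of r] unfolding bern_def .
  then show ?thesis
    using PiM_prob_Int_determined[of UNIV "\<lambda>e. measure_pmf (bernoulli_pmf (r e))" A J B K]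
      assms prob_space_measure_pmf
    unfolding bern_def by (auto simp: space_PiM)
qed

section \<open>Inequalities for crossing probabilities\<close>

lemma bern_bond_prob:
  assumes "0 \<le> r e" "r e \<le> 1"
  shows "measure (bern r) {\<omega>. \<omega> e = b} = (if b then r e else 1 - r e)"
proof -
  have m: "(\<lambda>\<omega>. \<omega> e) \<in> measurable (bern r) (measure_pmf (bernoulli_pmf (r e)))"
    unfolding bern_def by (rule measurable_component_singleton) simp
  have "measure (bern r) {\<omega>. \<omega> e = b} = measure (bern r) ((\<lambda>\<omega>. \<omega> e) -` {b} \<inter> space (bern r))"
    by (rule arg_cong[where f="measure (bern r)"]) auto
  also have "\<dots> = measure (distr (bern r) (measure_pmf (bernoulli_pmf (r e))) (\<lambda>\<omega>. \<omega> e)) {b}"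
    by (rule measure_distr[OF m, symmetric]) simp
  also have "distr (bern r) (measure_pmf (bernoulli_pmf (r e))) (\<lambda>\<omega>. \<omega> e) = measure_pmf (bernoulli_pmf (r e))"
    unfolding bern_def by (rule distr_PiM_component) (auto intro: prob_space_measure_pmf)
  finally show ?thesis using assms by (cases b) (simp_all add: measure_pmf_single)
qed

lemma bern_cylinder_prob:
  assumes "finite F" "\<And>e. e \<in> F \<Longrightarrow> 0 \<le> r e \<and> r e \<le> 1"
  shows "measure (bern r) {\<omega>. \<forall>e\<in>F. \<omega> e = b} = (\<Prod>e\<in>F. if b then r e else 1 - r e)"
  using assms
proof (induction F rule: finite_induct)
  case empty
  then show ?case using bern.prob_space[of r] by simp
next
  case (insert x F)
  note m = bond_event_measurable[of x b] cylinder_measurable[OF insert(1), of b]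
  have "{\<omega>. \<forall>e\<in>insert x F. \<omega> e = b} = {\<omega>. \<omega> x = b} \<inter> {\<omega>. \<forall>e\<in>F. \<omega> e = b}" by auto
  then have "measure (bern r) {\<omega>. \<forall>e\<in>insert x F. \<omega> e = b}
     = measure (bern r) {\<omega>. \<omega> x = b} * measure (bern r) {\<omega>. \<forall>e\<in>F. \<omega> e = b}"
    using bern_prob_Int[OF m(1) _ m(2), of "{x}" F r] insert(2)
    by (auto simp: determined_by_def)
  then show ?case using insert bern_bond_prob[of r x b] by simp
qed

text \<open>Uniform in the height \<open>y\<close>, because the arguments with strips use these bounds at many
  heights at once.\<close>

definition hle :: "(bond \<Rightarrow> real) \<Rightarrow> nat \<Rightarrow> nat \<Rightarrow> nat \<Rightarrow> real \<Rightarrow> bool" where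
  "hle r a b k q \<longleftrightarrow> (\<forall>y. measure (bern r) (hcross a b y k) \<le> q)"

definition vle :: "(bond \<Rightarrow> real) \<Rightarrow> nat \<Rightarrow> nat \<Rightarrow> nat \<Rightarrow> real \<Rightarrow> bool" where
  "vle r a b k q \<longleftrightarrow> (\<forall>y. measure (bern r) (vcross a b y k) \<le> q)"

lemma hle_nonneg: "hle r a b k q \<Longrightarrow> 0 \<le> q"
  unfolding hle_def by (meson measure_nonneg order_trans)

lemma vle_nonneg: "vle r a b k q \<Longrightarrow> 0 \<le> q"
  unfolding vle_def by (meson measure_nonneg order_trans)

lemma hle_weaken: "hle r a b k q \<Longrightarrow> q \<le> q' \<Longrightarrow> hle r a b k q'"
  unfolding hle_def by (meson order_trans)

lemma vle_weaken: "vle r a b k q \<Longrightarrow> q \<le> q' \<Longrightarrow> vle r a b k q'"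
  unfolding vle_def by (meson order_trans)

lemma hle_one: "1 \<le> q \<Longrightarrow> hle r a b k q"
  unfolding hle_def by (meson bern.prob_le_1 order_trans)

lemma hcross_mono:
  assumes "a \<le> a'" "b' \<le> b" "y' \<le> y" "y + k \<le> y' + k'"
  shows "hcross a b y k \<subseteq> hcross a' b' y' k'"
proof
  fix \<omega> assume \<omega>: "\<omega> \<in> hcross a b y k"
  show "\<omega> \<in> hcross a' b' y' k'"
  proof (cases "a' < b'")
    case True
    then obtain u v where "conn \<omega> ({a..<b} \<times> {y..<y + k}) u v" "fst u = a" "Suc (fst v) = b"
      using \<omega> assms unfolding hcross_def by fastforce
    then show ?thesis using assms by (intro hcrossI) auto
  qed (simp add: hcross_def)
qed

lemma vcross_mono:
  assumes "a' \<le> a" "b \<le> b'" "y \<le> y'" "y' + k' \<le> y + k" "0 < k'"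
  shows "vcross a b y k \<subseteq> vcross a' b' y' k'"
proof
  fix \<omega> assume \<omega>: "\<omega> \<in> vcross a b y k"
  then obtain u v where "conn \<omega> ({a..<b} \<times> {y..<y + k}) u v" "snd u = y" "Suc (snd v) = y + k"
    unfolding vcross_def by fastforce
  then show "\<omega> \<in> vcross a' b' y' k'" using assms by (intro vcrossI) auto
qed

lemma hle_mono:
  assumes "hle r a' b' k' q" "a \<le> a'" "b' \<le> b" "k \<le> k'"
  shows "hle r a b k q"
  unfolding hle_def
proof
  fix y :: nat
  have "measure (bern r) (hcross a b y k) \<le> measure (bern r) (hcross a' b' y k')"
    using assms by (intro bern.finite_measure_mono hcross_mono) auto
  then show "measure (bern r) (hcross a b y k) \<le> q"
    using assms(1) unfolding hle_def by (meson order_trans)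
qed

lemma vle_mono:
  assumes "vle r a' b' k' q" "a' \<le> a" "b \<le> b'" "k' \<le> k" "0 < k'"
  shows "vle r a b k q"
  unfolding vle_def
proof
  fix y :: nat
  have "measure (bern r) (vcross a b y k) \<le> measure (bern r) (vcross a' b' y k')"
    using assms by (intro bern.finite_measure_mono vcross_mono) auto
  then show "measure (bern r) (vcross a b y k) \<le> q"
    using assms(1) unfolding vle_def by (meson order_trans)
qed

text \<open>Disjoint ranges of columns use disjoint sets of bonds, and a path that crosses both crosses each
  of them in the same rows.\<close>

lemma hle_mult:
  assumes q: "hle r a b k q" "hle r b c k q'" and abc: "a \<le> b" "b \<le> c"
  shows "hle r a c k (q * q')"
  unfolding hle_def
proof
  fix y :: nat
  have "hcross a c y k \<subseteq> hcross a b y k \<inter> hcross b c y k"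
    using abc hcross_mono[of a a b c y y k k] hcross_mono[of a b c c y y k k] by blast
  then have "measure (bern r) (hcross a c y k) \<le> measure (bern r) (hcross a b y k \<inter> hcross b c y k)"
    by (intro bern.finite_measure_mono) auto
  also have "\<dots> = measure (bern r) (hcross a b y k) * measure (bern r) (hcross b c y k)"
    by (rule bern_prob_Int[OF _ hcross_determined _ hcross_determined])
       (auto intro!: bonds_within_disjoint)
  also have "\<dots> \<le> q * q'"
    using q hle_nonneg[OF q(1)] unfolding hle_def by (intro mult_mono) auto
  finally show "measure (bern r) (hcross a c y k) \<le> q * q'" .
qed

lemma vle_mult:
  assumes q: "vle r a b k q" "vle r a b k' q'" and k: "0 < k" "0 < k'"
  shows "vle r a b (k + k') (q * q')"
  unfolding vle_def
proof
  fix y :: nat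
  have "vcross a b y (k + k') \<subseteq> vcross a b y k \<inter> vcross a b (y + k) k'"
    using k vcross_mono[of a a b b y y k "k + k'"] vcross_mono[of a a b b y "y + k" k' "k + k'"] by auto
  then have "measure (bern r) (vcross a b y (k + k'))
      \<le> measure (bern r) (vcross a b y k \<inter> vcross a b (y + k) k')"
    by (intro bern.finite_measure_mono) auto
  also have "\<dots> = measure (bern r) (vcross a b y k) * measure (bern r) (vcross a b (y + k) k')"
    by (rule bern_prob_Int[OF _ vcross_determined _ vcross_determined])
       (auto intro!: bonds_within_disjoint)
  also have "\<dots> \<le> q * q'"
    using q vle_nonneg[OF q(1)] unfolding vle_def by (intro mult_mono) auto
  finally show "measure (bern r) (vcross a b y (k + k')) \<le> q * q'" .
qed

lemma vle_power:
  assumes "vle r a b k q" "0 < k" "0 < m"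
  shows "vle r a b (m * k) (q ^ m)"
  using assms(3)
proof (induction m rule: nat_induct_non_zero)
  case (Suc m)
  show ?case
    using vle_mult[OF assms(1) Suc(2)] assms(2) Suc(1) by simp
qed (use assms in simp)

lemma hle_blocks:
  assumes "a \<le> b" "\<And>i. a \<le> i \<Longrightarrow> i < b \<Longrightarrow> hle r (i * W) (Suc i * W) k q"
  shows "hle r (a * W) (b * W) k (q ^ (b - a))"
  using assms
proof (induction b rule: dec_induct)
  case base
  then show ?case by (simp add: hle_one)
next
  case (step n)
  have "hle r (a * W) (Suc n * W) k (q ^ (n - a) * q)"
    using step by (intro hle_mult[of _ _ "n * W"]) auto
  moreover have "q ^ (n - a) * q = q ^ (Suc n - a)"
    using step(1) by (simp add: Suc_diff_le)
  ultimately show ?case by simp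
qed

lemma conn_Int:
  assumes "conn \<omega> S u v" "\<And>x. conn \<omega> S u x \<Longrightarrow> x \<in> T"
  shows "conn \<omega> (S \<inter> T) u v"
  using assms(1)
proof (induction rule: conn_induct)
  case refl
  have "conn \<omega> S u u" using conn_in[OF assms(1)] by (simp add: conn_refl)
  then show ?case using assms(2) conn_in by (intro conn_refl) blast
next
  case (step v x)
  then show ?case using assms(2) conn_step[OF step(1-3)] by (intro conn_step[OF step(4)]) auto
qed

text \<open>Cut the rectangle into strips of height \<open>k\<close> and follow the crossing from the strip in which it
  starts: as long as it does not cross one of the two neighbouring strips vertically, it stays in
  three consecutive strips.\<close>

lemma hcross_windows:
  assumes "0 < k" "a < b"
  shows "hcross a b y (M * k) \<subseteq> (\<Union>m<M. hcross a b (y + (m - 1) * k) (3 * k)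
    \<union> (vcross a b (y + (m - 1) * k) k \<union> vcross a b (y + (m + 1) * k) k))"
proof
  fix \<omega> assume "\<omega> \<in> hcross a b y (M * k)"
  then obtain u v where uv: "conn \<omega> ({a..<b} \<times> {y..<y + M * k}) u v" "fst u = a" "Suc (fst v) = b"
    using assms unfolding hcross_def by auto
  let ?S = "{a..<b} \<times> {y..<y + M * k}"
  \<comment> \<open>the strip in which the crossing starts; for \<open>m = 0\<close> there is no strip below, and \<open>m - 1\<close> is 0\<close>
  define m where "m = (snd u - y) div k"
  have u: "y \<le> snd u" "snd u < y + M * k" using conn_in[OF uv(1)] by auto
  then have mM: "m < M" unfolding m_def using assms(1) by (simp add: less_mult_imp_div_less)
  have u1: "y + m * k \<le> snd u" "snd u < y + (m + 1) * k"
  proof -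
    have "m * k \<le> snd u - y" unfolding m_def by (rule div_times_less_eq_dividend)
    then show "y + m * k \<le> snd u" using u by simp
    have "snd u - y < Suc m * k" unfolding m_def using assms(1) by (rule dividend_less_div_times[of k "snd u - y", simplified add.commute, THEN order_less_le_trans]) simp
    then show "snd u < y + (m + 1) * k" using u by simp
  qed
  let ?lo = "y + (m - 1) * k"
  have lo: "?lo \<le> snd u" "snd u < ?lo + 2 * k" "y + (m + 1) * k \<le> ?lo + 2 * k"
    using u1 by (cases m; simp add: algebra_simps)+
  have up: "y + (m + 1) * k + k \<le> ?lo + 3 * k" by (cases m) auto
  consider (inside) "\<And>x. conn \<omega> ?S u x \<Longrightarrow> ?lo \<le> snd x \<and> snd x < ?lo + 3 * k"
    | (below) x where "conn \<omega> ?S u x" "snd x < ?lo"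
    | (above) x where "conn \<omega> ?S u x" "?lo + 3 * k \<le> snd x"
    by (meson leI)
  then have "\<omega> \<in> hcross a b ?lo (3 * k)
    \<union> (vcross a b ?lo k \<union> vcross a b (y + (m + 1) * k) k)"
  proof cases
    case inside
    then have "conn \<omega> (?S \<inter> UNIV \<times> {?lo..<?lo + 3 * k}) u v"
      using uv(1) by (intro conn_Int) (auto simp: mem_Times_iff)
    then have "\<omega> \<in> hcross a b ?lo (3 * k)"
      by (rule hcrossI) (use uv in auto)
    then show ?thesis by simp
  next
    case below
    then have "0 < m" using conn_in[OF below(1)] by (cases m) auto
    then have "?lo + k \<le> snd u" using u1 by (cases m) auto
    then have "\<omega> \<in> vcross a b ?lo k"
      using below(2) assms(1) by (intro vcrossI[OF conn_sym[OF below(1)]]) auto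
    then show ?thesis by simp
  next
    case above
    have "\<omega> \<in> vcross a b (y + (m + 1) * k) k"
      using above(2) assms(1) up u1 by (intro vcrossI[OF above(1)]) auto
    then show ?thesis by simp
  qed
  then show "\<omega> \<in> (\<Union>m<M. hcross a b (y + (m - 1) * k) (3 * k)
    \<union> (vcross a b (y + (m - 1) * k) k \<union> vcross a b (y + (m + 1) * k) k))"
    using mM by blast
qed

lemma hle_window:
  assumes "hle r a b (3 * k) q" "vle r a b k q'" "0 < k" "a < b"
  shows "hle r a b (M * k) (M * (q + 2 * q'))"
  unfolding hle_def
proof
  fix y :: nat
  let ?A = "\<lambda>m. hcross a b (y + (m - 1) * k) (3 * k)
    \<union> (vcross a b (y + (m - 1) * k) k \<union> vcross a b (y + (m + 1) * k) k)"
  have A: "measure (bern r) (?A m) \<le> q + 2 * q'" for m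
  proof -
    have "measure (bern r) (?A m) \<le> measure (bern r) (hcross a b (y + (m - 1) * k) (3 * k))
       + (measure (bern r) (vcross a b (y + (m - 1) * k) k) + measure (bern r) (vcross a b (y + (m + 1) * k) k))"
      by (intro order_trans[OF measure_Un_le] add_left_mono measure_Un_le)
        auto
    also have "\<dots> \<le> q + (q' + q')"
      using assms unfolding hle_def vle_def by (intro add_mono) auto
    finally show ?thesis by simp
  qed
  have "measure (bern r) (hcross a b y (M * k)) \<le> measure (bern r) (\<Union>m<M. ?A m)"
    by (intro bern.finite_measure_mono hcross_windows assms) auto
  also have "\<dots> \<le> (\<Sum>m<M. measure (bern r) (?A m))"
    by (intro bern.finite_measure_subadditive_finite) auto
  also have "\<dots> \<le> (\<Sum>m<M. q + 2 * q')" by (intro sum_mono A)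
  finally show "measure (bern r) (hcross a b y (M * k)) \<le> M * (q + 2 * q')" by simp
qed

lemma conn_column_extent:
  assumes "conn \<omega> S u v" "\<And>x. x \<in> S \<Longrightarrow> fst x < b"
  shows "\<exists>p p'. conn \<omega> S u p \<and> conn \<omega> S u p' \<and>
    (\<forall>x. conn \<omega> S u x \<longrightarrow> fst p \<le> fst x \<and> fst x \<le> fst p')"
proof -
  have u: "conn \<omega> S u u" using conn_in[OF assms(1)] by (simp add: conn_refl)
  obtain p where p: "conn \<omega> S u p" "\<And>x. conn \<omega> S u x \<Longrightarrow> fst p \<le> fst x"
    using ex_has_least_nat[of "conn \<omega> S u" u fst] u by blast
  obtain p' where p': "conn \<omega> S u p'" "\<And>x. conn \<omega> S u x \<Longrightarrow> fst x \<le> fst p'"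
    using ex_has_greatest_nat[of "conn \<omega> S u" u fst b] u assms(2) conn_in
    by (metis less_imp_le_nat)
  show ?thesis using p p' by blast
qed

text \<open>Compare the leftmost and the rightmost block that the path visits: if they are neither equal nor
  neighbours, then the path crosses the block that follows the leftmost one.\<close>

lemma vcross_blocks:
  assumes "a + 2 \<le> b" "0 < k"
  shows "vcross (a * W) (b * W) y k \<subseteq> (\<Union>i\<in>{a..<b}. hcross (i * W) (Suc i * W) y k)
     \<union> (\<Union>i\<in>{a..<b - 1}. vcross (i * W) (Suc (Suc i) * W) y k)"
proof
  fix \<omega> assume "\<omega> \<in> vcross (a * W) (b * W) y k"
  then obtain u v where uv: "conn \<omega> ({a * W..<b * W} \<times> {y..<y + k}) u v" "snd u = y" "Suc (snd v) = y + k"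
    unfolding vcross_def by auto
  let ?S = "{a * W..<b * W} \<times> {y..<y + k}"
  obtain p p' where p: "conn \<omega> ?S u p" "conn \<omega> ?S u p'"
    "\<And>x. conn \<omega> ?S u x \<Longrightarrow> fst p \<le> fst x \<and> fst x \<le> fst p'"
    using conn_column_extent[OF uv(1), of "b * W"] by (metis mem_Times_iff atLeastLessThan_iff)
  define i j where "i = fst p div W" and "j = fst p' div W"
  have pS: "a * W \<le> fst p" "fst p < b * W" "a * W \<le> fst p'" "fst p' < b * W"
    using conn_in[OF p(1)] conn_in[OF p(2)] by auto
  then have W: "0 < W" by (cases W) auto
  have i: "i * W \<le> fst p" "fst p < Suc i * W" "a \<le> i" "i < b"
    using pS W unfolding i_def
    by (auto simp: dividend_less_div_times[OF W, THEN order_less_le_trans] less_mult_imp_div_less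
        div_less_iff_less_mult less_eq_div_iff_mult_less_eq dividend_less_times_div algebra_simps)
  have j: "j * W \<le> fst p'" "fst p' < Suc j * W" "j < b"
    using pS W unfolding j_def
    by (auto simp: dividend_less_div_times[OF W, THEN order_less_le_trans] less_mult_imp_div_less
        div_less_iff_less_mult less_eq_div_iff_mult_less_eq dividend_less_times_div algebra_simps)
  show "\<omega> \<in> (\<Union>i\<in>{a..<b}. hcross (i * W) (Suc i * W) y k)
     \<union> (\<Union>i\<in>{a..<b - 1}. vcross (i * W) (Suc (Suc i) * W) y k)"
  proof (cases "i + 2 \<le> j")
    case True
    have "conn \<omega> ?S p p'" using p conn_sym conn_trans by blast
    moreover have "Suc (Suc i) * W \<le> j * W" using True by (intro mult_right_mono) auto
    ultimately have "\<omega> \<in> hcross (Suc i * W) (Suc (Suc i) * W) y k"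
      using i j by (intro hcrossI) auto
    moreover have "Suc i \<in> {a..<b}" using True i j by auto
    ultimately show ?thesis by blast
  next
    case False
    \<comment> \<open>in the last block of the run the pair that ends there has to be used\<close>
    define i' where "i' = min i (b - 2)"
    have i': "i' \<in> {a..<b - 1}" using i assms by (auto simp: i'_def)
    have "i' * W \<le> fst p" using i(1) unfolding i'_def by (meson min.cobounded1 mult_le_mono1 order_trans)
    moreover have "fst p' < Suc (Suc i') * W"
    proof -
      have "Suc j \<le> Suc (Suc i')" using False j assms by (auto simp: i'_def)
      then have "Suc j * W \<le> Suc (Suc i') * W" by (rule mult_le_mono1)
      then show ?thesis using j(2) by linarith
    qed
    ultimately have "conn \<omega> (?S \<inter> {i' * W..<Suc (Suc i') * W} \<times> UNIV) u v"
      using p(3) by (intro conn_Int[OF uv(1)]) (fastforce simp: mem_Times_iff)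
    then have "\<omega> \<in> vcross (i' * W) (Suc (Suc i') * W) y k"
      by (rule vcrossI) (use uv assms in auto)
    then show ?thesis using i' by blast
  qed
qed

lemma vle_blocks:
  assumes ab: "a + 2 \<le> b" "0 < k"
    and h: "\<And>i. a \<le> i \<Longrightarrow> i < b \<Longrightarrow> hle r (i * W) (Suc i * W) k q"
    and v: "\<And>i. a \<le> i \<Longrightarrow> Suc i < b \<Longrightarrow> vle r (i * W) (Suc (Suc i) * W) k q"
  shows "vle r (a * W) (b * W) k (2 * real (b - a) * q)"
  unfolding vle_def
proof
  fix y :: nat
  have q: "0 \<le> q" using h[of a] ab hle_nonneg by auto
  let ?H = "\<Union>i\<in>{a..<b}. hcross (i * W) (Suc i * W) y k"
  let ?V = "\<Union>i\<in>{a..<b - 1}. vcross (i * W) (Suc (Suc i) * W) y k"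
  have "measure (bern r) ?H \<le> (\<Sum>i\<in>{a..<b}. measure (bern r) (hcross (i * W) (Suc i * W) y k))"
    by (intro bern.finite_measure_subadditive_finite) auto
  also have "\<dots> \<le> (\<Sum>i\<in>{a..<b}. q)" by (intro sum_mono) (use h in \<open>auto simp: hle_def\<close>)
  finally have H: "measure (bern r) ?H \<le> real (b - a) * q" by simp
  have "measure (bern r) ?V \<le> (\<Sum>i\<in>{a..<b - 1}. measure (bern r) (vcross (i * W) (Suc (Suc i) * W) y k))"
    by (intro bern.finite_measure_subadditive_finite) auto
  also have "\<dots> \<le> (\<Sum>i\<in>{a..<b - 1}. q)" by (intro sum_mono) (use v in \<open>auto simp: vle_def\<close>)
  also have "\<dots> = real (b - 1 - a) * q" by simp
  also have "\<dots> \<le> real (b - a) * q" using q by (intro mult_right_mono) auto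
  finally have V: "measure (bern r) ?V \<le> real (b - a) * q" .
  have "measure (bern r) (vcross (a * W) (b * W) y k) \<le> measure (bern r) (?H \<union> ?V)"
    by (intro bern.finite_measure_mono vcross_blocks ab) auto
  also have "\<dots> \<le> measure (bern r) ?H + measure (bern r) ?V"
    by (intro measure_Un_le) auto
  finally show "measure (bern r) (vcross (a * W) (b * W) y k) \<le> 2 * real (b - a) * q"
    using H V by simp
qed

text \<open>A vertical path that does not stay between the outer ends of the two buffers
  \<open>{l0..<l1}\<close> and \<open>{r0..<r1}\<close> either crosses one of them horizontally or lives
  entirely on the outer side of its inner end.\<close>

lemma vcross_buffers:
  assumes "0 < k"
  shows "vcross a b y k \<subseteq> vcross l0 r1 y k
     \<union> ((if a < l0 then vcross a l1 y k \<union> hcross l0 l1 y k else {})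
     \<union> (if r1 < b then vcross r0 b y k \<union> hcross r0 r1 y k else {}))"
proof
  fix \<omega> assume "\<omega> \<in> vcross a b y k"
  then obtain u v where uv: "conn \<omega> ({a..<b} \<times> {y..<y + k}) u v" "snd u = y" "Suc (snd v) = y + k"
    unfolding vcross_def by auto
  let ?S = "{a..<b} \<times> {y..<y + k}"
  obtain p p' where p: "conn \<omega> ?S u p" "conn \<omega> ?S u p'"
    "\<And>x. conn \<omega> ?S u x \<Longrightarrow> fst p \<le> fst x \<and> fst x \<le> fst p'"
    using conn_column_extent[OF uv(1), of b] by (metis mem_Times_iff atLeastLessThan_iff)
  have pS: "a \<le> fst p" "fst p < b" "a \<le> fst p'" "fst p' < b"
    using conn_in[OF p(1)] conn_in[OF p(2)] by auto
  have pp: "conn \<omega> ?S p p'" using p conn_sym conn_trans by blast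
  have confined: "\<omega> \<in> vcross c d y k" if "c \<le> fst p" "fst p' < d" for c d
  proof -
    have "conn \<omega> (?S \<inter> {c..<d} \<times> UNIV) u v"
      using p(3) that by (intro conn_Int[OF uv(1)]) (fastforce simp: mem_Times_iff)
    then show ?thesis by (rule vcrossI) (use uv assms in auto)
  qed
  have crosses: "\<omega> \<in> hcross c d y k" if "fst p \<le> c" "d \<le> Suc (fst p')" for c d
    using pp by (rule hcrossI) (use that in auto)
  show "\<omega> \<in> vcross l0 r1 y k
     \<union> ((if a < l0 then vcross a l1 y k \<union> hcross l0 l1 y k else {})
     \<union> (if r1 < b then vcross r0 b y k \<union> hcross r0 r1 y k else {}))"
  proof (cases "l0 \<le> fst p \<and> fst p' < r1")
    case True
    then show ?thesis using confined by blast
  next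
    case False
    then consider (left) "fst p < l0" | (right) "r1 \<le> fst p'" by linarith
    then show ?thesis
    proof cases
      case left
      then have "a < l0" using pS by simp
      then show ?thesis using confined[of a l1] crosses[of l0 l1] left pS
        by (cases "fst p' < l1") auto
    next
      case right
      then have "r1 < b" using pS by simp
      then show ?thesis using confined[of r0 b] crosses[of r0 r1] right pS
        by (cases "r0 \<le> fst p") auto
    qed
  qed
qed

lemma vle_buffers:
  assumes "0 < k" and mid: "vle r l0 r1 k q1"
    and left: "a < l0 \<Longrightarrow> vle r a l1 k q2 \<and> hle r l0 l1 k q3"
    and right: "r1 < b \<Longrightarrow> vle r r0 b k q2 \<and> hle r r0 r1 k q3"
    and q: "0 \<le> q2" "0 \<le> q3"
  shows "vle r a b k (q1 + 2 * (q2 + q3))"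
  unfolding vle_def
proof
  fix y :: nat
  let ?L = "if a < l0 then vcross a l1 y k \<union> hcross l0 l1 y k else {}"
  let ?R = "if r1 < b then vcross r0 b y k \<union> hcross r0 r1 y k else {}"
  have L: "measure (bern r) ?L \<le> q2 + q3"
  proof (cases "a < l0")
    case True
    have "measure (bern r) (vcross a l1 y k \<union> hcross l0 l1 y k)
      \<le> measure (bern r) (vcross a l1 y k) + measure (bern r) (hcross l0 l1 y k)"
      by (intro measure_Un_le) auto
    also have "\<dots> \<le> q2 + q3"
      using left[OF True] unfolding hle_def vle_def by (intro add_mono) auto
    finally show ?thesis using True by simp
  qed (use q in simp)
  have R: "measure (bern r) ?R \<le> q2 + q3"
  proof (cases "r1 < b")
    case True
    have "measure (bern r) (vcross r0 b y k \<union> hcross r0 r1 y k)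
      \<le> measure (bern r) (vcross r0 b y k) + measure (bern r) (hcross r0 r1 y k)"
      by (intro measure_Un_le) auto
    also have "\<dots> \<le> q2 + q3"
      using right[OF True] unfolding hle_def vle_def by (intro add_mono) auto
    finally show ?thesis using True by simp
  qed (use q in simp)
  have "measure (bern r) (vcross a b y k) \<le> measure (bern r) (vcross l0 r1 y k \<union> (?L \<union> ?R))"
    by (intro bern.finite_measure_mono vcross_buffers assms) auto
  also have "\<dots> \<le> measure (bern r) (vcross l0 r1 y k) + (measure (bern r) ?L + measure (bern r) ?R)"
    by (intro order_trans[OF measure_Un_le] add_left_mono measure_Un_le)
      auto
  also have "\<dots> \<le> q1 + ((q2 + q3) + (q2 + q3))"
    using mid L R unfolding vle_def by (intro add_mono) auto
  finally show "measure (bern r) (vcross a b y k) \<le> q1 + 2 * (q2 + q3)" by simp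
qed

text \<open>\<open>X i\<close> is additive: the vertical bonds of one level in several columns are all closed
  with probability \<open>exp\<close> of minus the sum of the \<open>X i\<close>.\<close>

definition column_probs :: "(nat \<Rightarrow> real) \<Rightarrow> (nat \<Rightarrow> real) \<Rightarrow> bond \<Rightarrow> real" where
  "column_probs w X = (\<lambda>(i, n, b). if b then w i else 1 - exp (- X i))"

text \<open>A path that moves up by one row uses one of the vertical bonds between the two rows.\<close>

lemma vle_straight:
  assumes X: "\<And>i. 0 \<le> X i" and sum: "(\<Sum>i\<in>{a..<b}. X i) \<le> \<sigma>"
  shows "vle (column_probs w X) a b 2 (1 - exp (- \<sigma>))"
  unfolding vle_def
proof
  fix y :: nat
  let ?r = "column_probs w X"
  let ?F = "(\<lambda>i. (i, y, False)) ` {a..<b}"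
  let ?C = "{\<omega> :: bond \<Rightarrow> bool. \<forall>e\<in>?F. \<omega> e = False}"
  have C: "?C \<in> sets configs" by (rule cylinder_measurable) simp
  have "measure (bern ?r) ?C = (\<Prod>e\<in>?F. if False then ?r e else 1 - ?r e)"
    using X by (intro bern_cylinder_prob) (auto simp: column_probs_def)
  also have "\<dots> = (\<Prod>i\<in>{a..<b}. exp (- X i))"
    by (subst prod.reindex) (auto simp: inj_on_def column_probs_def)
  also have "\<dots> = exp (- (\<Sum>i\<in>{a..<b}. X i))"
    by (simp add: exp_sum sum_negf flip: sum_negf)
  finally have PC: "exp (- \<sigma>) \<le> measure (bern ?r) ?C" using sum by simp
  have "vcross a b y 2 \<subseteq> UNIV - ?C"
  proof
    fix \<omega> assume "\<omega> \<in> vcross a b y 2"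
    then obtain u v where uv: "conn \<omega> ({a..<b} \<times> {y..<y + 2}) u v" "snd u = y" "Suc (snd v) = y + 2"
      unfolding vcross_def by auto
    have "\<omega> \<in> ?C \<Longrightarrow> snd v = y"
      using uv(1)
    proof (induction rule: conn_induct)
      case refl
      show ?case by (rule uv)
    next
      case (step v x)
      then have *: "snd v = y" "fst v \<in> {a..<b}" "fst x \<in> {a..<b}" "y \<le> snd x" 
        using conn_in[OF step(1)] by auto
      obtain e where e: "\<omega> e" "bond_start e = v \<and> bond_end e = x \<or> bond_start e = x \<and> bond_end e = v"
        using step(2) unfolding linked_def by blast
      obtain i n c where [simp]: "e = (i, n, c)" by (cases e) auto
      show ?case
      proof (cases c)
        case True
        then show ?thesis using e * by auto
      next
        case False
        then have "(i, n, False) \<notin> ?F" using e(1) step(5) by auto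
        then show ?thesis using e * False by auto
      qed
    qed
    then show "\<omega> \<in> UNIV - ?C" using uv(3) by auto
  qed
  then have "measure (bern ?r) (vcross a b y 2) \<le> measure (bern ?r) (space (bern ?r) - ?C)"
    using C by (intro bern.finite_measure_mono sets.compl_sets) auto
  also have "\<dots> = 1 - measure (bern ?r) ?C"
    by (rule bern.prob_compl) (unfold sets_bern, rule C)
  finally show "measure (bern ?r) (vcross a b y 2) \<le> 1 - exp (- \<sigma>)" using PC by simp
qed

lemma hle_base:
  assumes w: "0 \<le> w a" "w a \<le> 1" and ab: "Suc a < b"
  shows "hle (column_probs w X) a b k (k * w a)"
  unfolding hle_def
proof
  fix y :: nat
  let ?r = "column_probs w X"
  let ?A = "\<lambda>t. {\<omega>. \<omega> (a, t, True) = True}"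
  have A: "?A t \<in> sets configs" for t by (rule bond_event_measurable)
  have "hcross a b y k \<subseteq> (\<Union>t\<in>{y..<y + k}. ?A t)"
  proof
    fix \<omega> assume "\<omega> \<in> hcross a b y k"
    then obtain u v where uv: "conn \<omega> ({a..<b} \<times> {y..<y + k}) u v" "fst u = a" "Suc (fst v) = b"
      using ab unfolding hcross_def by auto
    show "\<omega> \<in> (\<Union>t\<in>{y..<y + k}. ?A t)"
    proof (rule ccontr)
      assume no: "\<omega> \<notin> (\<Union>t\<in>{y..<y + k}. ?A t)"
      have "fst v = a"
        using uv(1)
      proof (induction rule: conn_induct)
        case refl
        show ?case by (rule uv)
      next
        case (step v x)
        then have *: "fst v = a" "snd v \<in> {y..<y + k}" "snd x \<in> {y..<y + k}" "a \<le> fst x" 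
          using conn_in[OF step(1)] by auto
        obtain e where e: "\<omega> e" "bond_start e = v \<and> bond_end e = x \<or> bond_start e = x \<and> bond_end e = v"
          using step(2) unfolding linked_def by blast
        obtain i n c where [simp]: "e = (i, n, c)" by (cases e) auto
        show ?case
        proof (cases c)
          case True
          then have "i \<noteq> a \<or> n \<notin> {y..<y + k}" using e(1) no by auto
          then show ?thesis using e * True by auto
        next
          case False
          then show ?thesis using e * by auto
        qed
      qed
      then show False using uv(3) ab by simp
    qed
  qed
  then have "measure (bern ?r) (hcross a b y k) \<le> measure (bern ?r) (\<Union>t\<in>{y..<y + k}. ?A t)"
    using A by (intro bern.finite_measure_mono) auto
  also have "\<dots> \<le> (\<Sum>t\<in>{y..<y + k}. measure (bern ?r) (?A t))"
    using A by (intro bern.finite_measure_subadditive_finite) auto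
  also have "\<dots> = (\<Sum>t\<in>{y..<y + k}. w a)"
    using w by (subst bern_bond_prob) (auto simp: column_probs_def)
  finally show "measure (bern ?r) (hcross a b y k) \<le> k * w a" by simp
qed

section \<open>One renormalisation step\<close>

text \<open>Goodness concerns two neighbouring blocks because a path can climb along their common boundary
  without crossing either of them.\<close>

definition good_pair :: "(bond \<Rightarrow> real) \<Rightarrow> nat \<Rightarrow> nat \<Rightarrow> real \<Rightarrow> nat \<Rightarrow> bool" where
  "good_pair r W H q k \<longleftrightarrow> hle r (k * W) (Suc k * W) (3 * H) q
     \<and> hle r (Suc k * W) (Suc (Suc k) * W) (3 * H) q
     \<and> vle r (k * W) (Suc (Suc k) * W) H q"

text \<open>In a run of good blocks a vertical path crosses a block or is confined to two of them, hence
  \<open>good_run_v\<close>; repeating the bound in \<open>2 * R\<close> strips gives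
  \<open>good_run_v_tall\<close>, which is as small as the cost of crossing the whole run. A horizontal
  crossing of a run multiplies the costs of its blocks, each increased by a factor \<open>18 * R\<close> for
  the choice of a strip; only afterwards is the height enlarged by the factor \<open>M\<close>, at a cost of
  \<open>M\<close> for the whole run and not for each block.\<close>

lemma good_run:
  assumes good: "\<And>k. a \<le> k \<Longrightarrow> Suc k < b \<Longrightarrow> good_pair r W H q k"
    and ab: "a + 2 \<le> b" "b - a \<le> 2 * R" and pos: "0 < W" "0 < H"
    and q: "18 * real R * q \<le> 1"
  shows good_run_v: "vle r (a * W) (b * W) H (4 * real R * q)"
    and good_run_v_tall: "vle r (a * W) (b * W) (2 * R * H) ((18 * real R * q) ^ (b - a))"
    and good_run_h: "hle r (a * W) (b * W) (M * (2 * R * H)) (3 * real M * (18 * real R * q) ^ (b - a))"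
proof -
  have R: "0 < R" using ab by simp
  have q0: "0 \<le> q" using good[of a] ab hle_nonneg unfolding good_pair_def by auto
  have block_h: "hle r (i * W) (Suc i * W) (3 * H) q" if "a \<le> i" "i < b" for i
  proof (cases "Suc i < b")
    case True
    then show ?thesis using good[of i] that unfolding good_pair_def by blast
  next
    case False
    then have "i = Suc (i - 1)" "a \<le> i - 1" "Suc (i - 1) < b" using that ab by auto
    then obtain j where j: "i = Suc j" "a \<le> j" "Suc j < b" by blast
    then show ?thesis using good[of j] unfolding good_pair_def by blast
  qed
  have block_v: "vle r (i * W) (Suc i * W) H q" if "a \<le> i" "i < b" for i
  proof (cases "Suc i < b")
    case True
    then have "vle r (i * W) (Suc (Suc i) * W) H q"
      using good[of i] that unfolding good_pair_def by blast
    then show ?thesis by (rule vle_mono) (use pos in auto)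
  next
    case False
    then have "i = Suc (i - 1)" "a \<le> i - 1" "Suc (i - 1) < b" using that ab by auto
    then obtain j where j: "i = Suc j" "a \<le> j" "Suc j < b" by blast
    then have "vle r (j * W) (Suc (Suc j) * W) H q" using good[of j] unfolding good_pair_def by blast
    then show ?thesis by (rule vle_mono) (use pos j in auto)
  qed
  have "vle r (a * W) (b * W) H (2 * real (b - a) * q)"
  proof (rule vle_blocks)
    fix i assume "a \<le> i" "i < b"
    from block_h[OF this] show "hle r (i * W) (Suc i * W) H q" by (rule hle_mono) auto
  next
    fix i assume "a \<le> i" "Suc i < b"
    from good[OF this] show "vle r (i * W) (Suc (Suc i) * W) H q" unfolding good_pair_def by blast
  qed (use ab pos in auto)
  moreover have "2 * real (b - a) * q \<le> 4 * real R * q"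
    using ab q0 by (intro mult_right_mono) auto
  ultimately show v: "vle r (a * W) (b * W) H (4 * real R * q)" by (rule vle_weaken)
  have "vle r (a * W) (b * W) ((2 * R) * H) ((4 * real R * q) ^ (2 * R))"
    using v pos R by (intro vle_power) auto
  moreover have "(4 * real R * q) ^ (2 * R) \<le> (18 * real R * q) ^ (b - a)"
  proof -
    have "(4 * real R * q) ^ (2 * R) \<le> (18 * real R * q) ^ (2 * R)"
      using q0 by (intro power_mono mult_right_mono) auto
    also have "\<dots> \<le> (18 * real R * q) ^ (b - a)"
      using q0 q ab by (intro power_decreasing) auto
    finally show ?thesis .
  qed
  ultimately show vt: "vle r (a * W) (b * W) (2 * R * H) ((18 * real R * q) ^ (b - a))"
    by (rule vle_weaken)
  have "hle r (i * W) (Suc i * W) (6 * R * H) (18 * real R * q)" if "a \<le> i" "i < b" for i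
    using hle_window[OF block_h[OF that] block_v[OF that], of "6 * R"] pos by (simp add: algebra_simps)
  then have "hle r (a * W) (b * W) (6 * R * H) ((18 * real R * q) ^ (b - a))"
    using ab by (intro hle_blocks) auto
  then have "hle r (a * W) (b * W) (3 * (2 * R * H)) ((18 * real R * q) ^ (b - a))"
    by (simp add: algebra_simps)
  from hle_window[OF this vt, of M]
  show "hle r (a * W) (b * W) (M * (2 * R * H)) (3 * real M * (18 * real R * q) ^ (b - a))"
    using pos R ab by (simp add: algebra_simps)
qed

text \<open>A single block need not belong to a good pair; lowering the exponent by one makes the bound hold
  for it as well.\<close>

lemma good_run_h_any:
  assumes good: "\<And>k. a \<le> k \<Longrightarrow> Suc k < b \<Longrightarrow> good_pair r W H q k"
    and "b - a \<le> 2 * R" "0 < W" "0 < H" "18 * real R * q \<le> 1" "1 \<le> M" "0 \<le> q"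
  shows "hle r (a * W) (b * W) (M * (2 * R * H)) (3 * real M * (18 * real R * q) ^ (b - a - 1))"
proof (cases "a + 2 \<le> b")
  case True
  have "(18 * real R * q) ^ (b - a) \<le> (18 * real R * q) ^ (b - a - 1)"
    using assms by (intro power_decreasing) auto
  then have "3 * real M * (18 * real R * q) ^ (b - a) \<le> 3 * real M * (18 * real R * q) ^ (b - a - 1)"
    by (intro mult_left_mono) auto
  then show ?thesis using good_run_h[OF good True assms(2-5)] by (rule hle_weaken[rotated])
next
  case False
  then have "b - a - 1 = 0" by simp
  then show ?thesis using assms(6) by (intro hle_one) simp
qed

lemma one_minus_exp_power_le:
  fixes \<sigma> :: real
  assumes "4 * exp \<sigma> \<le> real m" "0 \<le> \<sigma>"
  shows "(1 - exp (- \<sigma>)) ^ m \<le> exp (- 4)"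
proof -
  have "(1 - exp (- \<sigma>)) ^ m \<le> exp (- exp (- \<sigma>)) ^ m"
    using exp_ge_add_one_self[of "- exp (- \<sigma>)"] assms(2) by (intro power_mono) auto
  also have "\<dots> = exp (- (real m * exp (- \<sigma>)))" by (simp flip: exp_of_nat_mult)
  also have "\<dots> \<le> exp (- 4)"
  proof -
    have "4 * exp \<sigma> * exp (- \<sigma>) \<le> real m * exp (- \<sigma>)" using assms by (intro mult_right_mono) auto
    then show ?thesis by (simp add: mult.assoc flip: exp_add)
  qed
  finally show ?thesis .
qed

text \<open>One step of the renormalisation, for the block of columns
  \<open>{A * W..<(A + 2 * R) * W}\<close>. Two bad pairs always overlap, so all bad pairs contain the
  same block \<open>Suc k0\<close> and the blocks on either side of it form two good runs;
  \<open>window\<close> bounds the sum of \<open>X\<close> within distance \<open>l\<close> blocks of any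
  block.\<close>

locale block_step =
  fixes w X :: "nat \<Rightarrow> real" and W H R l A :: nat and q \<sigma> :: real and bad :: "nat \<Rightarrow> bool"
  assumes X: "\<And>i. 0 \<le> X i"
    and good: "\<And>k. A \<le> k \<Longrightarrow> Suc k < A + 2 * R \<Longrightarrow> \<not> bad k \<Longrightarrow> good_pair (column_probs w X) W H q k"
    and bad: "\<And>k k'. A \<le> k \<Longrightarrow> k + 2 \<le> k' \<Longrightarrow> Suc k' < A + 2 * R \<Longrightarrow> bad k \<Longrightarrow> bad k' \<Longrightarrow> False"
    and window: "\<And>k. A \<le> k \<Longrightarrow> k < A + 2 * R \<Longrightarrow>
      (\<Sum>i\<in>{max A (k - l) * W..<min (A + 2 * R) (Suc k + l) * W}. X i) \<le> \<sigma>"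
    and pos: "0 < W" "0 < H" "0 < R" "2 \<le> l" "0 \<le> q" "18 * real R * q \<le> 1"
begin

lemma bad_location:
  obtains k0 where "A \<le> k0" "Suc k0 < A + 2 * R"
    "\<And>k. A \<le> k \<Longrightarrow> Suc k < A + 2 * R \<Longrightarrow> bad k \<Longrightarrow> k = k0 \<or> k = Suc k0"
proof (cases "\<exists>k. A \<le> k \<and> Suc k < A + 2 * R \<and> bad k")
  case True
  then obtain k0 where k0: "A \<le> k0 \<and> Suc k0 < A + 2 * R \<and> bad k0"
    and least: "\<And>k. A \<le> k \<and> Suc k < A + 2 * R \<and> bad k \<Longrightarrow> k0 \<le> k"
    using exists_least_iff[of "\<lambda>k. A \<le> k \<and> Suc k < A + 2 * R \<and> bad k"] by (meson not_less)
  show ?thesis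
  proof (rule that[of k0])
    fix k assume "A \<le> k" "Suc k < A + 2 * R" "bad k"
    moreover from this have "\<not> k0 + 2 \<le> k" using bad k0 by blast
    ultimately show "k = k0 \<or> k = Suc k0" using least[of k] by linarith
  qed (use k0 in auto)
next
  case False
  show ?thesis by (rule that[of A]) (use False pos in auto)
qed

lemma runs:
  obtains k0 where "A \<le> k0" "Suc k0 < A + 2 * R"
    "\<And>k. A \<le> k \<Longrightarrow> Suc k < Suc k0 \<Longrightarrow> good_pair (column_probs w X) W H q k"
    "\<And>k. Suc (Suc k0) \<le> k \<Longrightarrow> Suc k < A + 2 * R \<Longrightarrow> good_pair (column_probs w X) W H q k"
proof -
  obtain k0 where k0: "A \<le> k0" "Suc k0 < A + 2 * R"
    "\<And>k. A \<le> k \<Longrightarrow> Suc k < A + 2 * R \<Longrightarrow> bad k \<Longrightarrow> k = k0 \<or> k = Suc k0"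
    using bad_location by blast
  show ?thesis
  proof (rule that[OF k0(1,2)])
    fix k assume *: "A \<le> k" "Suc k < Suc k0"
    then have "\<not> bad k" using k0(2) k0(3)[of k] by auto
    then show "good_pair (column_probs w X) W H q k" using good[of k] * k0(2) by auto
  next
    fix k assume *: "Suc (Suc k0) \<le> k" "Suc k < A + 2 * R"
    then have "\<not> bad k" using k0(1) k0(3)[of k] by auto
    then show "good_pair (column_probs w X) W H q k" using good[of k] * k0(1) by auto
  qed
qed

text \<open>One block may lie between the two good runs, and each run may lose one block through
  \<open>good_run_h_any\<close>, so at most three block crossings are missing in the exponent.\<close>

lemma step_h:
  assumes cd: "A \<le> c" "c \<le> d" "d \<le> A + 2 * R" and M: "1 \<le> M"
  shows "hle (column_probs w X) (c * W) (d * W) (M * (2 * R * H))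
    ((3 * real M)\<^sup>2 * (18 * real R * q) ^ (d - c - 3))"
proof -
  let ?r = "column_probs w X"
  let ?K = "18 * real R * q"
  let ?B = "\<lambda>n. 3 * real M * ?K ^ (n - 1)"
  obtain k0 where k0: "A \<le> k0" "Suc k0 < A + 2 * R"
    "\<And>k. A \<le> k \<Longrightarrow> Suc k < Suc k0 \<Longrightarrow> good_pair ?r W H q k"
    "\<And>k. Suc (Suc k0) \<le> k \<Longrightarrow> Suc k < A + 2 * R \<Longrightarrow> good_pair ?r W H q k"
    using runs by blast
  \<comment> \<open>the range \<open>{c..<d}\<close> of blocks is split into its parts to the left and to the right of block \<open>Suc k0\<close>\<close>
  define e where "e = max c (min d (Suc k0))"
  define f where "f = max e (min d (Suc (Suc k0)))"
  have ef: "c \<le> e" "e \<le> f" "f \<le> d" using cd by (auto simp: e_def f_def)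
  have L: "hle ?r (c * W) (e * W) (M * (2 * R * H)) (?B (e - c))"
  proof (rule good_run_h_any)
    show "good_pair ?r W H q k" if "c \<le> k" "Suc k < e" for k
      using k0(3)[of k] that cd unfolding e_def by auto
  qed (use pos cd ef M in auto)
  have Rt: "hle ?r (f * W) (d * W) (M * (2 * R * H)) (?B (d - f))"
  proof (rule good_run_h_any)
    show "good_pair ?r W H q k" if "f \<le> k" "Suc k < d" for k
      using k0(4)[of k] that cd unfolding f_def e_def by auto
  qed (use pos cd ef M in auto)
  have mid: "hle ?r (e * W) (f * W) (M * (2 * R * H)) 1" by (rule hle_one) simp
  have "hle ?r (c * W) (d * W) (M * (2 * R * H)) (?B (e - c) * (1 * ?B (d - f)))"
    by (intro hle_mult[OF L] hle_mult[OF mid] Rt mult_right_mono ef le_trans[OF ef(2,3)]) auto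
  moreover have "?B (e - c) * (1 * ?B (d - f)) \<le> (3 * real M)\<^sup>2 * ?K ^ (d - c - 3)"
  proof -
    have "d - c - 3 \<le> (e - c - 1) + (d - f - 1)"
    proof -
      have "f \<le> Suc e" by (auto simp: e_def f_def)
      then show ?thesis using ef by linarith
    qed
    then have "?K ^ ((e - c - 1) + (d - f - 1)) \<le> ?K ^ (d - c - 3)"
      using pos by (intro power_decreasing) auto
    then have "(3 * real M)\<^sup>2 * ?K ^ ((e - c - 1) + (d - f - 1)) \<le> (3 * real M)\<^sup>2 * ?K ^ (d - c - 3)"
      by (intro mult_left_mono) auto
    then show ?thesis by (simp add: power_add power2_eq_square algebra_simps)
  qed
  ultimately show ?thesis by (rule hle_weaken)
qed

text \<open>Between two consecutive rows, all vertical bonds of the middle window are closed with probability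
  at least \<open>exp (- \<sigma>)\<close>, and the \<open>M \<ge> 4 exp \<sigma>\<close> attempts leave
  at most \<open>exp (- 4)\<close>.\<close>

lemma step_v:
  assumes \<sigma>: "0 \<le> \<sigma>" and M: "4 * exp \<sigma> \<le> real M"
  shows "vle (column_probs w X) (A * W) ((A + 2 * R) * W) (M * (2 * R * H))
    (exp (- 4) + 2 * (18 * real R * q + 3 * real M * (18 * real R * q) ^ l))"
proof -
  let ?r = "column_probs w X"
  let ?K = "18 * real R * q"
  have M1: "1 \<le> M"
  proof -
    have "1 \<le> exp \<sigma>" using \<sigma> by simp
    then have "4 \<le> real M" using M by linarith
    then show ?thesis by simp
  qed
  have ht: "0 < M * (2 * R * H)" "2 * R * H \<le> M * (2 * R * H)" using pos M1 by auto
  obtain k0 where k0: "A \<le> k0" "Suc k0 < A + 2 * R"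
    "\<And>k. A \<le> k \<Longrightarrow> Suc k < Suc k0 \<Longrightarrow> good_pair ?r W H q k"
    "\<And>k. Suc (Suc k0) \<le> k \<Longrightarrow> Suc k < A + 2 * R \<Longrightarrow> good_pair ?r W H q k"
    using runs by blast
  let ?l0 = "max A (Suc k0 - l) * W" and ?r1 = "min (A + 2 * R) (Suc (Suc k0) + l) * W"
  show ?thesis
  proof (rule vle_buffers[where ?l0.0 = ?l0 and ?l1.0 = "Suc k0 * W" and ?r0.0 = "Suc (Suc k0) * W" and ?r1.0 = ?r1])
    have "vle ?r ?l0 ?r1 2 (1 - exp (- \<sigma>))"
      by (rule vle_straight[OF X]) (use window[of "Suc k0"] k0 in auto)
    then have "vle ?r ?l0 ?r1 (M * R * H * 2) ((1 - exp (- \<sigma>)) ^ (M * R * H))"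
      using pos M1 by (intro vle_power) auto
    moreover have "(1 - exp (- \<sigma>)) ^ (M * R * H) \<le> exp (- 4)"
    proof (rule one_minus_exp_power_le)
      have "M * 1 \<le> M * (R * H)" using pos by (intro mult_le_mono2) auto
      then have "real M \<le> real (M * R * H)" by (metis mult.assoc mult.right_neutral of_nat_le_iff)
      then show "4 * exp \<sigma> \<le> real (M * R * H)" using M by linarith
    qed (rule \<sigma>)
    ultimately have "vle ?r ?l0 ?r1 (M * R * H * 2) (exp (- 4))" by (rule vle_weaken)
    then show "vle ?r ?l0 ?r1 (M * (2 * R * H)) (exp (- 4))" by (simp add: algebra_simps)
  next
    assume "A * W < ?l0"
    then have lt: "A < Suc k0 - l" by (auto simp: max_def split: if_splits)
    then have eq: "max A (Suc k0 - l) = Suc k0 - l" by simp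
    have "vle ?r (A * W) (Suc k0 * W) (2 * R * H) (?K ^ (Suc k0 - A))"
      by (rule good_run_v_tall) (use k0 lt pos in auto)
    then have 1: "vle ?r (A * W) (Suc k0 * W) (M * (2 * R * H)) (?K ^ (Suc k0 - A))"
      by (rule vle_mono) (use pos M1 in auto)
    have "?K ^ (Suc k0 - A) \<le> ?K ^ 1" using pos lt by (intro power_decreasing) auto
    then have v: "vle ?r (A * W) (Suc k0 * W) (M * (2 * R * H)) ?K"
      using 1 vle_weaken by fastforce
    have "hle ?r ((Suc k0 - l) * W) (Suc k0 * W) (M * (2 * R * H)) (3 * real M * ?K ^ (Suc k0 - (Suc k0 - l)))"
      by (rule good_run_h) (use k0 lt pos in auto)
    moreover have "Suc k0 - (Suc k0 - l) = l" using lt by simp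
    ultimately show "vle ?r (A * W) (Suc k0 * W) (M * (2 * R * H)) ?K
       \<and> hle ?r ?l0 (Suc k0 * W) (M * (2 * R * H)) (3 * real M * ?K ^ l)"
      using v eq by simp
  next
    assume "?r1 < (A + 2 * R) * W"
    then have lt: "Suc (Suc k0) + l < A + 2 * R" by (auto simp: min_def split: if_splits)
    then have eq: "min (A + 2 * R) (Suc (Suc k0) + l) = Suc (Suc k0) + l" by simp
    have "vle ?r (Suc (Suc k0) * W) ((A + 2 * R) * W) (2 * R * H) (?K ^ (A + 2 * R - Suc (Suc k0)))"
      by (rule good_run_v_tall) (use k0 lt pos in auto)
    then have 1: "vle ?r (Suc (Suc k0) * W) ((A + 2 * R) * W) (M * (2 * R * H)) (?K ^ (A + 2 * R - Suc (Suc k0)))"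
      by (rule vle_mono) (use pos M1 in auto)
    have "?K ^ (A + 2 * R - Suc (Suc k0)) \<le> ?K ^ 1" using pos lt by (intro power_decreasing) auto
    then have v: "vle ?r (Suc (Suc k0) * W) ((A + 2 * R) * W) (M * (2 * R * H)) ?K"
      using 1 vle_weaken by fastforce
    have "hle ?r (Suc (Suc k0) * W) ((Suc (Suc k0) + l) * W) (M * (2 * R * H))
        (3 * real M * ?K ^ (Suc (Suc k0) + l - Suc (Suc k0)))"
      by (rule good_run_h) (use k0 lt pos in auto)
    then show "vle ?r (Suc (Suc k0) * W) ((A + 2 * R) * W) (M * (2 * R * H)) ?K
       \<and> hle ?r (Suc (Suc k0) * W) ?r1 (M * (2 * R * H)) (3 * real M * ?K ^ l)"
      using v eq by simp
  qed (use pos ht in auto)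
qed

end

section \<open>The sequence of scales\<close>

text \<open>With these choices \<open>width (Suc n) = ratio n * width n\<close> and
  \<open>buffer n * width n = 4 * threshold n\<close>: crossing a buffer of good blocks costs more
  than the factor \<open>exp (threshold n)\<close> that is needed to break a window. At the same time
  \<open>threshold n\<close> is only the fraction \<open>2 ^ - (n + 4)\<close> of the next width, which
  keeps the losses in \<open>rate\<close> summable.\<close>

definition width :: "nat \<Rightarrow> nat" where "width n = 4 ^ (n ^ 2)"
definition ratio :: "nat \<Rightarrow> nat" where "ratio n = 4 ^ (2 * n + 1)"
definition buffer :: "nat \<Rightarrow> nat" where "buffer n = 8 ^ n"
definition threshold :: "nat \<Rightarrow> real" where "threshold n = width (Suc n) / 2 ^ (n + 4)"
definition rate :: "nat \<Rightarrow> real" where "rate n = exp (- ((1 + 1 / 2 ^ n) * width n))"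

lemma width_Suc: "width (Suc n) = ratio n * width n"
  by (simp add: width_def ratio_def power2_eq_square flip: power_add)

lemma width_pos [simp]: "0 < width n" by (simp add: width_def)
lemma ratio_pos [simp]: "0 < ratio n" by (simp add: ratio_def)

lemma ratio_real: "real (ratio n) = 4 * (2 ^ n) ^ 4"
proof -
  have "(4::real) ^ (2 * n) = (2 ^ 2) ^ (2 * n)" by simp
  also have "\<dots> = (2 ^ n) ^ 4" unfolding power_mult[symmetric] by (simp add: mult.commute)
  finally have "(4::real) ^ (2 * n) = (2 ^ n) ^ 4" .
  then show ?thesis by (simp add: ratio_def)
qed

lemma threshold_eq: "threshold n = real (width n) * (2 ^ n) ^ 3 / 4"
  unfolding threshold_def width_Suc of_nat_mult ratio_real
  by (simp add: power_add field_simps power3_eq_cube power4_eq_xxxx)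

lemma buffer_real: "real (buffer n) = (2 ^ n) ^ 3"
proof -
  have "(2 ^ n) ^ 3 = ((2::real) ^ 3) ^ n" by (metis mult.commute power_mult)
  then show ?thesis by (simp add: buffer_def)
qed

text \<open>The width dominates every power of \<open>2 ^ n\<close>; the fifth is enough for the numerical
  lemmas.\<close>

lemma width_large:
  assumes "5 \<le> n"
  shows "576 * (2 ^ n) ^ 5 \<le> real (width n)"
proof -
  have "5 * n + 10 \<le> 2 * n ^ 2"
  proof -
    have "5 * n \<le> n * n" using assms by simp
    then show ?thesis using assms unfolding power2_eq_square by linarith
  qed
  then have "(2::real) ^ (5 * n + 10) \<le> 2 ^ (2 * n ^ 2)" by (rule power_increasing) simp
  moreover have "(2::real) ^ (5 * n + 10) = 1024 * (2 ^ n) ^ 5"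
    by (simp add: power_add power_mult[symmetric] mult.commute)
  moreover have "(2::real) ^ (2 * n ^ 2) = real (width n)"
    by (simp add: width_def power_mult)
  ultimately show ?thesis by (smt (verit) zero_le_power)
qed

lemma two_power_large: "5 \<le> n \<Longrightarrow> (32::real) \<le> 2 ^ n"
  using power_increasing[of 5 n "2::real"] by simp

text \<open>The arithmetic of one step, in terms of \<open>t = 2 ^ n\<close> and
  \<open>x = width n\<close>. The rate constant drops from \<open>1 + 1 / t\<close> to
  \<open>1 + 1 / (2 * t)\<close>, and this drop has to pay for the choice of a strip in each block, for
  the larger height and for the three lost blocks.\<close>

context
  fixes t x \<sigma> \<rho> q :: real
  assumes t: "32 \<le> t" and x: "576 * t ^ 5 \<le> x"
    and \<sigma>: "\<sigma> = x * t ^ 3 / 4" and \<rho>: "\<rho> = 4 * t ^ 4" and q: "q = exp (- ((1 + 1 / t) * x))"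
begin

lemma x_large: "1024 \<le> x"
proof -
  have "1 \<le> t ^ 5" using t by (intro one_le_power) auto
  moreover have "32 * t ^ 4 \<le> t ^ 5"
    using mult_right_mono[OF t, of "t ^ 4"] t by (simp add: power_Suc numeral_eq_Suc)
  moreover have "1 \<le> t ^ 4" using t by (intro one_le_power) auto
  ultimately show ?thesis using x by linarith
qed

lemma good_rate: "18 * \<rho> * q \<le> exp (- ((1 + 7 / (8 * t)) * x))"
proof -
  have "18 * \<rho> \<le> x / (8 * t)"
    using x t unfolding \<rho> by (simp add: field_simps power_Suc numeral_eq_Suc)
  also have "\<dots> \<le> exp (x / (8 * t))" using exp_ge_add_one_self[of "x / (8 * t)"] by linarith
  finally have "18 * \<rho> * q \<le> exp (x / (8 * t)) * q" by (intro mult_right_mono) (simp_all add: q)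
  also have "\<dots> = exp (x / (8 * t) - (1 + 1 / t) * x)" unfolding q by (simp flip: exp_add)
  also have "x / (8 * t) - (1 + 1 / t) * x = - ((1 + 7 / (8 * t)) * x)"
    using t by (simp add: field_simps)
  finally show ?thesis .
qed

lemma good_rate_le: "18 * \<rho> * q \<le> exp (- x)"
proof -
  have "x \<le> (1 + 7 / (8 * t)) * x" using x_large t by (simp add: field_simps)
  then show ?thesis using good_rate by (smt (verit) exp_le_cancel_iff)
qed

lemma \<sigma>_large: "1024 \<le> \<sigma>"
proof -
  have "4 \<le> t ^ 3" using t power_mono[of 32 t 3] by simp
  then have "x * 4 \<le> x * t ^ 3" using x_large by (intro mult_left_mono) auto
  then show ?thesis using x_large unfolding \<sigma> by linarith
qed

lemma vertical_numeric:
  assumes M: "M \<le> 5 * exp \<sigma>" "0 \<le> M" and l: "real l * x = 4 * \<sigma>"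
  shows "exp (- 4) + 2 * (18 * \<rho> * q + 3 * M * (18 * \<rho> * q) ^ l) \<le> exp (- 1 :: real)"
proof -
  have K0: "0 \<le> 18 * \<rho> * q" using t by (simp add: \<rho> q)
  have "M * (18 * \<rho> * q) ^ l \<le> 5 * exp \<sigma> * exp (- x) ^ l"
    using M K0 good_rate_le by (intro mult_mono power_mono) auto
  also have "\<dots> = 5 * exp (\<sigma> - real l * x)"
    by (simp add: mult.assoc flip: exp_of_nat_mult exp_add)
  also have "\<dots> = 5 * exp (- (3 * \<sigma>))" by (simp add: l)
  also have "\<dots> \<le> 5 * (1 / 1025)"
  proof -
    have "1025 \<le> exp (3 * \<sigma>)" using exp_ge_add_one_self[of "3 * \<sigma>"] \<sigma>_large by linarith
    then show ?thesis by (simp add: exp_minus field_simps)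
  qed
  finally have 1: "M * (18 * \<rho> * q) ^ l \<le> 5 / 1025" by simp
  have "1025 \<le> exp x" using exp_ge_add_one_self[of x] x_large by linarith
  then have "exp (- x) \<le> 1 / 1025" by (simp add: exp_minus field_simps)
  then have 2: "18 * \<rho> * q \<le> 1 / 1025" using good_rate_le by linarith
  have "(2::real) ^ 4 \<le> exp 1 ^ 4"
    using exp_ge_add_one_self[of 1] by (intro power_mono) auto
  then have "16 \<le> exp (4::real)" by (simp flip: exp_of_nat_mult)
  then have 3: "exp (- 4 :: real) \<le> 1 / 16" by (simp add: exp_minus field_simps)
  have 4: "1 / 3 \<le> exp (- 1 :: real)" using exp_le by (simp add: exp_minus field_simps)
  define K where "K = 18 * \<rho> * q"
  have "e4 + 2 * (k + 3 * m) \<le> e1"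
    if "m \<le> 5 / 1025" "k \<le> 1 / 1025" "e4 \<le> 1 / 16" "1 / 3 \<le> e1" for e1 e4 k m :: real
    using that by argo
  from this[OF 1 2 3 4] have "exp (- 4) + 2 * (K + 3 * (M * K ^ l)) \<le> exp (- 1 :: real)"
    unfolding K_def[symmetric] .
  then show ?thesis unfolding K_def[symmetric] by (simp only: mult.assoc)
qed

lemma horizontal_numeric:
  assumes M: "M \<le> 5 * exp \<sigma>" "0 \<le> M" and R: "\<rho> = real R"
  shows "(3 * (3 * (2 * (\<rho> * x)) * M))\<^sup>2 * (18 * \<rho> * q) ^ (R - 3)
    \<le> exp (- ((1 + 1 / (2 * t)) * (\<rho> * x)))"
proof -
  have K0: "0 \<le> 18 * \<rho> * q" using t by (simp add: \<rho> q)
  have t4: "1 \<le> t ^ 4" using t by (intro one_le_power) auto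
  have R3: "3 \<le> R" using R t4 unfolding \<rho> by linarith
  have pos: "0 \<le> \<rho> * x" using t x_large by (simp add: \<rho>)
  \<comment> \<open>the polynomial factors cost no more than another \<open>exp \<sigma>\<close>\<close>
  have z: "90 * (\<rho> * x) \<le> exp \<sigma>"
  proof -
    have "90 * (\<rho> * x) = 360 * (t ^ 4 * x)" by (simp add: \<rho>)
    also have "\<dots> \<le> \<sigma>\<^sup>2 / 2"
    proof -
      have "11520 \<le> x * t ^ 2"
      proof -
        have "1024 * 32 ^ 2 \<le> x * t ^ 2" using x_large t by (intro mult_mono power_mono) auto
        then show ?thesis by simp
      qed
      then have "11520 * (t ^ 4 * x) \<le> (x * t ^ 2) * (t ^ 4 * x)"
        using t x_large by (intro mult_right_mono) auto
      moreover have "\<sigma>\<^sup>2 / 2 = (x * t ^ 2) * (t ^ 4 * x) / 32"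
        unfolding \<sigma> by (simp add: power2_eq_square numeral_eq_Suc field_simps)
      ultimately show ?thesis by simp
    qed
    also have "\<dots> \<le> exp \<sigma>" using exp_lower_Taylor_quadratic[of \<sigma>] \<sigma>_large by simp
    finally show ?thesis .
  qed
  have "3 * (3 * (2 * (\<rho> * x)) * M) \<le> 3 * (3 * (2 * (\<rho> * x)) * (5 * exp \<sigma>))"
    using M pos by (intro mult_left_mono) auto
  also have "\<dots> = 90 * (\<rho> * x) * exp \<sigma>" by simp
  also have "\<dots> \<le> exp \<sigma> * exp \<sigma>" using z by (intro mult_right_mono) auto
  finally have "3 * (3 * (2 * (\<rho> * x)) * M) \<le> exp (2 * \<sigma>)" by (simp flip: exp_add)
  then have "(3 * (3 * (2 * (\<rho> * x)) * M))\<^sup>2 \<le> exp (2 * \<sigma>) ^ 2"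
    using M pos by (intro power_mono) auto
  then have 1: "(3 * (3 * (2 * (\<rho> * x)) * M))\<^sup>2 \<le> exp (4 * \<sigma>)"
    by (simp flip: exp_of_nat_mult)
  have "(18 * \<rho> * q) ^ (R - 3) \<le> exp (- ((1 + 7 / (8 * t)) * x)) ^ (R - 3)"
    using K0 good_rate by (rule power_mono[rotated])
  also have "\<dots> = exp (- (real (R - 3) * ((1 + 7 / (8 * t)) * x)))"
    by (simp flip: exp_of_nat_mult)
  also have "real (R - 3) = \<rho> - 3" using R3 R by simp
  finally have 2: "(18 * \<rho> * q) ^ (R - 3) \<le> exp (- ((\<rho> - 3) * ((1 + 7 / (8 * t)) * x)))" .
  have "(3 * (3 * (2 * (\<rho> * x)) * M))\<^sup>2 * (18 * \<rho> * q) ^ (R - 3)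
    \<le> exp (4 * \<sigma>) * exp (- ((\<rho> - 3) * ((1 + 7 / (8 * t)) * x)))"
    using 1 2 K0 by (intro mult_mono) auto
  also have "\<dots> = exp (4 * \<sigma> - (\<rho> - 3) * ((1 + 7 / (8 * t)) * x))"
    by (simp flip: exp_add)
  also have "4 * \<sigma> - (\<rho> - 3) * ((1 + 7 / (8 * t)) * x) \<le> - ((1 + 1 / (2 * t)) * (\<rho> * x))"
  proof -
    have "3 * (1 + 7 / (8 * t)) \<le> 6" using t by (simp add: field_simps)
    also have "6 \<le> t ^ 3 / 2" using power_mono[of 32 t 3] t by simp
    finally have "3 * (1 + 7 / (8 * t)) * x \<le> t ^ 3 / 2 * x"
      using x_large by (intro mult_right_mono) auto
    moreover have "4 * \<sigma> - (\<rho> - 3) * ((1 + 7 / (8 * t)) * x) + (1 + 1 / (2 * t)) * (\<rho> * x)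
       = 3 * (1 + 7 / (8 * t)) * x - t ^ 3 / 2 * x" (is "?a + ?b = _")
      unfolding \<sigma> \<rho> using t by (simp add: field_simps numeral_eq_Suc)
    ultimately have "?a + ?b \<le> 0" by simp
    moreover have "a \<le> - b" if "a + b \<le> 0" for a b :: real using that by linarith
    ultimately show "?a \<le> - ?b" by blast
  qed
  finally show ?thesis by simp
qed

end

text \<open>A height increases by a factor of order \<open>exp (threshold n)\<close> to break the middle
  window once, and then by \<open>2 * width (Suc n)\<close> to turn the constant probability
  \<open>exp (- 1)\<close> of a vertical crossing into the next rate.\<close>

definition stretch :: "nat \<Rightarrow> nat" where "stretch n = nat \<lceil>4 * exp (threshold n)\<rceil>"

primrec height :: "nat \<Rightarrow> nat \<Rightarrow> nat" where
  "height n0 0 = 2"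
| "height n0 (Suc m) = (2 * width (Suc (n0 + m))) * (stretch (n0 + m) * (2 * ratio (n0 + m) * height n0 m))"

text \<open>Badness is a property of the column parameters alone, defined by recursion over the scales. Only
  finitely many columns enter, so that it is measurable and bad blocks far apart are independent; that it
  controls crossing probabilities is the content of \<open>not_bad_good\<close>.\<close>

primrec bad :: "nat \<Rightarrow> real \<Rightarrow> (nat \<Rightarrow> real) \<Rightarrow> (nat \<Rightarrow> real) \<Rightarrow> nat \<Rightarrow> nat \<Rightarrow> bool" where
  "bad n0 \<epsilon> w X 0 k \<longleftrightarrow> (\<exists>i\<in>{k * width n0..<Suc (Suc k) * width n0}. \<epsilon> < w i \<or> \<epsilon> < X i)"
| "bad n0 \<epsilon> w X (Suc m) K \<longleftrightarrow>
    (\<exists>k k'. K * ratio (n0 + m) \<le> k \<and> k + 2 \<le> k' \<and> Suc k' < K * ratio (n0 + m) + 2 * ratio (n0 + m)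
        \<and> bad n0 \<epsilon> w X m k \<and> bad n0 \<epsilon> w X m k') \<or>
    (\<exists>k. K * ratio (n0 + m) \<le> k \<and> k < K * ratio (n0 + m) + 2 * ratio (n0 + m) \<and>
      threshold (n0 + m) < (\<Sum>i\<in>{max (K * ratio (n0 + m)) (k - buffer (n0 + m)) * width (n0 + m)..<
          min (K * ratio (n0 + m) + 2 * ratio (n0 + m)) (Suc k + buffer (n0 + m)) * width (n0 + m)}. X i))"

lemma stretch_bounds: 
  assumes "0 \<le> threshold n"
  shows "4 * exp (threshold n) \<le> real (stretch n)" "real (stretch n) \<le> 5 * exp (threshold n)" "1 \<le> stretch n"
proof -
  show 1: "4 * exp (threshold n) \<le> real (stretch n)" unfolding stretch_def by linarith
  have "1 \<le> exp (threshold n)" using assms by simp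
  moreover have "0 < 4 * exp (threshold n)" by simp
  then have "real (stretch n) \<le> 4 * exp (threshold n) + 1" unfolding stretch_def by linarith
  ultimately show "real (stretch n) \<le> 5 * exp (threshold n)" by linarith
  then show "1 \<le> stretch n" using 1 \<open>1 \<le> exp (threshold n)\<close> by linarith
qed

lemma threshold_nonneg: "0 \<le> threshold n" by (simp add: threshold_def)

lemma height_ge: "2 \<le> height n0 m"
proof (induction m)
  case (Suc m)
  have "1 * (1 * 2) \<le> (2 * width (Suc (n0 + m))) * (stretch (n0 + m) * (2 * ratio (n0 + m) * height n0 m))"
  proof (rule mult_le_mono)
    show "1 \<le> 2 * width (Suc (n0 + m))" using width_pos[of "Suc (n0 + m)"] by linarith
    show "1 * 2 \<le> stretch (n0 + m) * (2 * ratio (n0 + m) * height n0 m)"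
    proof (rule mult_le_mono)
      show "1 \<le> stretch (n0 + m)" using stretch_bounds threshold_nonneg by blast
      have "1 * 2 \<le> 2 * ratio (n0 + m) * height n0 m"
        using ratio_pos[of "n0 + m"] Suc by (intro mult_le_mono) linarith+
      then show "2 \<le> 2 * ratio (n0 + m) * height n0 m" by simp
    qed
  qed
  then show ?case by simp
qed simp

lemma height_Suc_ge: "Suc (height n0 m) \<le> height n0 (Suc m)"
proof -
  have "2 * height n0 m \<le> height n0 (Suc m)"
  proof -
    have "1 * (1 * (2 * height n0 m)) \<le> (2 * width (Suc (n0 + m))) * (stretch (n0 + m) * (2 * ratio (n0 + m) * height n0 m))"
    proof (intro mult_le_mono)
      show "1 \<le> 2 * width (Suc (n0 + m))" using width_pos[of "Suc (n0 + m)"] by linarith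
      show "1 \<le> stretch (n0 + m)" using stretch_bounds threshold_nonneg by blast
      show "2 \<le> 2 * ratio (n0 + m)" using ratio_pos[of "n0 + m"] by linarith
    qed simp
    then show ?thesis by simp
  qed
  then show ?thesis using height_ge[of n0 m] by linarith
qed

locale columns =
  fixes w X :: "nat \<Rightarrow> real" and n0 :: nat and \<epsilon> :: real
  assumes w: "\<And>i. 0 \<le> w i \<and> w i \<le> 1" and X: "\<And>i. 0 \<le> X i"
    and n0: "5 \<le> n0" and \<epsilon>: "0 \<le> \<epsilon>" "6 * width n0 * \<epsilon> \<le> rate n0"
begin

abbreviation "probs \<equiv> column_probs w X"

lemma good_rate_le_one: "18 * real (ratio n) * rate n \<le> 1" if "n0 \<le> n"
proof -
  have n5: "5 \<le> n" using that n0 by simp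
  have "18 * real (ratio n) * rate n \<le> exp (- real (width n))"
    by (rule good_rate_le[OF two_power_large[OF n5] width_large[OF n5] threshold_eq ratio_real rate_def])
  also have "\<dots> \<le> 1" by simp
  finally show ?thesis .
qed

lemma rate_pos: "0 < rate n" by (simp add: rate_def)

lemma not_bad_0_good:
  assumes "\<not> bad n0 \<epsilon> w X 0 k"
  shows "good_pair probs (width n0) 2 (rate n0) k"
proof -
  have small: "w i \<le> \<epsilon>" "X i \<le> \<epsilon>" if "k * width n0 \<le> i" "i < Suc (Suc k) * width n0" for i
    using assms that by (auto simp: not_less)
  have W: "2 \<le> width n0"
  proof -
    have "(4::nat) ^ 1 \<le> 4 ^ (n0 ^ 2)" using n0 by (intro power_increasing) (auto simp: Suc_le_eq)
    then show ?thesis by (simp add: width_def)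
  qed
  have q: "6 * \<epsilon> \<le> rate n0" "2 * width n0 * \<epsilon> \<le> rate n0"
  proof -
    have "6 * 1 * \<epsilon> \<le> 6 * width n0 * \<epsilon>" using W \<epsilon> by (intro mult_right_mono) auto
    then show "6 * \<epsilon> \<le> rate n0" using \<epsilon> by simp
    have "2 * width n0 * \<epsilon> \<le> 6 * width n0 * \<epsilon>" using \<epsilon> by (intro mult_right_mono) auto
    then show "2 * width n0 * \<epsilon> \<le> rate n0" using \<epsilon> by linarith
  qed
  have h: "hle probs (j * width n0) (Suc j * width n0) 6 (rate n0)" if j: "j = k \<or> j = Suc k" for j
  proof -
    have 1: "hle probs (j * width n0) (Suc j * width n0) 6 (real 6 * w (j * width n0))"
      using w W by (intro hle_base) auto
    have "w (j * width n0) \<le> \<epsilon>" using j W by (intro small) auto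
    then show ?thesis using q by (intro hle_weaken[OF 1]) simp
  qed
  have "vle probs (k * width n0) (Suc (Suc k) * width n0) 2 (1 - exp (- (2 * width n0 * \<epsilon>)))"
  proof (rule vle_straight[OF X])
    have "(\<Sum>i\<in>{k * width n0..<Suc (Suc k) * width n0}. X i) \<le> (\<Sum>i\<in>{k * width n0..<Suc (Suc k) * width n0}. \<epsilon>)"
      by (intro sum_mono small) auto
    also have "\<dots> = 2 * width n0 * \<epsilon>" by (simp add: algebra_simps)
    finally show "(\<Sum>i\<in>{k * width n0..<Suc (Suc k) * width n0}. X i) \<le> 2 * width n0 * \<epsilon>" .
  qed
  moreover have "1 - exp (- (2 * width n0 * \<epsilon>)) \<le> rate n0"
    using exp_ge_add_one_self[of "- (2 * width n0 * \<epsilon>)"] q by linarith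
  ultimately have v: "vle probs (k * width n0) (Suc (Suc k) * width n0) 2 (rate n0)" by (rule vle_weaken)
  show ?thesis using h[of k] h[of "Suc k"] v unfolding good_pair_def by simp
qed

text \<open>Crossing probabilities at one scale are controlled by \<open>step_h\<close> and
  \<open>step_v\<close> from those at the previous scale, and all losses fit into the step from
  \<open>rate n\<close> to \<open>rate (Suc n)\<close>. The initial scale has height 2 and is so good that
  open bonds of any kind are rare.\<close>

theorem not_bad_good:
  assumes "\<not> bad n0 \<epsilon> w X m k"
  shows "good_pair probs (width (n0 + m)) (height n0 m) (rate (n0 + m)) k"
  using assms
proof (induction m arbitrary: k)
  case 0
  then show ?case using not_bad_0_good[of k] by simp
next
  case (Suc m)
  define n where "n = n0 + m"
  have n5: "5 \<le> n" using n0 by (simp add: n_def)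
  note num = two_power_large[OF n5] width_large[OF n5] threshold_eq[of n] ratio_real[of n]
  interpret block_step w X "width n" "height n0 m" "ratio n" "buffer n" "k * ratio n" "rate n" "threshold n" "bad n0 \<epsilon> w X m"
  proof
    show "\<not> bad n0 \<epsilon> w X m j \<Longrightarrow> good_pair probs (width n) (height n0 m) (rate n) j" for j
      using Suc(1)[of j] by (simp add: n_def)
    show "2 \<le> buffer n"
      using n5 power_increasing[of 1 n "8::nat"] by (simp add: buffer_def)
    show "18 * real (ratio n) * rate n \<le> 1" using good_rate_le_one[of n] by (simp add: n_def)
  next
    fix j j' assume "k * ratio n \<le> j" "j + 2 \<le> j'" "Suc j' < k * ratio n + 2 * ratio n"
      "bad n0 \<epsilon> w X m j" "bad n0 \<epsilon> w X m j'"
    then show False using Suc(2) unfolding bad.simps n_def by blast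
  next
    fix j assume j: "k * ratio n \<le> j" "j < k * ratio n + 2 * ratio n"
    then show "(\<Sum>i\<in>{max (k * ratio n) (j - buffer n) * width n..<
        min (k * ratio n + 2 * ratio n) (Suc j + buffer n) * width n}. X i) \<le> threshold n"
      using Suc(2) unfolding bad.simps n_def by (meson not_less)
  qed (use X height_ge[of n0 m] rate_pos[of n] in auto)
  let ?A = "k * ratio n" and ?M = "stretch n" and ?h = "2 * ratio n * height n0 m"
  note M = stretch_bounds[OF threshold_nonneg, of n]
  have cols: "j * width (Suc n) = (j * ratio n) * width n" for j
    by (simp add: width_Suc)
  have ht: "height n0 (Suc m) = (2 * width (Suc n)) * (?M * ?h)"
    by (simp add: n_def)
  have rate': "rate (Suc n) = exp (- ((1 + 1 / (2 * 2 ^ n)) * (real (ratio n) * real (width n))))"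
    by (simp add: rate_def width_Suc)
  have v: "vle probs (k * width (Suc n)) (Suc (Suc k) * width (Suc n)) (height n0 (Suc m)) (rate (Suc n))"
  proof -
    have "vle probs (?A * width n) ((?A + 2 * ratio n) * width n) (?M * ?h) (exp (- 1))"
    proof (rule vle_weaken[OF step_v[OF threshold_nonneg M(1)]])
      show "exp (- 4) + 2 * (18 * real (ratio n) * rate n + 3 * real ?M * (18 * real (ratio n) * rate n) ^ buffer n) \<le> exp (- 1)"
        by (rule vertical_numeric[OF num rate_def]) (use M in \<open>auto simp: threshold_eq buffer_real\<close>)
    qed
    then have "vle probs (?A * width n) ((?A + 2 * ratio n) * width n) ((2 * width (Suc n)) * (?M * ?h))
      (exp (- 1) ^ (2 * width (Suc n)))"
      using M(3) height_ge[of n0 m] by (intro vle_power) auto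
    moreover have "exp (- 1 :: real) ^ (2 * width (Suc n)) \<le> rate (Suc n)"
    proof -
      have "(1 + 1 / 2 ^ Suc n) * real (width (Suc n)) \<le> 2 * real (width (Suc n))"
        using two_power_large[OF n5] by (intro mult_right_mono) (auto simp: field_simps)
      then show ?thesis by (simp add: rate_def flip: exp_of_nat_mult)
    qed
    ultimately have "vle probs (?A * width n) ((?A + 2 * ratio n) * width n)
        ((2 * width (Suc n)) * (?M * ?h)) (rate (Suc n))"
      by (rule vle_weaken)
    moreover have "Suc (Suc k) * ratio n = ?A + 2 * ratio n" by simp
    ultimately show ?thesis unfolding ht cols by metis
  qed
  have h: "hle probs (j * width (Suc n)) (Suc j * width (Suc n)) (3 * height n0 (Suc m)) (rate (Suc n))"
    if j: "j = k \<or> j = Suc k" for j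
  proof -
    have M': "1 \<le> 3 * (2 * width (Suc n)) * ?M" using M(3) width_pos[of "Suc n"] by (simp add: Suc_le_eq)
    have "hle probs ((j * ratio n) * width n) ((Suc j * ratio n) * width n) ((3 * (2 * width (Suc n)) * ?M) * ?h)
      ((3 * real (3 * (2 * width (Suc n)) * ?M))\<^sup>2 * (18 * real (ratio n) * rate n) ^ (Suc j * ratio n - j * ratio n - 3))"
      by (rule step_h[OF _ _ _ M']) (use j in auto)
    moreover have "(3 * real (3 * (2 * width (Suc n)) * ?M))\<^sup>2 * (18 * real (ratio n) * rate n) ^ (Suc j * ratio n - j * ratio n - 3)
       \<le> rate (Suc n)"
    proof -
      have "(3 * (3 * (2 * (real (ratio n) * real (width n))) * real ?M))\<^sup>2 * (18 * real (ratio n) * rate n) ^ (ratio n - 3)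
        \<le> rate (Suc n)"
        unfolding rate' by (rule horizontal_numeric[OF num rate_def]) (use M in auto)
      then show ?thesis by (simp add: width_Suc)
    qed
    ultimately have "hle probs ((j * ratio n) * width n) ((Suc j * ratio n) * width n) ((3 * (2 * width (Suc n)) * ?M) * ?h) (rate (Suc n))"
      by (rule hle_weaken)
    moreover have "(3 * (2 * width (Suc n)) * ?M) * ?h = 3 * height n0 (Suc m)"
      unfolding ht by (simp only: mult.assoc)
    ultimately show ?thesis by (simp only: cols)
  qed
  have "good_pair probs (width (Suc n)) (height n0 (Suc m)) (rate (Suc n)) k"
    using h[of k] h[of "Suc k"] v unfolding good_pair_def by blast
  then show ?case by (simp only: n_def add_Suc_right)
qed

end

text \<open>The three crossings cover both uses of the boxes: leaving the box of height
  \<open>2 * height n0 (Suc m)\<close> from the lower half of its left side, and coming down to the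
  bottom from a height above \<open>height n0 m\<close> inside the columns of the box.\<close>

definition escape :: "nat \<Rightarrow> nat \<Rightarrow> (bond \<Rightarrow> bool) set" where
  "escape n0 m = hcross 0 (width (Suc (n0 + m))) 0 (2 * height n0 (Suc m))
     \<union> (vcross 0 (width (Suc (n0 + m))) 0 (height n0 m)
     \<union> vcross 0 (width (Suc (n0 + m))) (height n0 (Suc m)) (height n0 (Suc m)))"

lemma escape_measurable [measurable]: "escape n0 m \<in> sets configs"
  unfolding escape_def by measurable

context columns
begin

lemma escape_prob:
  assumes good: "\<And>k. k < ratio (n0 + m) \<Longrightarrow> \<not> bad n0 \<epsilon> w X m k"
  shows "measure (bern probs) (escape n0 m) \<le> (1 / 2) ^ (n0 + m)"
proof -
  define n where "n = n0 + m"
  have n5: "5 \<le> n" using n0 by (simp add: n_def)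
  note num = two_power_large[OF n5] width_large[OF n5] threshold_eq[of n] ratio_real[of n] rate_def[of n]
  let ?x = "real (width n)" and ?K = "18 * real (ratio n) * rate n"
  have K: "?K \<le> exp (- ?x)" by (rule good_rate_le[OF num])
  have K1: "?K \<le> 1" by (rule good_rate_le_one) (simp add: n_def)
  have K0: "0 \<le> ?K" using rate_pos[of n] by simp
  have run: "good_pair probs (width n) (height n0 m) (rate n) k" if "0 \<le> k" "Suc k < ratio n" for k
    using not_bad_good[OF good[of k]] that by (simp add: n_def)
  have "(4::nat) ^ 1 \<le> ratio n" unfolding ratio_def by (rule power_increasing) auto
  then have R: "0 + 2 \<le> ratio n" "ratio n - 0 \<le> 2 * ratio n" by auto
  have H: "0 < height n0 m" using height_ge[of n0 m] by simp
  note M = stretch_bounds[OF threshold_nonneg, of n]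
  have v: "vle probs 0 (width (Suc n)) (height n0 m) (exp (- ?x))"
  proof -
    have "vle probs (0 * width n) (ratio n * width n) (height n0 m) (4 * real (ratio n) * rate n)"
      by (rule good_run_v[OF run R width_pos H K1])
    moreover have "4 * real (ratio n) * rate n \<le> ?K" using rate_pos[of n] by (intro mult_right_mono) auto
    ultimately have "vle probs (0 * width n) (ratio n * width n) (height n0 m) (exp (- ?x))"
      using K by (meson vle_weaken order_trans)
    then show ?thesis by (simp only: width_Suc mult_0)
  qed
  have v': "vle probs 0 (width (Suc n)) (height n0 (Suc m)) (exp (- ?x))"
    using Suc_leD[OF height_Suc_ge[of n0 m]] H by (intro vle_mono[OF v]) (auto simp del: height.simps)
  let ?M = "3 * (2 * width (Suc n)) * stretch n"
  have h: "hle probs 0 (width (Suc n)) (2 * height n0 (Suc m)) (exp (- ?x))"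
  proof -
    have "hle probs (0 * width n) (ratio n * width n) (?M * (2 * ratio n * height n0 m)) (3 * real ?M * ?K ^ (ratio n - 0))"
      by (rule good_run_h[OF run R width_pos H K1])
    moreover have "3 * real ?M * ?K ^ (ratio n - 0) \<le> exp (- ?x)"
    proof -
      have M1: "1 \<le> real ?M" using M(3) width_pos[of "Suc n"] by (metis (no_types) One_nat_def Suc_leI mult_pos_pos nat_0_less_mult_iff of_nat_1 of_nat_le_iff order_less_le_trans zero_less_numeral zero_less_one)
      have "3 * real ?M \<le> (3 * real ?M)\<^sup>2" using M1 by (intro self_le_power) auto
      moreover have "?K ^ (ratio n - 0) \<le> ?K ^ (ratio n - 3)" using K0 K1 by (intro power_decreasing) auto
      ultimately have "3 * real ?M * ?K ^ (ratio n - 0) \<le> (3 * real ?M)\<^sup>2 * ?K ^ (ratio n - 3)"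
        using K0 by (intro mult_mono) auto
      also have "\<dots> = (3 * (3 * (2 * (real (ratio n) * ?x)) * real (stretch n)))\<^sup>2 * ?K ^ (ratio n - 3)"
        by (simp add: width_Suc)
      also have "\<dots> \<le> exp (- ((1 + 1 / (2 * 2 ^ n)) * (real (ratio n) * ?x)))"
        by (rule horizontal_numeric[OF num]) (use M in auto)
      also have "\<dots> \<le> exp (- ?x)"
      proof -
        have "1 \<le> real (ratio n)" using ratio_pos[of n] by linarith
        then have "1 * (1 * ?x) \<le> (1 + 1 / (2 * 2 ^ n)) * (real (ratio n) * ?x)"
          by (intro mult_mono) auto
        then show ?thesis by simp
      qed
      finally show ?thesis .
    qed
    ultimately have "hle probs (0 * width n) (ratio n * width n) (?M * (2 * ratio n * height n0 m)) (exp (- ?x))"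
      by (rule hle_weaken)
    then have "hle probs 0 (width (Suc n)) (?M * (2 * ratio n * height n0 m)) (exp (- ?x))"
      by (simp only: width_Suc mult_0)
    moreover have "?M * (2 * ratio n * height n0 m) = 3 * height n0 (Suc m)"
      by (simp only: height.simps n_def mult.assoc)
    ultimately have "hle probs 0 (width (Suc n)) (3 * height n0 (Suc m)) (exp (- ?x))" by (simp only:)
    then show ?thesis by (rule hle_mono) (simp_all only: le_refl mult_le_mono1 numeral_le_iff semiring_norm)
  qed
  have "measure (bern probs) (escape n0 m)
     \<le> measure (bern probs) (hcross 0 (width (Suc n)) 0 (2 * height n0 (Suc m)))
      + (measure (bern probs) (vcross 0 (width (Suc n)) 0 (height n0 m))
      + measure (bern probs) (vcross 0 (width (Suc n)) (height n0 (Suc m)) (height n0 (Suc m))))"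
    unfolding escape_def n_def[symmetric]
    by (intro order_trans[OF measure_Un_le] add_left_mono measure_Un_le) auto
  also have "\<dots> \<le> exp (- ?x) + (exp (- ?x) + exp (- ?x))"
    using v v' h unfolding hle_def vle_def by (intro add_mono) auto
  also have "\<dots> \<le> (1 / 2) ^ n"
  proof -
    have "1 * 2 ^ n \<le> (2 ^ n) ^ 4 * (2 ^ n :: real)" by (intro mult_right_mono one_le_power) auto
    then have "(2::real) ^ n \<le> (2 ^ n) ^ 5" by (simp add: numeral_eq_Suc)
    then have "3 * 2 ^ n \<le> ?x" using width_large[OF n5] by (smt (verit) zero_le_power)
    then have "3 * 2 ^ n \<le> exp ?x" using exp_ge_add_one_self[of ?x] by linarith
    then show ?thesis by (simp add: exp_minus field_simps)
  qed
  finally show ?thesis by (simp add: n_def)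
qed

end

section \<open>A tail bound for sums\<close>

text \<open>Either one summand exceeds \<open>\<sigma>\<close>, which is Markov's inequality for the tail
  expectation \<open>\<tau>\<close>, or the summands truncated at \<open>\<sigma>\<close> exceed their mean by
  \<open>\<sigma> / 2\<close>. Their second moments are at most
  \<open>t / 24 + \<sigma> * \<tau>\<close> (values below and above the level \<open>t\<close>), and
  Chebyshev's inequality applies. A first moment bound would give only a constant, since the number of
  summands is of order \<open>\<sigma>\<close>.\<close>

lemma (in prob_space) truncated_sum_tail:
  fixes Y :: "nat \<Rightarrow> 'a \<Rightarrow> real"
  assumes S: "finite S" and ind: "indep_vars (\<lambda>_. borel) Y S"
    and Y0: "\<And>i \<omega>. i \<in> S \<Longrightarrow> 0 \<le> Y i \<omega>"
    and int: "\<And>i. i \<in> S \<Longrightarrow> integrable M (Y i)"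
    and mean: "\<And>i. i \<in> S \<Longrightarrow> expectation (Y i) \<le> 1 / 24"
    and tail: "\<And>i. i \<in> S \<Longrightarrow> expectation (\<lambda>\<omega>. Y i \<omega> * indicator {\<omega>. t < Y i \<omega>} \<omega>) \<le> \<tau>"
    and \<tau>0: "0 \<le> \<tau>" and t: "0 < t" "t \<le> \<sigma>" and card: "real (card S) \<le> 12 * \<sigma>"
  shows "prob {\<omega> \<in> space M. \<sigma> < (\<Sum>i\<in>S. Y i \<omega>)} \<le> 60 * \<tau> + 2 * t / \<sigma>"
proof (cases "S = {}")
  case True
  then show ?thesis using t \<tau>0 by (simp add: not_less)
next
  case False
  have Ym [measurable]: "Y i \<in> borel_measurable M" if "i \<in> S" for i
    using int[OF that] by auto
  have \<sigma>: "0 < \<sigma>" using t by simp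
  define Z where "Z i \<omega> = (if Y i \<omega> \<le> \<sigma> then Y i \<omega> else 0)" for i \<omega>
  define T where "T i \<omega> = Y i \<omega> * indicator {\<omega>. t < Y i \<omega>} \<omega>" for i \<omega>
  have Zm [measurable]: "Z i \<in> borel_measurable M" if "i \<in> S" for i
    unfolding Z_def using that by measurable
  have Tm [measurable]: "T i \<in> borel_measurable M" if "i \<in> S" for i
    unfolding T_def using Ym[OF that] by measurable
  have Z0: "0 \<le> Z i \<omega>" "Z i \<omega> \<le> \<sigma>" "Z i \<omega> \<le> Y i \<omega>" if "i \<in> S" for i \<omega>
    using Y0[OF that, of \<omega>] \<sigma> by (auto simp: Z_def)
  have T0: "0 \<le> T i \<omega>" "T i \<omega> \<le> Y i \<omega>" if "i \<in> S" for i \<omega>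
    using Y0[OF that, of \<omega>] by (auto simp: T_def indicator_def)
  have Tint: "integrable M (T i)" if "i \<in> S" for i
    using T0[OF that] Y0[OF that] by (intro Bochner_Integration.integrable_bound[OF int[OF that]] Tm that) auto
  have Zint: "integrable M (Z i)" if "i \<in> S" for i
    using Z0[OF that] Y0[OF that] by (intro Bochner_Integration.integrable_bound[OF int[OF that]] Zm that) auto
  have ET: "expectation (T i) \<le> \<tau>" if "i \<in> S" for i
    using tail[OF that] unfolding T_def .
  have EZ: "0 \<le> expectation (Z i)" "expectation (Z i) \<le> 1 / 24" if "i \<in> S" for i
  proof -
    show "0 \<le> expectation (Z i)" using Z0[OF that] by (intro integral_nonneg_AE) auto
    have "expectation (Z i) \<le> expectation (Y i)"
      using Z0[OF that] by (intro integral_mono Zint int that)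
    then show "expectation (Z i) \<le> 1 / 24" using mean[OF that] by linarith
  qed
  define D where "D i \<omega> = Z i \<omega> - expectation (Z i)" for i \<omega>
  have Dm [measurable]: "D i \<in> borel_measurable M" if "i \<in> S" for i
    unfolding D_def using that by measurable
  have Dint: "integrable M (D i)" "expectation (D i) = 0" if "i \<in> S" for i
    unfolding D_def using Zint[OF that] by (auto simp: prob_space)
  have Dind: "indep_vars (\<lambda>_. borel) D S"
  proof -
    have "indep_vars (\<lambda>_. borel) (\<lambda>i \<omega>. (if Y i \<omega> \<le> \<sigma> then Y i \<omega> else 0) - expectation (Z i)) S"
      by (rule indep_vars_compose2[OF ind, where Y = "\<lambda>i y. (if y \<le> \<sigma> then y else 0) - expectation (Z i)"]) measurable
    then show ?thesis unfolding D_def Z_def .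
  qed
  have Dbound: "\<bar>D i \<omega>\<bar> \<le> \<sigma> + 1" if "i \<in> S" for i \<omega>
    using Z0[OF that, of \<omega>] EZ[OF that] \<sigma> unfolding D_def by auto
  have DDint: "integrable M (\<lambda>\<omega>. D i \<omega> * D j \<omega>)" if "i \<in> S" "j \<in> S" for i j
  proof (rule integrable_const_bound)
    show "AE \<omega> in M. norm (D i \<omega> * D j \<omega>) \<le> (\<sigma> + 1) * (\<sigma> + 1)"
    proof (rule AE_I2)
      fix \<omega>
      have "\<bar>D i \<omega>\<bar> * \<bar>D j \<omega>\<bar> \<le> (\<sigma> + 1) * (\<sigma> + 1)"
        using Dbound that \<sigma> by (intro mult_mono) auto
      then show "norm (D i \<omega> * D j \<omega>) \<le> (\<sigma> + 1) * (\<sigma> + 1)" by (simp add: abs_mult)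
    qed
    show "(\<lambda>\<omega>. D i \<omega> * D j \<omega>) \<in> borel_measurable M"
      using Dm[OF that(1)] Dm[OF that(2)] by (rule borel_measurable_times)
  qed
  have DD0: "expectation (\<lambda>\<omega>. D i \<omega> * D j \<omega>) = 0" if "i \<in> S" "j \<in> S" "i \<noteq> j" for i j
  proof -
    have "indep_var borel ((\<lambda>f. f i) \<circ> (\<lambda>\<omega>. restrict (\<lambda>i. D i \<omega>) {i}))
        borel ((\<lambda>f. f j) \<circ> (\<lambda>\<omega>. restrict (\<lambda>i. D i \<omega>) {j}))"
      using that by (intro indep_var_compose[OF indep_var_restrict[OF Dind]]) auto
    then have "indep_var borel (D i) borel (D j)" by (simp add: comp_def)
    from indep_var_lebesgue_integral[OF this] show ?thesis using Dint that by simp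
  qed
  have D2: "expectation (\<lambda>\<omega>. D i \<omega> * D i \<omega>) \<le> t / 24 + \<sigma> * \<tau>" if "i \<in> S" for i
  proof -
    have ZZ: "integrable M (\<lambda>\<omega>. (Z i \<omega>)\<^sup>2)"
    proof (rule integrable_const_bound)
      show "AE \<omega> in M. norm ((Z i \<omega>)\<^sup>2) \<le> \<sigma>\<^sup>2"
        using Z0[OF that] by (intro AE_I2) (auto intro: power_mono)
      show "(\<lambda>\<omega>. (Z i \<omega>)\<^sup>2) \<in> borel_measurable M" using Zm[OF that] by measurable
    qed
    have "expectation (\<lambda>\<omega>. D i \<omega> * D i \<omega>) = variance (Z i)" unfolding D_def power2_eq_square ..
    also have "\<dots> \<le> expectation (\<lambda>\<omega>. (Z i \<omega>)\<^sup>2)"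
      using variance_eq[OF Zint[OF that] ZZ] by simp
    also have "\<dots> \<le> expectation (\<lambda>\<omega>. t * Y i \<omega> + \<sigma> * T i \<omega>)"
    proof (rule integral_mono[OF ZZ])
      show "integrable M (\<lambda>\<omega>. t * Y i \<omega> + \<sigma> * T i \<omega>)" using int[OF that] Tint[OF that] by auto
      fix \<omega>
      show "(Z i \<omega>)\<^sup>2 \<le> t * Y i \<omega> + \<sigma> * T i \<omega>"
      proof (cases "t < Y i \<omega>")
        case True
        then have "(Z i \<omega>)\<^sup>2 \<le> \<sigma> * Y i \<omega>"
          unfolding power2_eq_square using Z0[OF that, of \<omega>] \<sigma> by (intro mult_mono) auto
        moreover have "0 \<le> t * Y i \<omega>" using t Y0[OF that] by auto
        ultimately show ?thesis using True by (simp add: T_def)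
      next
        case False
        then have "(Z i \<omega>)\<^sup>2 \<le> t * Y i \<omega>"
          unfolding power2_eq_square using Z0[OF that, of \<omega>] t by (intro mult_mono) auto
        then show ?thesis using T0[OF that, of \<omega>] \<sigma> by (simp add: add_increasing2)
      qed
    qed
    also have "\<dots> = t * expectation (Y i) + \<sigma> * expectation (T i)"
      using int[OF that] Tint[OF that] by simp
    also have "\<dots> \<le> t * (1 / 24) + \<sigma> * \<tau>"
      using t \<sigma> mean[OF that] ET[OF that] by (intro add_mono mult_left_mono) auto
    finally show ?thesis by simp
  qed
  define F where "F \<omega> = (\<Sum>i\<in>S. Z i \<omega>)" for \<omega>
  have Fm: "F \<in> borel_measurable M" unfolding F_def using Zm by measurable
  have EF: "expectation F = (\<Sum>i\<in>S. expectation (Z i))" unfolding F_def using Zint by simp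
  have FD: "F \<omega> - expectation F = (\<Sum>i\<in>S. D i \<omega>)" for \<omega>
    unfolding EF by (simp add: F_def D_def sum_subtractf)
  have EF2: "expectation F \<le> \<sigma> / 2"
  proof -
    have "expectation F \<le> (\<Sum>i\<in>S. 1 / 24)" unfolding EF using EZ by (intro sum_mono) auto
    then show ?thesis using card by simp
  qed
  have Fint: "integrable M (\<lambda>\<omega>. (F \<omega>)\<^sup>2)"
  proof (rule integrable_const_bound)
    show "AE \<omega> in M. norm ((F \<omega>)\<^sup>2) \<le> (card S * \<sigma>)\<^sup>2"
    proof (rule AE_I2)
      fix \<omega>
      have "0 \<le> F \<omega>" unfolding F_def using Z0 by (intro sum_nonneg) auto
      moreover have "F \<omega> \<le> card S * \<sigma>" unfolding F_def using Z0 by (intro sum_bounded_above) auto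
      ultimately show "norm ((F \<omega>)\<^sup>2) \<le> (card S * \<sigma>)\<^sup>2" by (auto intro: power_mono)
    qed
  qed (use Fm in measurable)
  have "variance F = expectation (\<lambda>\<omega>. \<Sum>i\<in>S. \<Sum>j\<in>S. D i \<omega> * D j \<omega>)"
    unfolding FD power2_eq_square sum_product ..
  also have "\<dots> = (\<Sum>i\<in>S. \<Sum>j\<in>S. expectation (\<lambda>\<omega>. D i \<omega> * D j \<omega>))"
    using DDint by (simp add: Bochner_Integration.integral_sum)
  also have "\<dots> = (\<Sum>i\<in>S. expectation (\<lambda>\<omega>. D i \<omega> * D i \<omega>))"
  proof (rule sum.cong[OF refl])
    fix i assume i: "i \<in> S"
    have "(\<Sum>j\<in>S. expectation (\<lambda>\<omega>. D i \<omega> * D j \<omega>)) = (\<Sum>j\<in>S. if j = i then expectation (\<lambda>\<omega>. D i \<omega> * D i \<omega>) else 0)"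
      using DD0 i by (intro sum.cong) auto
    then show "(\<Sum>j\<in>S. expectation (\<lambda>\<omega>. D i \<omega> * D j \<omega>)) = expectation (\<lambda>\<omega>. D i \<omega> * D i \<omega>)"
      using S i by simp
  qed
  also have "\<dots> \<le> (\<Sum>i\<in>S. t / 24 + \<sigma> * \<tau>)" using D2 by (intro sum_mono) auto
  also have "\<dots> = card S * (t / 24 + \<sigma> * \<tau>)" by simp
  also have "card S * (t / 24 + \<sigma> * \<tau>) \<le> 12 * \<sigma> * (t / 24 + \<sigma> * \<tau>)"
    using card t \<sigma> \<tau>0 by (intro mult_right_mono) auto
  finally have var: "variance F \<le> 12 * \<sigma> * (t / 24 + \<sigma> * \<tau>)" by simp
  have "prob {\<omega> \<in> space M. \<sigma> / 2 \<le> \<bar>F \<omega> - expectation F\<bar>} \<le> variance F / (\<sigma> / 2)\<^sup>2"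
    using \<sigma> by (intro Chebyshev_inequality Fm Fint) auto
  also have "\<dots> \<le> 12 * \<sigma> * (t / 24 + \<sigma> * \<tau>) / (\<sigma> / 2)\<^sup>2"
    using var by (intro divide_right_mono) auto
  also have "\<dots> = 2 * t / \<sigma> + 48 * \<tau>"
    using \<sigma> by (simp add: field_simps power2_eq_square)
  finally have cheb: "prob {\<omega> \<in> space M. \<sigma> / 2 \<le> \<bar>F \<omega> - expectation F\<bar>} \<le> 2 * t / \<sigma> + 48 * \<tau>" .
  have big: "prob {\<omega> \<in> space M. \<sigma> < Y i \<omega>} \<le> \<tau> / \<sigma>" if i: "i \<in> S" for i
  proof -
    have "\<sigma> * prob {\<omega> \<in> space M. \<sigma> < Y i \<omega>} = expectation (\<lambda>\<omega>. \<sigma> * indicator {\<omega> \<in> space M. \<sigma> < Y i \<omega>} \<omega>)"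
      using Ym[OF i] by simp
    also have "\<dots> \<le> expectation (T i)"
    proof (rule integral_mono)
      show "integrable M (\<lambda>\<omega>. \<sigma> * indicator {\<omega> \<in> space M. \<sigma> < Y i \<omega>} \<omega>)"
        using Ym[OF i] by (intro integrable_mult_right integrable_real_indicator) (auto simp: emeasure_eq_measure)
      fix \<omega> assume "\<omega> \<in> space M"
      then show "\<sigma> * indicator {\<omega> \<in> space M. \<sigma> < Y i \<omega>} \<omega> \<le> T i \<omega>"
        using Y0[OF i, of \<omega>] t by (auto simp: T_def indicator_def)
    qed (rule Tint[OF i])
    also have "\<dots> \<le> \<tau>" by (rule ET[OF i])
    finally show ?thesis using \<sigma> by (simp add: field_simps)
  qed
  have meas: "{\<omega> \<in> space M. \<sigma> < Y i \<omega>} \<in> sets M" if "i \<in> S" for i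
    using Ym[OF that] by measurable
  have meas2: "{\<omega> \<in> space M. \<sigma> / 2 \<le> \<bar>F \<omega> - expectation F\<bar>} \<in> sets M" using Fm by measurable
  have "{\<omega> \<in> space M. \<sigma> < (\<Sum>i\<in>S. Y i \<omega>)}
    \<subseteq> (\<Union>i\<in>S. {\<omega> \<in> space M. \<sigma> < Y i \<omega>}) \<union> {\<omega> \<in> space M. \<sigma> / 2 \<le> \<bar>F \<omega> - expectation F\<bar>}"
  proof
    fix \<omega> assume \<omega>: "\<omega> \<in> {\<omega> \<in> space M. \<sigma> < (\<Sum>i\<in>S. Y i \<omega>)}"
    show "\<omega> \<in> (\<Union>i\<in>S. {\<omega> \<in> space M. \<sigma> < Y i \<omega>}) \<union> {\<omega> \<in> space M. \<sigma> / 2 \<le> \<bar>F \<omega> - expectation F\<bar>}"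
    proof (cases "\<exists>i\<in>S. \<sigma> < Y i \<omega>")
      case False
      then have "F \<omega> = (\<Sum>i\<in>S. Y i \<omega>)" unfolding F_def Z_def by (intro sum.cong) (auto simp: not_less)
      then have "\<sigma> / 2 \<le> F \<omega> - expectation F" using \<omega> EF2 by auto
      then have "\<sigma> / 2 \<le> \<bar>F \<omega> - expectation F\<bar>" by linarith
      then show ?thesis using \<omega> by auto
    qed (use \<omega> in auto)
  qed
  then have "prob {\<omega> \<in> space M. \<sigma> < (\<Sum>i\<in>S. Y i \<omega>)}
    \<le> prob ((\<Union>i\<in>S. {\<omega> \<in> space M. \<sigma> < Y i \<omega>}) \<union> {\<omega> \<in> space M. \<sigma> / 2 \<le> \<bar>F \<omega> - expectation F\<bar>})"
    using meas meas2 S by (intro finite_measure_mono) auto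
  also have "\<dots> \<le> prob (\<Union>i\<in>S. {\<omega> \<in> space M. \<sigma> < Y i \<omega>}) + prob {\<omega> \<in> space M. \<sigma> / 2 \<le> \<bar>F \<omega> - expectation F\<bar>}"
    using meas meas2 S by (intro measure_Un_le) auto
  also have "prob (\<Union>i\<in>S. {\<omega> \<in> space M. \<sigma> < Y i \<omega>}) \<le> (\<Sum>i\<in>S. prob {\<omega> \<in> space M. \<sigma> < Y i \<omega>})"
    using meas S by (intro finite_measure_subadditive_finite) auto
  also have "\<dots> \<le> (\<Sum>i\<in>S. \<tau> / \<sigma>)" using big by (intro sum_mono) auto
  also have "\<dots> = card S * (\<tau> / \<sigma>)" by simp
  also have "\<dots> \<le> 12 * \<sigma> * (\<tau> / \<sigma>)" using card \<tau>0 \<sigma> by (intro mult_right_mono) auto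
  also have "\<dots> = 12 * \<tau>" using \<sigma> by simp
  finally show ?thesis using cheb by simp
qed

section \<open>Random environments\<close>

locale increment_law =
  fixes \<nu> :: "real measure"
  assumes prob_\<nu>: "prob_space \<nu>" and sets_\<nu>: "sets \<nu> = sets borel"
begin

definition E :: "(nat \<Rightarrow> real) measure" where "E = Pi\<^sub>M {1..} (\<lambda>_. \<nu>)"

lemma space_\<nu>: "space \<nu> = UNIV" using sets_eq_imp_space_eq[OF sets_\<nu>] by simp

sublocale E: prob_space E unfolding E_def by (rule prob_space_PiM) (rule prob_\<nu>)

lemma coordinate_measurable_law: "(\<lambda>\<xi>. \<xi> (Suc i)) \<in> measurable E \<nu>"
  unfolding E_def by (rule measurable_component_singleton) simp

lemma coordinate_measurable: "(\<lambda>\<xi>. \<xi> (Suc i)) \<in> borel_measurable E"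
  using coordinate_measurable_law measurable_cong_sets[OF refl sets_\<nu>] by blast

lemma distr_coordinate: "distr E \<nu> (\<lambda>\<xi>. \<xi> (Suc i)) = \<nu>"
  unfolding E_def by (rule distr_PiM_component) (auto intro: prob_\<nu>)

end

text \<open>The hypotheses on a column model with i.i.d. parameters \<open>fw \<xi>\<close> and
  \<open>fX \<xi>\<close>. The level \<open>2 ^ n\<^sup>2\<close> in \<open>tail\<close> is the square root
  of \<open>width n\<close>; \<open>base\<close> makes blocks of the initial scale \<open>n0\<close> good
  with the probability required there.\<close>

locale random_columns = increment_law \<nu> for \<nu> :: "real measure" +
  fixes fw fX :: "real \<Rightarrow> real" and n0 :: nat and \<epsilon> C :: real
  assumes fw_m [measurable]: "fw \<in> borel_measurable borel" and fX_m [measurable]: "fX \<in> borel_measurable borel"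
    and fw: "\<And>z. 0 \<le> fw z \<and> fw z \<le> 1" and fX: "\<And>z. 0 \<le> fX z"
    and int: "integrable \<nu> fX" and mean: "(\<integral>z. fX z \<partial>\<nu>) \<le> 1 / 24"
    and tail: "\<And>n. n0 \<le> n \<Longrightarrow> (\<integral>z. fX z * indicator {z. 2 ^ n\<^sup>2 < fX z} z \<partial>\<nu>) \<le> C / (2 ^ n) ^ 18"
    and n0: "18 \<le> n0" and C: "0 \<le> C" "60 * C * 2 ^ 17 \<le> (2 ^ n0)\<^sup>2"
    and \<epsilon>: "0 \<le> \<epsilon>" "6 * width n0 * \<epsilon> \<le> rate n0"
    and base: "2 * width n0 * measure \<nu> {z \<in> space \<nu>. \<epsilon> < fw z \<or> \<epsilon> < fX z} \<le> 1 / (2 ^ n0) ^ 12"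
begin

definition cw :: "(nat \<Rightarrow> real) \<Rightarrow> nat \<Rightarrow> real" where "cw \<xi> i = fw (\<xi> (Suc i))"
definition cX :: "(nat \<Rightarrow> real) \<Rightarrow> nat \<Rightarrow> real" where "cX \<xi> i = fX (\<xi> (Suc i))"

declare coordinate_measurable [measurable]

lemma cw_m [measurable]: "(\<lambda>\<xi>. cw \<xi> i) \<in> borel_measurable E"
  unfolding cw_def by measurable

lemma cX_m [measurable]: "(\<lambda>\<xi>. cX \<xi> i) \<in> borel_measurable E"
  unfolding cX_def by measurable

lemma columns: "columns (cw \<xi>) (cX \<xi>) n0 \<epsilon>"
  by unfold_locales (use fw fX n0 \<epsilon> in \<open>auto simp: cw_def cX_def\<close>)

abbreviation "badE m k \<xi> \<equiv> bad n0 \<epsilon> (cw \<xi>) (cX \<xi>) m k"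

lemma bad_measurable [measurable]: "Measurable.pred E (badE m k)"
proof (induction m arbitrary: k)
  case 0
  show ?case unfolding bad.simps by measurable
next
  case (Suc m)
  note [measurable] = Suc
  show ?case unfolding bad.simps by measurable
qed

lemma bad_determined:
  "determined_by (Suc ` {k * width (n0 + m)..<Suc (Suc k) * width (n0 + m)}) {\<xi>. badE m k \<xi>}"
proof -
  have "bad n0 \<epsilon> (cw \<xi>) (cX \<xi>) m k \<Longrightarrow> bad n0 \<epsilon> (cw \<xi>') (cX \<xi>') m k"
    if "\<And>i. i \<in> {k * width (n0 + m)..<Suc (Suc k) * width (n0 + m)} \<Longrightarrow> \<xi> (Suc i) = \<xi>' (Suc i)" for \<xi> \<xi>'
    using that
  proof (induction m arbitrary: k)
    case 0
    then show ?case by (auto simp: cw_def cX_def)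
  next
    case (Suc m)
    let ?R = "ratio (n0 + m)" and ?W = "width (n0 + m)"
    have W: "width (n0 + Suc m) = ?R * ?W" by (simp add: width_Suc)
    have eq: "\<xi> (Suc i) = \<xi>' (Suc i)" if "k * ?R * ?W \<le> i" "i < (k * ?R + 2 * ?R) * ?W" for i
    proof (rule Suc(3))
      have "Suc (Suc k) * (?R * ?W) = (k * ?R + 2 * ?R) * ?W" by (simp add: algebra_simps)
      then show "i \<in> {k * width (n0 + Suc m)..<Suc (Suc k) * width (n0 + Suc m)}"
        unfolding W using that by (simp add: mult.assoc)
    qed
    have sub: "bad n0 \<epsilon> (cw \<xi>) (cX \<xi>) m j \<Longrightarrow> bad n0 \<epsilon> (cw \<xi>') (cX \<xi>') m j"
      if j: "k * ?R \<le> j" "Suc j < k * ?R + 2 * ?R" for j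
    proof (rule Suc(1))
      fix i assume i: "i \<in> {j * ?W..<Suc (Suc j) * ?W}"
      have "k * ?R * ?W \<le> j * ?W" using j by (intro mult_right_mono) auto
      moreover have "Suc (Suc j) * ?W \<le> (k * ?R + 2 * ?R) * ?W" using j by (intro mult_right_mono) auto
      ultimately show "\<xi> (Suc i) = \<xi>' (Suc i)"
        using i unfolding atLeastLessThan_iff by (intro eq) linarith+
    qed
    have win: "(\<Sum>i\<in>{max (k * ?R) a * ?W..<min (k * ?R + 2 * ?R) b * ?W}. cX \<xi> i)
       = (\<Sum>i\<in>{max (k * ?R) a * ?W..<min (k * ?R + 2 * ?R) b * ?W}. cX \<xi>' i)" for a b
    proof (rule sum.cong[OF refl])
      fix i assume i: "i \<in> {max (k * ?R) a * ?W..<min (k * ?R + 2 * ?R) b * ?W}"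
      have "k * ?R * ?W \<le> max (k * ?R) a * ?W" by (intro mult_right_mono) auto
      moreover have "min (k * ?R + 2 * ?R) b * ?W \<le> (k * ?R + 2 * ?R) * ?W" by (intro mult_right_mono) auto
      ultimately have "k * ?R * ?W \<le> i" "i < (k * ?R + 2 * ?R) * ?W"
        using i unfolding atLeastLessThan_iff by linarith+
      then show "cX \<xi> i = cX \<xi>' i" unfolding cX_def by (simp only: eq)
    qed
    show ?case using Suc(2) sub unfolding bad.simps win
      by (smt (verit, ccfv_threshold) Suc_leD Suc_lessD add_2_eq_Suc' le_less_trans le_trans less_Suc_eq_le)
  qed
  note transfer = this
  show ?thesis unfolding determined_by_def mem_Collect_eq
  proof (intro allI impI)
    fix \<xi> \<xi>' :: "nat \<Rightarrow> real"
    assume "\<forall>i\<in>Suc ` {k * width (n0 + m)..<Suc (Suc k) * width (n0 + m)}. \<xi> i = \<xi>' i" "badE m k \<xi>"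
    then show "badE m k \<xi>'" by (intro transfer[of \<xi> \<xi>']) blast+
  qed
qed

definition \<delta> :: "nat \<Rightarrow> real" where "\<delta> n = 1 / (2 ^ n) ^ 12"

lemma bad_two_blocks:
  assumes "k + 2 \<le> k'"
  shows "E.prob {\<xi> \<in> space E. badE m k \<xi> \<and> badE m k' \<xi>}
    = E.prob {\<xi> \<in> space E. badE m k \<xi>} * E.prob {\<xi> \<in> space E. badE m k' \<xi>}"
proof -
  let ?W = "width (n0 + m)"
  have "Suc (Suc k) * ?W \<le> k' * ?W" using assms by (intro mult_right_mono) auto
  then have disj: "Suc ` {k * ?W..<Suc (Suc k) * ?W} \<inter> Suc ` {k' * ?W..<Suc (Suc k') * ?W} = {}"
    by auto
  have eq: "space E \<inter> {\<xi>. badE m j \<xi>} = {\<xi> \<in> space E. badE m j \<xi>}" for j by auto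
  have sets: "space E \<inter> {\<xi>. badE m j \<xi>} \<in> sets E" for j unfolding eq by measurable
  have "E.prob (space E \<inter> {\<xi>. badE m k \<xi>} \<inter> {\<xi>. badE m k' \<xi>})
    = E.prob (space E \<inter> {\<xi>. badE m k \<xi>}) * E.prob (space E \<inter> {\<xi>. badE m k' \<xi>})"
    unfolding E_def
  proof (rule PiM_prob_Int_determined[OF _ _ _ bad_determined _ _ bad_determined _ disj])
    show "space (Pi\<^sub>M {1..} (\<lambda>_. \<nu>)) \<inter> {\<xi>. badE m k \<xi>} \<in> sets (Pi\<^sub>M {1..} (\<lambda>_. \<nu>))"
      using sets[of k] unfolding E_def .
    show "space (Pi\<^sub>M {1..} (\<lambda>_. \<nu>)) \<inter> {\<xi>. badE m k' \<xi>} \<in> sets (Pi\<^sub>M {1..} (\<lambda>_. \<nu>))"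
      using sets[of k'] unfolding E_def .
  qed (use prob_\<nu> in auto)
  also have "space E \<inter> {\<xi>. badE m k \<xi>} \<inter> {\<xi>. badE m k' \<xi>} = {\<xi> \<in> space E. badE m k \<xi> \<and> badE m k' \<xi>}"
    by auto
  finally show ?thesis unfolding eq .
qed

lemma cX_indep: "E.indep_vars (\<lambda>_. borel) (\<lambda>i \<xi>. cX \<xi> i) S"
proof -
  have 3: "E.indep_vars (\<lambda>_. \<nu>) (\<lambda>i \<xi>. \<xi> (Suc i)) S"
    unfolding E_def by (rule PiM_reindexed_coordinates_indep_vars) (auto intro: prob_\<nu>)
  have "fX \<in> measurable \<nu> borel" using fX_m measurable_cong_sets[OF sets_\<nu> refl] by blast
  then have "E.indep_vars (\<lambda>_. borel) (\<lambda>i \<xi>. fX (\<xi> (Suc i))) S"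
    by (intro E.indep_vars_compose2[OF 3, where Y = "\<lambda>_. fX"]) auto
  then show ?thesis unfolding cX_def .
qed

lemma fX_\<nu>: "f \<in> borel_measurable borel \<Longrightarrow> f \<in> borel_measurable \<nu>" for f :: "real \<Rightarrow> real"
  using measurable_cong_sets[OF sets_\<nu> refl] by blast

lemma window_tail:
  assumes n: "n0 \<le> n" and S: "finite S" "real (card S) \<le> 12 * threshold n"
  shows "E.prob {\<xi> \<in> space E. threshold n < (\<Sum>i\<in>S. cX \<xi> i)}
    \<le> 60 * (C / (2 ^ n) ^ 18) + 2 * 2 ^ n\<^sup>2 / threshold n"
proof (cases "S = {}")
  case True
  then show ?thesis using C threshold_nonneg[of n] by (simp add: not_less)
next
  case False
  have th: "2 ^ n\<^sup>2 \<le> threshold n"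
  proof -
    have "(2::real) ^ n\<^sup>2 \<le> 4 ^ n\<^sup>2" by (intro power_mono) auto
    moreover have "(1::real) \<le> (2 ^ n) ^ 3 / 4"
    proof -
      have "(4::real) \<le> (2 ^ n)" using power_increasing[of 2 n "2::real"] n n0 by simp
      also have "\<dots> \<le> (2 ^ n) ^ 3" by (intro self_le_power) auto
      finally show ?thesis by simp
    qed
    ultimately have "2 ^ n\<^sup>2 * 1 \<le> (4::real) ^ n\<^sup>2 * ((2 ^ n) ^ 3 / 4)" by (intro mult_mono) auto
    then show ?thesis unfolding threshold_eq by (simp add: width_def)
  qed
  have E1: "(\<integral>\<xi>. f (\<xi> (Suc i)) \<partial>E) = (\<integral>z. f z \<partial>\<nu>)" if "f \<in> borel_measurable borel" for f :: "real \<Rightarrow> real" and i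
    using integral_distr[OF coordinate_measurable_law[of i] fX_\<nu>[OF that]] by (simp add: distr_coordinate)
  show ?thesis
  proof (rule E.truncated_sum_tail)
    show "E.indep_vars (\<lambda>_. borel) (\<lambda>i \<xi>. cX \<xi> i) S" by (rule cX_indep)
    show "integrable E (\<lambda>\<xi>. cX \<xi> i)" for i
      using int integrable_distr_eq[OF coordinate_measurable_law[of i] fX_\<nu>[OF fX_m]] by (simp add: distr_coordinate cX_def)
    show "E.expectation (\<lambda>\<xi>. cX \<xi> i) \<le> 1 / 24" for i
      using mean E1[OF fX_m, of i] by (simp add: cX_def)
    show "E.expectation (\<lambda>\<xi>. cX \<xi> i * indicator {\<xi>. 2 ^ n\<^sup>2 < cX \<xi> i} \<xi>) \<le> C / (2 ^ n) ^ 18" for i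
    proof -
      have "(\<lambda>z. fX z * indicator {z. 2 ^ n\<^sup>2 < fX z} z) \<in> borel_measurable borel" by measurable
      from E1[OF this, of i] tail[OF n] show ?thesis
        by (simp add: cX_def indicator_def)
    qed
  qed (use S C th fX in \<open>auto simp: cX_def\<close>)
qed

text \<open>The first term bounds two separated bad blocks, the second the untypical windows. With
  \<open>u = 2 ^ n\<close> the target is \<open>u ^ -12 / 4096\<close>, while the three contributions
  are of order \<open>u ^ -16\<close>, \<open>C * u ^ -14\<close> and smaller than any power of
  \<open>u\<close>.\<close>

lemma window_numeric:
  assumes n: "n0 \<le> n"
  shows "(2 * real (ratio n))\<^sup>2 * (\<delta> n)\<^sup>2
     + 2 * real (ratio n) * (60 * (C / (2 ^ n) ^ 18) + 2 * 2 ^ n\<^sup>2 / threshold n) \<le> \<delta> (Suc n)"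
proof -
  define u :: real where "u = 2 ^ n"
  have u: "2 ^ 18 \<le> u" unfolding u_def using n n0 by (intro power_increasing) auto
  then have u0: "0 < u" by simp
  have C': "C \<le> u\<^sup>2 / (60 * 2 ^ 17)"
  proof -
    have "(2 ^ n0 :: real) \<le> u" unfolding u_def using n by (intro power_increasing) auto
    then have "(2 ^ n0 :: real)\<^sup>2 \<le> u\<^sup>2" by (intro power_mono) auto
    then show ?thesis using C(2) by (simp add: field_simps)
  qed
  have R: "real (ratio n) = 4 * u ^ 4" by (simp add: ratio_real u_def)
  have d: "\<delta> n = 1 / u ^ 12" "\<delta> (Suc n) = 1 / (4096 * u ^ 12)"
    by (simp_all add: \<delta>_def u_def power_mult_distrib)
  have big: "2 ^ 18 * u ^ 16 \<le> 2 ^ n\<^sup>2"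
  proof -
    have "16 * n + 18 \<le> n\<^sup>2"
    proof -
      have "18 * n \<le> n * n" using n n0 by (intro mult_right_mono) auto
      then show ?thesis using n n0 unfolding power2_eq_square by linarith
    qed
    then have "(2::real) ^ (16 * n + 18) \<le> 2 ^ n\<^sup>2" by (intro power_increasing) auto
    moreover have "(2::real) ^ (16 * n + 18) = 2 ^ 18 * u ^ 16"
      unfolding u_def by (simp add: power_add power_mult[symmetric] mult.commute)
    ultimately show ?thesis by simp
  qed
  have t1: "(2 * real (ratio n))\<^sup>2 * (\<delta> n)\<^sup>2 \<le> 1 / (2 ^ 14 * u ^ 12)"
  proof -
    have "(2 * real (ratio n))\<^sup>2 * (\<delta> n)\<^sup>2 = 64 / (u ^ 4 * u ^ 12)"
      unfolding R d using u0 by (simp add: field_simps numeral_eq_Suc)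
    also have "\<dots> \<le> 1 / (2 ^ 14 * u ^ 12)"
    proof -
      have "64 * 2 ^ 14 \<le> u ^ 4"
      proof -
        have "(64 * 2 ^ 14 :: real) \<le> (2 ^ 18) ^ 4" by simp
        also have "\<dots> \<le> u ^ 4" using u by (intro power_mono) auto
        finally show ?thesis .
      qed
      then have "64 * 2 ^ 14 * u ^ 12 \<le> u ^ 4 * u ^ 12" using u0 by (intro mult_right_mono) auto
      then show ?thesis using u0 by (simp add: field_simps)
    qed
    finally show ?thesis .
  qed
  have t2: "2 * real (ratio n) * (60 * (C / (2 ^ n) ^ 18)) \<le> 1 / (2 ^ 14 * u ^ 12)"
  proof -
    have "2 * real (ratio n) * (60 * (C / (2 ^ n) ^ 18)) = C * (480 * u ^ 4 / u ^ 18)"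
      unfolding R u_def by simp
    also have "\<dots> \<le> u\<^sup>2 / (60 * 2 ^ 17) * (480 * u ^ 4 / u ^ 18)"
      using C' u0 by (intro mult_right_mono) auto
    also have "\<dots> = 1 / (2 ^ 14 * u ^ 12)"
      using u0 by (simp add: field_simps numeral_eq_Suc)
    finally show ?thesis .
  qed
  have t3: "2 * real (ratio n) * (2 * 2 ^ n\<^sup>2 / threshold n) \<le> 1 / (2 ^ 12 * u ^ 12 * 2)"
  proof -
    have th: "threshold n = 2 ^ n\<^sup>2 * 2 ^ n\<^sup>2 * u ^ 3 / 4"
      unfolding threshold_eq u_def width_def by (simp flip: power_mult_distrib)
    have "2 * real (ratio n) * (2 * 2 ^ n\<^sup>2 / threshold n) = 64 * u / 2 ^ n\<^sup>2"
      unfolding th R using u0 by (simp add: field_simps numeral_eq_Suc)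
    also have "\<dots> \<le> 64 * u / (2 ^ 18 * u ^ 16)"
      using big u0 by (intro divide_left_mono) auto
    also have "\<dots> = 1 / (2 ^ 12 * u ^ 12 * u ^ 3)" using u0 by (simp add: field_simps numeral_eq_Suc)
    also have "\<dots> \<le> 1 / (2 ^ 12 * u ^ 12 * 2)"
    proof -
      have "2 \<le> u" using u by simp
      also have "u \<le> u ^ 3" using u by (intro self_le_power) auto
      finally show ?thesis using u0 by (intro divide_left_mono mult_left_mono) auto
    qed
    finally show ?thesis .
  qed
  define v where "v = 1 / u ^ 12"
  have v0: "0 \<le> v" using u0 by (simp add: v_def)
  have "1 / (2 ^ 14 * u ^ 12) = v / 2 ^ 14" "1 / (2 ^ 12 * u ^ 12 * 2) = v / 2 ^ 13" "\<delta> (Suc n) = v / 2 ^ 12"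
    unfolding d v_def by simp_all
  then show ?thesis using t1 t2 t3 v0 by (simp add: distrib_left)
qed

lemma window_card:
  "real (card {max a (k - buffer n) * width n..<min b (Suc k + buffer n) * width n}) \<le> 12 * threshold n"
proof -
  have "card {max a (k - buffer n) * width n..<min b (Suc k + buffer n) * width n}
      = (min b (Suc k + buffer n) - max a (k - buffer n)) * width n"
    by (simp add: diff_mult_distrib)
  also have "\<dots> \<le> (3 * buffer n) * width n"
  proof -
    have "1 \<le> buffer n" by (simp add: buffer_def)
    then show ?thesis by (intro mult_right_mono) auto
  qed
  finally have "real (card {max a (k - buffer n) * width n..<min b (Suc k + buffer n) * width n})
     \<le> real ((3 * buffer n) * width n)" by (simp only: of_nat_le_iff)
  also have "\<dots> = 12 * threshold n" by (simp add: buffer_real threshold_eq)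
  finally show ?thesis .
qed

text \<open>Two bad pairs without a common block depend on disjoint sets of columns, so their joint
  probability is at most \<open>(\<delta> n)\<^sup>2\<close>; the probability of a heavy window is bounded by
  \<open>window_tail\<close>.\<close>

lemma prob_bad: "E.prob {\<xi> \<in> space E. badE m k \<xi>} \<le> \<delta> (n0 + m)"
proof (induction m arbitrary: k)
  case 0
  let ?S = "{k * width n0..<Suc (Suc k) * width n0}"
  let ?Z = "{z \<in> space \<nu>. \<epsilon> < fw z \<or> \<epsilon> < fX z}"
  let ?A = "\<lambda>i. {\<xi> \<in> space E. \<epsilon> < cw \<xi> i \<or> \<epsilon> < cX \<xi> i}"
  have A: "?A i \<in> sets E" for i by measurable
  have Zs: "?Z \<in> sets \<nu>"
    using fX_\<nu>[OF fw_m] fX_\<nu>[OF fX_m] by measurable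
  have PA: "E.prob (?A i) = measure \<nu> ?Z" for i
  proof -
    have "measure \<nu> ?Z = measure (distr E \<nu> (\<lambda>\<xi>. \<xi> (Suc i))) ?Z" by (simp only: distr_coordinate)
    also have "\<dots> = E.prob ((\<lambda>\<xi>. \<xi> (Suc i)) -` ?Z \<inter> space E)" by (rule measure_distr[OF coordinate_measurable_law Zs])
    also have "(\<lambda>\<xi>. \<xi> (Suc i)) -` ?Z \<inter> space E = ?A i" by (auto simp: cw_def cX_def space_\<nu>)
    finally show ?thesis by simp
  qed
  have "{\<xi> \<in> space E. badE 0 k \<xi>} = (\<Union>i\<in>?S. ?A i)" by auto
  then have "E.prob {\<xi> \<in> space E. badE 0 k \<xi>} = E.prob (\<Union>i\<in>?S. ?A i)" by (rule arg_cong)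
  also have "\<dots> \<le> (\<Sum>i\<in>?S. E.prob (?A i))"
    using A by (intro E.finite_measure_subadditive_finite) auto
  also have "\<dots> = 2 * width n0 * measure \<nu> ?Z" unfolding PA by (simp add: algebra_simps)
  also have "\<dots> \<le> \<delta> n0" using base by (simp add: \<delta>_def)
  finally show ?case by simp
next
  case (Suc m)
  define n where "n = n0 + m"
  let ?R = "ratio n" and ?W = "width n"
  let ?I = "{k * ?R..<k * ?R + 2 * ?R}"
  let ?P = "{p \<in> ?I \<times> ?I. fst p + 2 \<le> snd p}"
  let ?A = "\<lambda>p. {\<xi> \<in> space E. badE m (fst p) \<xi> \<and> badE m (snd p) \<xi>}"
  let ?w = "\<lambda>j. {max (k * ?R) (j - buffer n) * ?W..<min (k * ?R + 2 * ?R) (Suc j + buffer n) * ?W}"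
  let ?B = "\<lambda>j. {\<xi> \<in> space E. threshold n < (\<Sum>i\<in>?w j. cX \<xi> i)}"
  have A: "?A p \<in> sets E" for p by measurable
  have B: "?B j \<in> sets E" for j by measurable
  have "{\<xi> \<in> space E. badE (Suc m) k \<xi>} \<subseteq> (\<Union>p\<in>?P. ?A p) \<union> (\<Union>j\<in>?I. ?B j)"
  proof
    fix \<xi> assume \<xi>: "\<xi> \<in> {\<xi> \<in> space E. badE (Suc m) k \<xi>}"
    have "(\<exists>j j'. k * ?R \<le> j \<and> j + 2 \<le> j' \<and> Suc j' < k * ?R + 2 * ?R \<and> badE m j \<xi> \<and> badE m j' \<xi>)
      \<or> (\<exists>j. k * ?R \<le> j \<and> j < k * ?R + 2 * ?R \<and> threshold n < (\<Sum>i\<in>?w j. cX \<xi> i))"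
      using \<xi> unfolding mem_Collect_eq bad.simps n_def by (rule conjunct2)
    then consider (pair) j j' where "k * ?R \<le> j" "j + 2 \<le> j'" "Suc j' < k * ?R + 2 * ?R" "badE m j \<xi>" "badE m j' \<xi>"
      | (window) j where "j \<in> ?I" "threshold n < (\<Sum>i\<in>?w j. cX \<xi> i)"
      unfolding atLeastLessThan_iff by blast
    then show "\<xi> \<in> (\<Union>p\<in>?P. ?A p) \<union> (\<Union>j\<in>?I. ?B j)"
    proof cases
      case pair
      have "j \<in> ?I" "j' \<in> ?I" unfolding atLeastLessThan_iff using pair by linarith+
      then have "(j, j') \<in> ?P" using pair(2) by simp
      moreover have "\<xi> \<in> ?A (j, j')" using pair \<xi> by simp
      ultimately show ?thesis by blast
    next
      case window
      then show ?thesis using \<xi> by blast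
    qed
  qed
  then have "E.prob {\<xi> \<in> space E. badE (Suc m) k \<xi>} \<le> E.prob ((\<Union>p\<in>?P. ?A p) \<union> (\<Union>j\<in>?I. ?B j))"
    using A B by (intro E.finite_measure_mono) auto
  also have "\<dots> \<le> E.prob (\<Union>p\<in>?P. ?A p) + E.prob (\<Union>j\<in>?I. ?B j)"
    using A B by (intro measure_Un_le) auto
  also have "E.prob (\<Union>p\<in>?P. ?A p) \<le> (\<Sum>p\<in>?P. E.prob (?A p))"
    using A by (intro E.finite_measure_subadditive_finite) auto
  also have "(\<Sum>p\<in>?P. E.prob (?A p)) \<le> (\<Sum>p\<in>?P. (\<delta> n)\<^sup>2)"
  proof (rule sum_mono)
    fix p assume p: "p \<in> ?P"
    have "E.prob (?A p) = E.prob {\<xi> \<in> space E. badE m (fst p) \<xi>} * E.prob {\<xi> \<in> space E. badE m (snd p) \<xi>}"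
      by (rule bad_two_blocks) (use p in auto)
    also have "\<dots> \<le> \<delta> n * \<delta> n" using Suc unfolding n_def by (intro mult_mono) (auto simp: \<delta>_def)
    finally show "E.prob (?A p) \<le> (\<delta> n)\<^sup>2" by (simp add: power2_eq_square)
  qed
  also have "\<dots> \<le> (2 * real ?R)\<^sup>2 * (\<delta> n)\<^sup>2"
  proof -
    have "card ?P \<le> card (?I \<times> ?I)" by (intro card_mono) auto
    also have "\<dots> = (2 * ?R)\<^sup>2" by (simp add: card_cartesian_product power2_eq_square)
    finally have "real (card ?P) \<le> real ((2 * ?R)\<^sup>2)" by (simp only: of_nat_le_iff)
    then have "real (card ?P) \<le> (2 * real ?R)\<^sup>2" by simp
    then show ?thesis by (simp add: mult_right_mono)
  qed
  also have "E.prob (\<Union>j\<in>?I. ?B j) \<le> (\<Sum>j\<in>?I. E.prob (?B j))"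
    using B by (intro E.finite_measure_subadditive_finite) auto
  also have "\<dots> \<le> (\<Sum>j\<in>?I. 60 * (C / (2 ^ n) ^ 18) + 2 * 2 ^ n\<^sup>2 / threshold n)"
    by (intro sum_mono window_tail window_card) (auto simp: n_def)
  also have "\<dots> = 2 * real ?R * (60 * (C / (2 ^ n) ^ 18) + 2 * 2 ^ n\<^sup>2 / threshold n)" by simp
  also have "(2 * real ?R)\<^sup>2 * (\<delta> n)\<^sup>2 + 2 * real ?R * (60 * (C / (2 ^ n) ^ 18) + 2 * 2 ^ n\<^sup>2 / threshold n) \<le> \<delta> (Suc n)"
    by (rule window_numeric) (simp add: n_def)
  finally show ?case by (simp add: n_def)
qed

text \<open>Borel and Cantelli: at scale \<open>n\<close> about \<open>2 ^ (4 * n)\<close> blocks have to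
  be good, and each is bad with probability at most \<open>2 ^ (- 12 * n)\<close>. In particular no bad
  block is close to the left side.\<close>

theorem AE_eventually_good:
  "AE \<xi> in E. \<exists>m0. \<forall>m\<ge>m0. \<forall>k<ratio (n0 + m). \<not> badE m k \<xi>"
proof -
  let ?A = "\<lambda>m. {\<xi> \<in> space E. \<exists>k<ratio (n0 + m). badE m k \<xi>}"
  have A: "?A m \<in> sets E" for m by measurable
  have PA: "E.prob (?A m) \<le> 4 * (1 / 2) ^ m" for m
  proof -
    define u :: real where "u = 2 ^ (n0 + m)"
    have u: "1 \<le> u" unfolding u_def by simp
    have "?A m = (\<Union>k<ratio (n0 + m). {\<xi> \<in> space E. badE m k \<xi>})" by auto
    then have "E.prob (?A m) = E.prob (\<Union>k<ratio (n0 + m). {\<xi> \<in> space E. badE m k \<xi>})" by (rule arg_cong)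
    also have "\<dots> \<le> (\<Sum>k<ratio (n0 + m). E.prob {\<xi> \<in> space E. badE m k \<xi>})"
      by (intro E.finite_measure_subadditive_finite) auto
    also have "\<dots> \<le> (\<Sum>k<ratio (n0 + m). \<delta> (n0 + m))" by (intro sum_mono prob_bad)
    also have "\<dots> = 4 * (u ^ 4 / u ^ 12)" by (simp add: ratio_real \<delta>_def u_def)
    also have "u ^ 4 / u ^ 12 = 1 / u ^ 8" using u by (simp add: field_simps numeral_eq_Suc)
    also have "\<dots> \<le> 1 / 2 ^ m"
    proof -
      have "(2::real) ^ m \<le> u" unfolding u_def by (intro power_increasing) auto
      also have "u \<le> u ^ 8" using u by (intro self_le_power) auto
      finally show ?thesis using u by (intro divide_left_mono) auto
    qed
    finally show ?thesis by (simp add: power_one_over)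
  qed
  have "summable (\<lambda>m. E.prob (?A m))"
  proof (rule summable_comparison_test')
    show "summable (\<lambda>m. 4 * (1 / 2 :: real) ^ m)" by (intro summable_mult summable_geometric) simp
    show "norm (E.prob (?A m)) \<le> 4 * (1 / 2) ^ m" for m using PA[of m] by simp
  qed
  then have "AE \<xi> in E. eventually (\<lambda>m. \<xi> \<in> space E - ?A m) sequentially"
    using A by (intro borel_cantelli_AE1) (auto simp: E.emeasure_eq_measure)
  then show ?thesis
  proof (rule AE_mp, intro AE_I2 impI)
    fix \<xi> assume "\<xi> \<in> space E" "eventually (\<lambda>m. \<xi> \<in> space E - ?A m) sequentially"
    then show "\<exists>m0. \<forall>m\<ge>m0. \<forall>k<ratio (n0 + m). \<not> badE m k \<xi>"
      unfolding eventually_sequentially by blast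
  qed
qed

lemma AE_escape_prob:
  "AE \<xi> in E. \<exists>m0. \<forall>m\<ge>m0. measure (bern (column_probs (cw \<xi>) (cX \<xi>))) (escape n0 m) \<le> (1 / 2) ^ (n0 + m)"
  using AE_eventually_good
proof (rule AE_mp, intro AE_I2 impI)
  fix \<xi> assume "\<exists>m0. \<forall>m\<ge>m0. \<forall>k<ratio (n0 + m). \<not> badE m k \<xi>"
  then obtain m0 where m0: "\<And>m k. m0 \<le> m \<Longrightarrow> k < ratio (n0 + m) \<Longrightarrow> \<not> badE m k \<xi>" by blast
  interpret columns "cw \<xi>" "cX \<xi>" n0 \<epsilon> by (rule columns)
  show "\<exists>m0. \<forall>m\<ge>m0. measure (bern (column_probs (cw \<xi>) (cX \<xi>))) (escape n0 m) \<le> (1 / 2) ^ (n0 + m)"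
    using escape_prob m0 by blast
qed

end

section \<open>Clusters and the uniform coupling\<close>

definition percolates :: "(bond \<Rightarrow> bool) set" where
  "percolates = {\<omega>. infinite {v. conn \<omega> UNIV (0, 0) v}}"

lemma infinite_sites_iff: "infinite (A :: site set) \<longleftrightarrow> (\<forall>n. \<exists>v\<in>A. n \<le> fst v + snd v)"
proof
  assume inf: "infinite A"
  show "\<forall>n. \<exists>v\<in>A. n \<le> fst v + snd v"
  proof (rule ccontr)
    assume "\<not> ?thesis"
    then obtain n where "\<And>v. v \<in> A \<Longrightarrow> fst v + snd v < n" by (auto simp: not_le)
    then have "A \<subseteq> {..<n} \<times> {..<n}" by (force simp: mem_Times_iff)
    then show False using inf finite_subset[of A "{..<n} \<times> {..<n}"] by auto
  qed
next
  assume ub: "\<forall>n. \<exists>v\<in>A. n \<le> fst v + snd v"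
  show "infinite A"
  proof
    assume "finite A"
    then have "finite ((\<lambda>v. fst v + snd v) ` A)" by simp
    then obtain n where "\<forall>k\<in>(\<lambda>v. fst v + snd v) ` A. k < n"
      unfolding finite_nat_set_iff_bounded by blast
    then show False using ub by (meson imageI not_less)
  qed
qed

lemma percolates_measurable [measurable]: "percolates \<in> sets configs"
proof -
  have "{\<omega> \<in> space configs. \<forall>n. \<exists>v. conn \<omega> UNIV (0, 0) v \<and> n \<le> fst v + snd v} \<in> sets configs"
    by measurable
  also have "{\<omega> \<in> space configs. \<forall>n. \<exists>v. conn \<omega> UNIV (0, 0) v \<and> n \<le> fst v + snd v} = percolates"
    unfolding percolates_def by (auto simp: infinite_sites_iff)
  finally show ?thesis .
qed

lemma percolates_mono:
  assumes "\<omega> \<in> percolates" "\<And>e. \<omega> e \<Longrightarrow> \<omega>' e"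
  shows "\<omega>' \<in> percolates"
proof -
  have "{v. conn \<omega> UNIV (0, 0) v} \<subseteq> {v. conn \<omega>' UNIV (0, 0) v}"
    using conn_mono_config[of \<omega> UNIV _ _ \<omega>'] assms(2) by blast
  then show ?thesis using assms(1) unfolding percolates_def by (auto dest: finite_subset)
qed

lemma conn_exits:
  assumes "conn \<omega> S u v" "u \<in> T"
  shows "conn \<omega> (S \<inter> T) u v \<or> (\<exists>z z'. conn \<omega> (S \<inter> T) u z \<and> linked \<omega> z z' \<and> z' \<notin> T)"
  using assms(1)
proof (induction rule: conn_induct)
  case refl
  then show ?case using conn_in[OF assms(1)] assms(2) by (auto intro: conn_refl)
next
  case (step v x)
  then show ?case by (cases "x \<in> T") (blast intro: conn_step)+
qed

lemma escape_if_leaves_box: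
  assumes z: "conn \<omega> ({0..<width (Suc (n0 + m))} \<times> {0..<2 * height n0 (Suc m)}) u z" "linked \<omega> z z'"
      "z' \<notin> {0..<width (Suc (n0 + m))} \<times> {0..<2 * height n0 (Suc m)}"
    and u: "fst u = 0" "snd u < height n0 (Suc m)"
  shows "\<omega> \<in> escape n0 m"
proof -
  let ?W = "width (Suc (n0 + m))" and ?H = "height n0 (Suc m)"
  show ?thesis
  proof (cases "?W \<le> fst z'")
    case True
    then have "?W \<le> Suc (fst z)" using linked_coords(1)[OF z(2)] by linarith
    then have "\<omega> \<in> hcross 0 ?W 0 (2 * ?H)"
      using u by (intro hcrossI[OF z(1)]) (auto simp del: height.simps)
    then show ?thesis unfolding escape_def by blast
  next
    case False
    then have "2 * ?H \<le> snd z'" using z(3) by (auto simp: mem_Times_iff simp del: height.simps)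
    then have "?H + ?H \<le> Suc (snd z)" using linked_coords(3)[OF z(2)] by linarith
    then have "\<omega> \<in> vcross 0 ?W ?H ?H"
      using u by (intro vcrossI[OF z(1)]) (auto simp del: height.simps)
    then show ?thesis unfolding escape_def by blast
  qed
qed

text \<open>An infinite cluster leaves the box that starts at the origin, through its right side or through
  its top.\<close>

lemma percolates_subset_escape: "percolates \<subseteq> escape n0 m"
proof
  fix \<omega> assume "\<omega> \<in> percolates"
  let ?W = "width (Suc (n0 + m))" and ?H = "height n0 (Suc m)"
  let ?T = "{0..<?W} \<times> {0..<2 * ?H}"
  have H: "2 \<le> ?H" by (rule height_ge)
  have W: "0 < ?W" by (rule width_pos)
  obtain v where v: "conn \<omega> UNIV (0, 0) v" "?W + 2 * ?H \<le> fst v + snd v"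
    using \<open>\<omega> \<in> percolates\<close> unfolding percolates_def infinite_sites_iff by blast
  have "v \<notin> ?T" using v(2) by (auto simp: mem_Times_iff simp del: height.simps)
  moreover have "(0, 0) \<in> ?T" using H W by (simp del: height.simps)
  ultimately obtain z z' where z: "conn \<omega> ?T (0, 0) z" "linked \<omega> z z'" "z' \<notin> ?T"
    using conn_exits[OF v(1), of ?T] conn_in by (metis Int_iff inf_top.left_neutral)
  show "\<omega> \<in> escape n0 m"
    by (rule escape_if_leaves_box[OF z]) (use H in \<open>auto simp del: height.simps\<close>)
qed

lemma distr_bernoulli:
  assumes "prob_space N" and X: "X \<in> measurable N (count_space UNIV)"
    and p: "measure N {x \<in> space N. X x} = p"
  shows "distr N (count_space UNIV) X = measure_pmf (bernoulli_pmf p)"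
proof -
  interpret N: prob_space N by fact
  interpret D: prob_space "distr N (count_space UNIV) X" by (rule N.prob_space_distr[OF X])
  have p01: "0 \<le> p" "p \<le> 1" using p by auto
  have T: "measure (distr N (count_space UNIV) X) {True} = p"
    using measure_distr[OF X, of "{True}"] p by (simp add: vimage_def Int_def conj_commute)
  have F: "measure (distr N (count_space UNIV) X) {False} = 1 - p"
    using D.prob_compl[of "{True}"] T by (simp add: UNIV_bool insert_Diff_if)
  show ?thesis
  proof (rule measure_eqI_finite[where A = UNIV])
    fix a :: bool
    have "measure (distr N (count_space UNIV) X) {a} = measure (measure_pmf (bernoulli_pmf p)) {a}"
      using T F p01 by (cases a) (simp_all add: measure_pmf_single)
    then show "emeasure (distr N (count_space UNIV) X) {a} = emeasure (measure_pmf (bernoulli_pmf p)) {a}"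
      by (simp add: D.emeasure_eq_measure measure_pmf.emeasure_eq_measure)
  qed auto
qed

lemma distr_bern:
  assumes "prob_space N" and ind: "prob_space.indep_vars N (\<lambda>_. count_space UNIV) X UNIV"
    and p: "\<And>e. measure N {x \<in> space N. X e x} = r e"
  shows "distr N configs (\<lambda>\<omega> e. X e \<omega>) = bern r"
proof -
  interpret N: prob_space N by fact
  have rv: "X e \<in> measurable N (count_space UNIV)" for e using ind unfolding N.indep_vars_def by blast
  have "distr N configs (\<lambda>\<omega> e. X e \<omega>) = distr N (bern r) (\<lambda>\<omega>. \<lambda>e\<in>UNIV. X e \<omega>)"
    by (intro distr_cong) auto
  also have "\<dots> = bern r"
    unfolding bern_def by (rule distr_PiM_independent[OF \<open>prob_space N\<close> _ ind])
      (auto intro: distr_bernoulli[OF \<open>prob_space N\<close> rv p])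
  finally show ?thesis .
qed

text \<open>All the product measures are realised on one space of independent uniform variables.\<close>

definition unif01 :: "real measure" where "unif01 = uniform_measure lborel {0..1}"

definition uniforms :: "(bond \<Rightarrow> real) measure" where "uniforms = Pi\<^sub>M UNIV (\<lambda>_. unif01)"

definition open_below :: "(bond \<Rightarrow> real) \<Rightarrow> (bond \<Rightarrow> real) \<Rightarrow> bond \<Rightarrow> bool" where
  "open_below r U e \<longleftrightarrow> U e < r e"

lemma prob_space_unif01: "prob_space unif01"
  unfolding unif01_def by (rule prob_space_uniform_measure) auto

lemma sets_unif01 [simp, measurable_cong]: "sets unif01 = sets borel"
  by (simp add: unif01_def)

lemma prob_space_uniforms: "prob_space uniforms"
  unfolding uniforms_def by (intro prob_space_PiM prob_space_unif01)

lemma uniforms_component: "(\<lambda>U. U e) \<in> measurable uniforms unif01"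
  unfolding uniforms_def by (rule measurable_component_singleton) simp

lemma uniforms_component' [measurable]: "(\<lambda>U. U e) \<in> borel_measurable uniforms"
  using uniforms_component measurable_cong_sets[OF refl sets_unif01] by blast

lemma unif01_less:
  assumes "0 \<le> p" "p \<le> 1"
  shows "measure unif01 {..<p} = p"
proof -
  have "{0..1} \<inter> {..<p} = {0..<p}" using assms by auto
  then show ?thesis
    unfolding unif01_def using assms by (simp add: measure_uniform_measure)
qed

lemma distr_uniforms:
  assumes r: "\<And>e. 0 \<le> r e \<and> r e \<le> 1"
  shows "distr uniforms configs (open_below r) = bern r"
proof -
  have "distr uniforms configs (\<lambda>U e. U e < r e) = bern r"
  proof (rule distr_bern[OF prob_space_uniforms])
    have "prob_space.indep_vars uniforms (\<lambda>_. unif01) (\<lambda>e U. U e) UNIV"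
      unfolding uniforms_def by (rule PiM_coordinates_indep_vars) (auto intro: prob_space_unif01)
    then show "prob_space.indep_vars uniforms (\<lambda>_. count_space UNIV) (\<lambda>e U. U e < r e) UNIV"
      by (rule prob_space.indep_vars_compose2[OF prob_space_uniforms]) measurable
    fix e
    have "measure unif01 {..<r e} = measure (distr uniforms unif01 (\<lambda>U. U e)) {..<r e}"
      unfolding uniforms_def by (subst distr_PiM_component) (auto intro: prob_space_unif01)
    also have "\<dots> = measure uniforms ((\<lambda>U. U e) -` {..<r e} \<inter> space uniforms)"
      by (rule measure_distr[OF uniforms_component]) simp
    also have "(\<lambda>U. U e) -` {..<r e} \<inter> space uniforms = {U \<in> space uniforms. U e < r e}" by auto
    finally show "measure uniforms {U \<in> space uniforms. U e < r e} = r e"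
      using unif01_less r by simp
  qed
  then show ?thesis by (simp add: open_below_def[abs_def])
qed

lemma open_below_measurable:
  assumes "\<And>e. (\<lambda>x. r x e) \<in> borel_measurable N"
  shows "(\<lambda>(x, U). open_below (r x) U) \<in> measurable (N \<Otimes>\<^sub>M uniforms) configs"
proof -
  have "(\<lambda>z e. snd z e < r (fst z) e) \<in> measurable (N \<Otimes>\<^sub>M uniforms) configs"
  proof (rule measurable_PiM_single')
    fix e :: bond
    note assms[of e, measurable]
    have "Measurable.pred (N \<Otimes>\<^sub>M uniforms) (\<lambda>z. snd z e < r (fst z) e)" by measurable
    then show "(\<lambda>z. snd z e < r (fst z) e) \<in> measurable (N \<Otimes>\<^sub>M uniforms) (count_space UNIV)" .
  qed auto
  then show ?thesis by (simp add: open_below_def[abs_def] case_prod_beta)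
qed

lemma bern_prob_uniforms:
  assumes r: "\<And>e. 0 \<le> r e \<and> r e \<le> 1" and A: "A \<in> sets configs"
  shows "measure (bern r) A = measure uniforms {U \<in> space uniforms. open_below r U \<in> A}"
proof -
  have "(\<lambda>(x, U). open_below r U) \<in> measurable (count_space (UNIV :: unit set) \<Otimes>\<^sub>M uniforms) configs"
    by (rule open_below_measurable) simp
  from measurable_compose[OF measurable_Pair1'[of "()"] this]
  have m: "open_below r \<in> measurable uniforms configs" by simp
  have "measure (bern r) A = measure uniforms (open_below r -` A \<inter> space uniforms)"
    using measure_distr[OF m A] by (simp add: distr_uniforms[OF r])
  also have "open_below r -` A \<inter> space uniforms = {U \<in> space uniforms. open_below r U \<in> A}" by auto
  finally show ?thesis .
qed

text \<open>In the coupling the event depends jointly measurably on the parameters and the uniform variables,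
  and Fubini applies.\<close>

lemma bern_prob_measurable:
  assumes m: "\<And>e. (\<lambda>x. r x e) \<in> borel_measurable N" and r: "\<And>x e. 0 \<le> r x e \<and> r x e \<le> 1"
    and A: "A \<in> sets configs"
  shows "(\<lambda>x. measure (bern (r x)) A) \<in> borel_measurable N"
proof -
  interpret U: prob_space uniforms by (rule prob_space_uniforms)
  let ?Q = "{z \<in> space (N \<Otimes>\<^sub>M uniforms). open_below (r (fst z)) (snd z) \<in> A}"
  have "?Q = (\<lambda>(x, U). open_below (r x) U) -` A \<inter> space (N \<Otimes>\<^sub>M uniforms)" by auto
  then have "?Q \<in> sets (N \<Otimes>\<^sub>M uniforms)"
    using measurable_sets[OF open_below_measurable[OF m] A] by simp
  then have "(\<lambda>x. emeasure uniforms (Pair x -` ?Q)) \<in> borel_measurable N"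
    by (rule U.measurable_emeasure_Pair)
  then have 1: "(\<lambda>x. enn2real (emeasure uniforms (Pair x -` ?Q))) \<in> borel_measurable N" by measurable
  show ?thesis
  proof (rule measurable_cong[THEN iffD2, OF _ 1])
    fix x assume "x \<in> space N"
    then have "Pair x -` ?Q = {U \<in> space uniforms. open_below (r x) U \<in> A}"
      by (auto simp: space_pair_measure)
    then show "measure (bern (r x)) A = enn2real (emeasure uniforms (Pair x -` ?Q))"
      using bern_prob_uniforms[of "r x", OF r A] by (simp add: measure_def)
  qed
qed

lemma percolation_prob_mono:
  assumes r: "\<And>e. 0 \<le> r e \<and> r e \<le> r' e \<and> r' e \<le> 1"
  shows "measure (bern r) percolates \<le> measure (bern r') percolates"
proof -
  interpret U: prob_space uniforms by (rule prob_space_uniforms)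
  have r1: "\<And>e. 0 \<le> r e \<and> r e \<le> 1" and r2: "\<And>e. 0 \<le> r' e \<and> r' e \<le> 1"
    using r by (meson order_trans)+
  have m: "{U \<in> space uniforms. open_below r' U \<in> percolates} \<in> sets uniforms"
  proof -
    have "(\<lambda>(x, U). open_below r' U) \<in> measurable (count_space (UNIV :: unit set) \<Otimes>\<^sub>M uniforms) configs"
      by (rule open_below_measurable) simp
    from measurable_compose[OF measurable_Pair1'[of "()"] this]
    have [measurable]: "open_below r' \<in> measurable uniforms configs" by simp
    show ?thesis by measurable
  qed
  have "measure uniforms {U \<in> space uniforms. open_below r U \<in> percolates}
      \<le> measure uniforms {U \<in> space uniforms. open_below r' U \<in> percolates}"
  proof (rule U.finite_measure_mono[OF _ m], safe)
    fix U assume "open_below r U \<in> percolates"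
    then show "open_below r' U \<in> percolates"
      by (rule percolates_mono) (use r in \<open>auto simp: open_below_def intro: less_le_trans\<close>)
  qed
  then show ?thesis
    unfolding bern_prob_uniforms[of r, OF r1 percolates_measurable]
      bern_prob_uniforms[of r', OF r2 percolates_measurable] .
qed

section \<open>Planar duality\<close>

text \<open>Sites of the dual lattice are the unit squares, named by their lower left corners;
  \<open>dual_bond e\<close> is the bond crossed by a step \<open>e\<close> from one square to the next.
  Bonds on the boundary of the quarter plane are not crossed.\<close>

fun dual_bond :: "bond \<Rightarrow> bond" where
  "dual_bond (j, n, b) = (if b then (Suc j, n, False) else (j, Suc n, True))"

definition dual_config :: "(bond \<Rightarrow> bool) \<Rightarrow> bond \<Rightarrow> bool" where
  "dual_config \<omega> e \<longleftrightarrow> \<not> \<omega> (dual_bond e)"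

lemma inj_dual_bond: "inj dual_bond"
proof (rule injI)
  fix x y assume "dual_bond x = dual_bond y"
  then show "x = y" by (cases x; cases y) (auto split: if_splits)
qed

lemma distr_dual:
  assumes r: "\<And>e. 0 \<le> r e \<and> r e \<le> 1"
  shows "distr (bern r) configs dual_config = bern (\<lambda>e. 1 - r (dual_bond e))"
proof -
  have "distr (bern r) configs (\<lambda>\<omega> e. \<not> \<omega> (dual_bond e)) = bern (\<lambda>e. 1 - r (dual_bond e))"
  proof (rule distr_bern[OF prob_space_bern])
    have "prob_space.indep_vars (bern r) (\<lambda>e. measure_pmf (bernoulli_pmf (r (dual_bond e)))) (\<lambda>e \<omega>. \<omega> (dual_bond e)) UNIV"
      unfolding bern_def
      by (rule PiM_reindexed_coordinates_indep_vars) (auto intro: prob_space_measure_pmf inj_dual_bond)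
    then show "prob_space.indep_vars (bern r) (\<lambda>_. count_space UNIV) (\<lambda>e \<omega>. \<not> \<omega> (dual_bond e)) UNIV"
      by (rule prob_space.indep_vars_compose2[OF prob_space_bern]) simp
    show "measure (bern r) {\<omega> \<in> space (bern r). \<not> \<omega> (dual_bond e)} = 1 - r (dual_bond e)" for e
      using bern_bond_prob[of r "dual_bond e" False] r by simp
  qed
  then show ?thesis by (simp add: dual_config_def[abs_def])
qed

lemma dual_config_measurable: "dual_config \<in> measurable configs configs"
proof (rule measurable_PiM_single')
  fix e :: bond
  have "Measurable.pred configs (\<lambda>\<omega>. \<not> \<omega> (dual_bond e))" by measurable
  then show "(\<lambda>\<omega>. dual_config \<omega> e) \<in> measurable configs (count_space UNIV)"
    by (simp add: dual_config_def)
qed auto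

lemma even_sum_telescope:
  fixes g :: "nat \<Rightarrow> int"
  shows "even ((\<Sum>j<N. g j + g (Suc j)) + g 0 + g N)"
proof (induction N)
  case (Suc N)
  have "(\<Sum>j<Suc N. g j + g (Suc j)) + g 0 + g (Suc N)
      = ((\<Sum>j<N. g j + g (Suc j)) + g 0 + g N) + 2 * g (Suc N)" by simp
  then show ?case using Suc by (simp only: even_add even_mult_iff even_numeral simp_thms)
qed simp

text \<open>The boundary bonds of the cluster \<open>C\<close> are closed. Let \<open>S\<close> be the set of
  squares that closed dual paths reach from the left side, and suppose that it contains no square of the
  bottom row. Every square has an even number of boundary bonds of \<open>C\<close>. Summed over
  \<open>S\<close>, a boundary bond between two squares is counted twice or not at all, so the number of
  boundary bonds on the left side is even. But this number is odd, since the left side starts in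
  \<open>C\<close> and leaves it for good.\<close>

lemma finite_cluster_dual_path:
  assumes fin: "finite {v. conn \<omega> UNIV (0, 0) v}"
  shows "\<exists>m j. \<not> \<omega> (0, m, False) \<and> conn (dual_config \<omega>) UNIV (0, m) (j, 0)"
proof (rule ccontr)
  assume no: "\<not> ?thesis"
  define C where "C = {v. conn \<omega> UNIV (0, 0) v}"
  define c :: "nat \<Rightarrow> nat \<Rightarrow> int" where "c i n = of_bool ((i, n) \<in> C)" for i n
  obtain N where N: "\<And>v. v \<in> C \<Longrightarrow> fst v < N \<and> snd v < N"
  proof -
    have "\<exists>n. \<forall>v\<in>C. \<not> n \<le> fst v + snd v"
      using fin infinite_sites_iff[of C] unfolding C_def by blast
    then obtain n where "\<And>v. v \<in> C \<Longrightarrow> fst v + snd v < n" by (meson not_le)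
    then have "\<And>v. v \<in> C \<Longrightarrow> fst v < n \<and> snd v < n" by fastforce
    then show ?thesis using that by blast
  qed
  define dV where "dV i n = \<bar>c i n - c i (Suc n)\<bar>" for i n
  define dH where "dH i n = \<bar>c i n - c (Suc i) n\<bar>" for i n
  have closed: "u \<in> C \<longleftrightarrow> v \<in> C" if "linked \<omega> u v" for u v
    using that conn_step[of \<omega> UNIV "(0, 0)"] linked_sym unfolding C_def mem_Collect_eq by blast
  have dV_closed: "\<not> \<omega> (i, n, False)" if "dV i n \<noteq> 0" for i n
  proof
    assume "\<omega> (i, n, False)"
    then have "linked \<omega> (i, n) (i, Suc n)" unfolding linked_def by (intro exI[of _ "(i, n, False)"]) simp
    from closed[OF this] show False using that by (simp add: dV_def c_def)
  qed
  have dH_closed: "\<not> \<omega> (i, n, True)" if "dH i n \<noteq> 0" for i n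
  proof
    assume "\<omega> (i, n, True)"
    then have "linked \<omega> (i, n) (Suc i, n)" unfolding linked_def by (intro exI[of _ "(i, n, True)"]) simp
    from closed[OF this] show False using that by (simp add: dH_def c_def)
  qed
  define S where "S = {f. \<exists>m. \<not> \<omega> (0, m, False) \<and> conn (dual_config \<omega>) UNIV (0, m) f}"
  define s :: "nat \<Rightarrow> nat \<Rightarrow> int" where "s j n = of_bool ((j, n) \<in> S)" for j n
  have S_link: "f \<in> S \<longleftrightarrow> g \<in> S" if "linked (dual_config \<omega>) f g" for f g
    using that conn_step[of "dual_config \<omega>" UNIV] linked_sym unfolding S_def by blast
  \<comment> \<open>a boundary bond is closed, hence joins two squares that are both in \<open>S\<close> or both outside\<close>
  have sV: "s j n * dV (Suc j) n = s (Suc j) n * dV (Suc j) n" for j n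
  proof (cases "dV (Suc j) n = 0")
    case False
    then have "dual_config \<omega> (j, n, True)" using dV_closed by (simp add: dual_config_def)
    then have "linked (dual_config \<omega>) (j, n) (Suc j, n)"
      unfolding linked_def by (intro exI[of _ "(j, n, True)"]) simp
    from S_link[OF this] show ?thesis by (simp add: s_def)
  qed simp
  have sH: "s j n * dH j (Suc n) = s j (Suc n) * dH j (Suc n)" for j n
  proof (cases "dH j (Suc n) = 0")
    case False
    then have "dual_config \<omega> (j, n, False)" using dH_closed by (simp add: dual_config_def)
    then have "linked (dual_config \<omega>) (j, n) (j, Suc n)"
      unfolding linked_def by (intro exI[of _ "(j, n, False)"]) simp
    from S_link[OF this] show ?thesis by (simp add: s_def)
  qed simp
  have s_left: "s 0 n * dV 0 n = dV 0 n" for n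
  proof (cases "dV 0 n = 0")
    case False
    then have "(0, n) \<in> S" unfolding S_def using dV_closed by (blast intro: conn_refl)
    then show ?thesis by (simp add: s_def)
  qed simp
  have s_bottom: "s j 0 = 0" for j
    using no unfolding s_def S_def by auto
  have c_out: "c N n = 0" "c n N = 0" for n using N[of "(N, n)"] N[of "(n, N)"] by (auto simp: c_def)
  have face: "even (dV j n + dV (Suc j) n + (dH j n + dH j (Suc n)))" for j n
    unfolding dV_def dH_def c_def by (auto simp: of_bool_def)
  have 1: "even (\<Sum>j<N. \<Sum>n<N. s j n * (dV j n + dV (Suc j) n + (dH j n + dH j (Suc n))))"
    using face by (intro dvd_sum) auto
  have V: "even ((\<Sum>j<N. s j n * (dV j n + dV (Suc j) n)) + dV 0 n)" for n
  proof -
    have "(\<Sum>j<N. s j n * (dV j n + dV (Suc j) n)) = (\<Sum>j<N. s j n * dV j n + s (Suc j) n * dV (Suc j) n)"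
      by (simp add: distrib_left sV)
    moreover have "s N n * dV N n = 0" using c_out by (simp add: dV_def)
    ultimately show ?thesis
      using even_sum_telescope[of "\<lambda>j. s j n * dV j n" N] by (simp only: s_left add_0_right)
  qed
  have H: "even (\<Sum>n<N. s j n * (dH j n + dH j (Suc n)))" for j
  proof -
    have "(\<Sum>n<N. s j n * (dH j n + dH j (Suc n))) = (\<Sum>n<N. s j n * dH j n + s j (Suc n) * dH j (Suc n))"
      by (simp add: distrib_left sH)
    moreover have "s j N * dH j N = 0" using c_out by (simp add: dH_def)
    ultimately show ?thesis
      using even_sum_telescope[of "\<lambda>n. s j n * dH j n" N] by (simp only: s_bottom mult_zero_left add_0_right)
  qed
  have "(\<Sum>j<N. \<Sum>n<N. s j n * (dV j n + dV (Suc j) n + (dH j n + dH j (Suc n))))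
     = (\<Sum>j<N. \<Sum>n<N. s j n * (dV j n + dV (Suc j) n)) + (\<Sum>j<N. \<Sum>n<N. s j n * (dH j n + dH j (Suc n)))"
    by (simp only: distrib_left[of _ "dV _ _ + dV _ _" "dH _ _ + dH _ _"] sum.distrib)
  also have "(\<Sum>j<N. \<Sum>n<N. s j n * (dV j n + dV (Suc j) n)) = (\<Sum>n<N. \<Sum>j<N. s j n * (dV j n + dV (Suc j) n))"
    by (rule sum.swap)
  finally have split: "(\<Sum>j<N. \<Sum>n<N. s j n * (dV j n + dV (Suc j) n + (dH j n + dH j (Suc n))))
     = (\<Sum>n<N. \<Sum>j<N. s j n * (dV j n + dV (Suc j) n)) + (\<Sum>j<N. \<Sum>n<N. s j n * (dH j n + dH j (Suc n)))" .
  have "even (\<Sum>j<N. \<Sum>n<N. s j n * (dH j n + dH j (Suc n)))" by (rule dvd_sum) (rule H)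
  then have "even (\<Sum>n<N. \<Sum>j<N. s j n * (dV j n + dV (Suc j) n))"
    using 1 unfolding split by (simp only: even_add)
  moreover have "even ((\<Sum>n<N. \<Sum>j<N. s j n * (dV j n + dV (Suc j) n)) + (\<Sum>n<N. dV 0 n))"
    unfolding sum.distrib[symmetric] by (rule dvd_sum) (rule V)
  ultimately have "even (\<Sum>n<N. dV 0 n)" by (simp only: even_add)
  moreover have "even ((\<Sum>n<N. dV 0 n) + (\<Sum>n<N. c 0 n + c 0 (Suc n)))"
    unfolding sum.distrib[symmetric] by (intro dvd_sum) (auto simp: dV_def c_def of_bool_def)
  ultimately have "even (\<Sum>n<N. c 0 n + c 0 (Suc n))" by (simp only: even_add)
  then have "even (c 0 0 + c 0 N)" using even_sum_telescope[of "c 0" N] unfolding even_add by blast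
  moreover have "c 0 N = 0" by (rule c_out)
  moreover have "c 0 0 = 1" unfolding c_def C_def by (simp add: conn_refl)
  ultimately show False by simp
qed

text \<open>Choose the scale \<open>i\<close> with
  \<open>height n0 i \<le> m < height n0 (Suc i)\<close>. A path from \<open>(0, m)\<close> to the
  bottom that stays in the box of this scale descends through all rows below \<open>height n0 i\<close>;
  otherwise it leaves the box.\<close>

lemma dual_path_escapes:
  assumes path: "conn \<eta> UNIV (0, m) (j, 0)" and m: "height n0 m1 \<le> m"
  shows "\<exists>i\<ge>m1. \<eta> \<in> escape n0 i"
proof -
  have "\<exists>k. m < height n0 k"
  proof -
    have "k \<le> height n0 k" for k
    proof (induction k)
      case (Suc k)
      then show ?case using height_Suc_ge[of n0 k] by linarith
    qed simp
    then have "m < height n0 (Suc m)" by (meson Suc_le_lessD)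
    then show ?thesis by blast
  qed
  then obtain k where k: "m < height n0 k" and least: "\<And>k'. k' < k \<Longrightarrow> \<not> m < height n0 k'"
    using exists_least_iff[of "\<lambda>k. m < height n0 k"] by blast
  have mono: "height n0 a \<le> height n0 b" if "a \<le> b" for a b
    by (rule lift_Suc_mono_le[of "height n0", OF Suc_leD[OF height_Suc_ge] that])
  have "m1 < k" using k m mono[of k m1] by linarith
  then obtain i where i: "k = Suc i" "m1 \<le> i" by (cases k) auto
  have mi: "height n0 i \<le> m" using least[of i] i(1) by simp
  let ?W = "width (Suc (n0 + i))" and ?H = "height n0 (Suc i)"
  let ?T = "{0..<?W} \<times> {0..<2 * ?H}"
  have mH: "m < ?H" using k i by simp
  have W: "0 < ?W" by (rule width_pos)
  have start: "(0, m) \<in> ?T" using mH W by (simp del: height.simps)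
  have "\<eta> \<in> escape n0 i"
  proof (cases "conn \<eta> ?T (0, m) (j, 0)")
    case True
    have "\<eta> \<in> vcross 0 ?W 0 (height n0 i)"
      using mi height_ge[of n0 i] by (intro vcrossI[OF conn_sym[OF True]]) auto
    then show ?thesis unfolding escape_def by blast
  next
    case False
    then obtain z z' where z: "conn \<eta> ?T (0, m) z" "linked \<eta> z z'" "z' \<notin> ?T"
      using conn_exits[OF path start] by (metis inf_top.left_neutral)
    show ?thesis by (rule escape_if_leaves_box[OF z]) (use mH in \<open>auto simp del: height.simps\<close>)
  qed
  then show ?thesis using i(2) by blast
qed

lemma percolates_if_dual_confined:
  assumes "\<And>i. m1 \<le> i \<Longrightarrow> dual_config \<omega> \<notin> escape n0 i"
    and left: "\<And>m. m < height n0 m1 \<Longrightarrow> \<omega> (0, m, False)"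
  shows "\<omega> \<in> percolates"
proof (rule ccontr)
  assume "\<omega> \<notin> percolates"
  then obtain m j where mj: "\<not> \<omega> (0, m, False)" "conn (dual_config \<omega>) UNIV (0, m) (j, 0)"
    using finite_cluster_dual_path unfolding percolates_def by blast
  then have "height n0 m1 \<le> m" using left by (meson not_le)
  from dual_path_escapes[OF mj(2) this] show False using assms(1) by blast
qed

text \<open>The bonds on the left side are not crossed by dual steps, so the event that they are open up to a
  given height is independent of the dual configuration.\<close>

lemma percolates_pos_if_dual_escape_summable:
  assumes r: "\<And>e. 0 \<le> r e \<and> r e \<le> 1" and pos: "\<And>m. 0 < r (0, m, False)"
    and esc: "\<And>m. m0 \<le> m \<Longrightarrow> measure (bern (\<lambda>e. 1 - r (dual_bond e))) (escape n0 m) \<le> (1 / 2) ^ (n0 + m)"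
    and n0: "2 \<le> n0"
  shows "0 < measure (bern r) percolates"
proof -
  let ?r' = "\<lambda>e. 1 - r (dual_bond e)"
  let ?G = "\<Union>i. escape n0 (m0 + i)"
  let ?F = "(\<lambda>m. (0, m, False)) ` {..<height n0 m0} :: bond set"
  let ?L = "{\<omega> :: bond \<Rightarrow> bool. \<forall>e\<in>?F. \<omega> e = True}"
  let ?D = "dual_config -` (- ?G)"
  have G: "?G \<in> sets configs" by auto
  have sum: "summable (\<lambda>i. measure (bern ?r') (escape n0 (m0 + i)))"
    and half: "measure (bern ?r') ?G \<le> 1 / 2"
  proof -
    have b: "measure (bern ?r') (escape n0 (m0 + i)) \<le> 1 / 4 * (1 / 2) ^ i" for i
    proof -
      have "measure (bern ?r') (escape n0 (m0 + i)) \<le> (1 / 2) ^ (n0 + (m0 + i))" by (rule esc) simp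
      also have "\<dots> \<le> (1 / 2) ^ (2 + i)" using n0 by (intro power_decreasing) auto
      finally show ?thesis by (simp add: power_add)
    qed
    have g: "(\<lambda>i. 1 / 4 * (1 / 2) ^ i) sums (1 / 4 * (1 / (1 - 1 / 2)) :: real)"
      by (intro sums_mult geometric_sums) simp
    show sum: "summable (\<lambda>i. measure (bern ?r') (escape n0 (m0 + i)))"
      by (rule summable_comparison_test'[OF sums_summable[OF g], of 0]) (use b in simp)
    have "measure (bern ?r') ?G \<le> (\<Sum>i. measure (bern ?r') (escape n0 (m0 + i)))"
      by (rule bern.finite_measure_subadditive_countably) (use sum in auto)
    also have "\<dots> \<le> (\<Sum>i. 1 / 4 * (1 / 2) ^ i)" by (rule suminf_le[OF b sum sums_summable[OF g]])
    also have "\<dots> = 1 / 2" using sums_unique[OF g] by simp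
    finally show "measure (bern ?r') ?G \<le> 1 / 2" .
  qed
  have D: "?D \<in> sets configs"
    using measurable_sets[OF dual_config_measurable sets.compl_sets[OF G]] by (simp add: Compl_eq_Diff_UNIV)
  have PD: "1 / 2 \<le> measure (bern r) ?D"
  proof -
    have dm: "dual_config \<in> measurable (bern r) configs"
      using dual_config_measurable by (simp cong: measurable_cong_sets)
    have mG: "- ?G \<in> sets configs" using sets.compl_sets[OF G] by (simp add: Compl_eq_Diff_UNIV)
    have "measure (bern r) ?D = measure (distr (bern r) configs dual_config) (- ?G)"
      using measure_distr[OF dm mG] by simp
    also have "\<dots> = measure (bern ?r') (- ?G)" by (simp add: distr_dual[OF r])
    also have "\<dots> = 1 - measure (bern ?r') ?G"
      using bern.prob_compl[of ?G ?r'] G by (simp add: Compl_eq_Diff_UNIV)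
    finally show ?thesis using half by simp
  qed
  have L: "?L \<in> sets configs" by (rule cylinder_measurable) simp
  have PL: "0 < measure (bern r) ?L"
  proof -
    have "measure (bern r) ?L = (\<Prod>e\<in>?F. if True then r e else 1 - r e)"
      using r by (intro bern_cylinder_prob) auto
    then show ?thesis using pos by (auto intro: prod_pos)
  qed
  have "determined_by ?F ?L" unfolding determined_by_def by auto
  moreover have "determined_by (range dual_bond) ?D"
  proof -
    have "dual_config \<omega> = dual_config \<omega>'" if "\<forall>e\<in>range dual_bond. \<omega> e = \<omega>' e" for \<omega> \<omega>'
      using that by (auto simp: dual_config_def fun_eq_iff)
    then show ?thesis unfolding determined_by_def by (metis vimage_eq)
  qed
  moreover have "?F \<inter> range dual_bond = {}" by (auto split: if_splits)
  ultimately have "measure (bern r) (?L \<inter> ?D) = measure (bern r) ?L * measure (bern r) ?D"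
    using L D by (intro bern_prob_Int) auto
  moreover have "0 < measure (bern r) ?L * measure (bern r) ?D" using PL PD by (intro mult_pos_pos) auto
  moreover have "measure (bern r) (?L \<inter> ?D) \<le> measure (bern r) percolates"
  proof (rule bern.finite_measure_mono)
    show "?L \<inter> ?D \<subseteq> percolates"
    proof
      fix \<omega> assume \<omega>: "\<omega> \<in> ?L \<inter> ?D"
      show "\<omega> \<in> percolates"
      proof (rule percolates_if_dual_confined)
        show "dual_config \<omega> \<notin> escape n0 i" if "m0 \<le> i" for i
          using \<omega> that by (auto dest!: le_Suc_ex)
        show "\<omega> (0, m, False)" if "m < height n0 m0" for m using \<omega> that by auto
      qed
    qed
  qed simp
  ultimately show ?thesis by linarith
qed

section \<open>Percolation on the embedded lattice\<close>

text \<open>Koenig's argument along geodesics: follow a step that increases the distance \<open>d\<close> from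
  \<open>u0\<close> by one and keeps infinitely many geodesic descendants \<open>D\<close>. Distances strictly
  increase, so the path never returns.\<close>

lemma infinite_cluster_path:
  assumes inf: "infinite {v. conn \<omega> UNIV u0 v}"
  shows "\<exists>g. g 0 = u0 \<and> inj g \<and> (\<forall>k. linked \<omega> (g k) (g (Suc k)))"
proof -
  let ?R = "{(x, y). linked \<omega> x y}"
  define d where "d v = (LEAST n. (u0, v) \<in> ?R ^^ n)" for v
  define reach where "reach v \<longleftrightarrow> (\<exists>n. (u0, v) \<in> ?R ^^ n)" for v
  have d: "(u0, v) \<in> ?R ^^ d v" if "reach v" for v
    using that unfolding reach_def d_def by (rule LeastI_ex)
  have d_le: "d v \<le> n" if "(u0, v) \<in> ?R ^^ n" for v n
    unfolding d_def using that by (rule Least_le)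
  have d_add: "d w \<le> d v + k" "reach w" if "reach v" "(v, w) \<in> ?R ^^ k" for v w k
  proof -
    have "(u0, w) \<in> ?R ^^ (d v + k)" unfolding relpow_add using d[OF that(1)] that(2) by blast
    then show "d w \<le> d v + k" "reach w" using d_le unfolding reach_def by blast+
  qed
  define D where "D v = {w. \<exists>k. (v, w) \<in> ?R ^^ k \<and> d w = d v + k}" for v
  \<comment> \<open>the descendants of \<open>v\<close> other than \<open>v\<close> itself are descendants of finitely many neighbours\<close>
  have step: "\<exists>v'. (reach v' \<and> infinite (D v')) \<and> linked \<omega> v v' \<and> d v' = Suc (d v)"
    if v: "reach v" "infinite (D v)" for v
  proof (rule ccontr)
    assume no: "\<not> ?thesis"
    let ?N = "{v'. linked \<omega> v v' \<and> d v' = Suc (d v)}"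
    have "?N \<subseteq> {..Suc (fst v)} \<times> {..Suc (snd v)}"
    proof
      fix v' assume "v' \<in> ?N"
      then have "linked \<omega> v v'" by simp
      from linked_coords(1,3)[OF this] show "v' \<in> {..Suc (fst v)} \<times> {..Suc (snd v)}"
        by (simp add: mem_Times_iff)
    qed
    then have finN: "finite ?N" by (rule finite_subset) simp
    have reachN: "reach v'" if "linked \<omega> v v'" for v'
      using d_add(2)[OF v(1), of v' 1] that by auto
    have "D v \<subseteq> insert v (\<Union>v'\<in>?N. D v')"
    proof
      fix w assume "w \<in> D v"
      then obtain k where k: "(v, w) \<in> ?R ^^ k" "d w = d v + k" unfolding D_def by blast
      show "w \<in> insert v (\<Union>v'\<in>?N. D v')"
      proof (cases k)
        case 0
        then show ?thesis using k by simp
      next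
        case (Suc k')
        then obtain v' where v': "linked \<omega> v v'" "(v', w) \<in> ?R ^^ k'"
          using k(1) relpow_Suc_D2[of v w k' ?R] by auto
        have "d v' \<le> d v + 1" using d_add(1)[OF v(1), of v' 1] v'(1) by auto
        moreover have "d w \<le> d v' + k'" using d_add(1)[OF reachN[OF v'(1)] v'(2)] .
        ultimately have "d v' = Suc (d v)" "d w = d v' + k'" using k(2) Suc by linarith+
        then have "v' \<in> ?N" "w \<in> D v'" using v' unfolding D_def by blast+
        then show ?thesis by blast
      qed
    qed
    moreover have "finite (D v')" if "v' \<in> ?N" for v' using no that reachN by blast
    ultimately have "finite (D v)" using finN by (meson finite_UN finite_insert finite_subset)
    then show False using v(2) by simp
  qed
  have reach0: "reach u0" unfolding reach_def by (intro exI[of _ 0]) simp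
  have d0: "d u0 = 0" using d_le[of u0 0] by simp
  have "{v. conn \<omega> UNIV u0 v} \<subseteq> D u0"
  proof
    fix v assume "v \<in> {v. conn \<omega> UNIV u0 v}"
    then have "(u0, v) \<in> ?R\<^sup>*" by (simp add: conn_def)
    then have "reach v" unfolding reach_def by (simp add: rtrancl_power)
    from d[OF this] show "v \<in> D u0" unfolding D_def using d0 by auto
  qed
  then have inf0: "infinite (D u0)" using inf finite_subset by blast
  have "\<exists>g. g 0 = u0 \<and> (\<forall>k. (reach (g k) \<and> infinite (D (g k))) \<and> linked \<omega> (g k) (g (Suc k)) \<and> d (g (Suc k)) = Suc (d (g k)))"
    using dependent_nat_choice[of "\<lambda>n v. (reach v \<and> infinite (D v)) \<and> (n = 0 \<longrightarrow> v = u0)"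
      "\<lambda>_ v v'. linked \<omega> v v' \<and> d v' = Suc (d v)"] step reach0 inf0 by (metis Zero_not_Suc)
  then obtain g where g: "g 0 = u0" "\<And>k. linked \<omega> (g k) (g (Suc k))" "\<And>k. d (g (Suc k)) = Suc (d (g k))"
    by blast
  have "d (g k) = k" for k by (induction k) (simp_all add: g d0)
  then have "inj g" by (metis injI)
  then show ?thesis using g by blast
qed

text \<open>The absolute value makes this a probability for every sequence \<open>d\<close>, including the
  null set on which some increment is negative.\<close>

definition lattice_probs :: "real \<Rightarrow> (nat \<Rightarrow> real) \<Rightarrow> bond \<Rightarrow> real" where
  "lattice_probs p d = (\<lambda>(i, n, b). if b then p powr \<bar>d i\<bar> else p)"

lemma lattice_probs_bounds: "0 \<le> p \<Longrightarrow> p \<le> 1 \<Longrightarrow> 0 \<le> lattice_probs p d e \<and> lattice_probs p d e \<le> 1"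
  unfolding lattice_probs_def by (auto simp: powr_le1 split: prod.splits)

lemma lattice_probs_mono:
  "0 \<le> p \<Longrightarrow> p \<le> p' \<Longrightarrow> lattice_probs p d e \<le> lattice_probs p' d e"
  unfolding lattice_probs_def by (auto simp: powr_mono2 split: prod.splits)

locale lattice =
  fixes x :: "nat \<Rightarrow> real" and p :: real
  assumes x0: "x 0 = 0" and mono: "strict_mono x" and p: "0 \<le> p" "p \<le> 1"
begin

definition place :: "site \<Rightarrow> vertex" where "place v = (x (fst v), real (snd v))"
definition edge :: "bond \<Rightarrow> vertex set" where "edge e = {place (bond_start e), place (bond_end e)}"

lemma place_inj: "place u = place v \<longleftrightarrow> u = v"
  using strict_mono_eq[OF mono] by (auto simp: place_def prod_eq_iff)

lemma edge_in: "edge e \<in> lattice_edges x"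
proof -
  obtain i n b where e: "e = (i, n, b)" by (cases e) auto
  show ?thesis
  proof (cases b)
    case True
    then have "edge e = {(x i, real n), (x (Suc i), real n)}" by (simp add: e edge_def place_def)
    moreover have "\<bar>int i - int (Suc i)\<bar> + \<bar>int n - int n\<bar> = 1" by simp
    ultimately show ?thesis unfolding lattice_edges_def by blast
  next
    case False
    then have "edge e = {(x i, real n), (x i, real (Suc n))}" by (simp add: e edge_def place_def)
    moreover have "\<bar>int i - int i\<bar> + \<bar>int n - int (Suc n)\<bar> = 1" by simp
    ultimately show ?thesis unfolding lattice_edges_def by blast
  qed
qed

lemma edge_surj:
  assumes "f \<in> lattice_edges x"
  shows "\<exists>e. f = edge e"
proof -
  obtain i j n m where f: "f = {(x i, real n), (x j, real m)}" and ij: "\<bar>int i - int j\<bar> + \<bar>int n - int m\<bar> = 1"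
    using assms unfolding lattice_edges_def by blast
  have "(n = m \<and> j = Suc i) \<or> (n = m \<and> i = Suc j) \<or> (i = j \<and> m = Suc n) \<or> (i = j \<and> n = Suc m)"
    using ij by linarith
  then have "f = edge (i, n, True) \<or> f = edge (j, n, True) \<or> f = edge (i, n, False) \<or> f = edge (i, m, False)"
    unfolding f edge_def place_def by (elim disjE conjE) auto
  then show ?thesis by blast
qed

lemma edge_inj: "inj edge"
proof (rule injI)
  fix e e' assume "edge e = edge e'"
  then have "bond_start e = bond_start e' \<and> bond_end e = bond_end e' \<or> bond_start e = bond_end e' \<and> bond_end e = bond_start e'"
    unfolding edge_def doubleton_eq_iff place_inj .
  then show "e = e'" by (cases e; cases e') (auto split: if_splits)
qed

lemma edge_prob: "p powr edge_length (edge e) = lattice_probs p (\<lambda>i. x (Suc i) - x i) e"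
  using p by (cases e) (auto simp: edge_def edge_length_doubleton place_def dist_Pair_Pair dist_real_def lattice_probs_def abs_minus_commute)

lemma linked_iff: "linked (\<lambda>e. \<omega> (edge e)) u v \<longleftrightarrow> {place u, place v} \<in> lattice_edges x \<and> \<omega> {place u, place v}"
proof
  assume "linked (\<lambda>e. \<omega> (edge e)) u v"
  then obtain e where e: "\<omega> (edge e)" "bond_start e = u \<and> bond_end e = v \<or> bond_start e = v \<and> bond_end e = u"
    unfolding linked_def by blast
  then have "edge e = {place u, place v}" unfolding edge_def by auto
  then show "{place u, place v} \<in> lattice_edges x \<and> \<omega> {place u, place v}" using edge_in[of e] e by simp
next
  assume a: "{place u, place v} \<in> lattice_edges x \<and> \<omega> {place u, place v}"
  then obtain e where e: "{place u, place v} = edge e" using edge_surj by blast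
  then have "bond_start e = u \<and> bond_end e = v \<or> bond_start e = v \<and> bond_end e = u"
    unfolding edge_def doubleton_eq_iff place_inj by auto
  moreover have "\<omega> (edge e)" using a e by simp
  ultimately show "linked (\<lambda>e. \<omega> (edge e)) u v" unfolding linked_def by blast
qed

lemma infinite_open_path_iff:
  "(\<exists>\<gamma>. infinite_open_path x \<omega> (0, 0) \<gamma>) \<longleftrightarrow> (\<lambda>e. \<omega> (edge e)) \<in> percolates"
proof
  assume "\<exists>\<gamma>. infinite_open_path x \<omega> (0, 0) \<gamma>"
  then obtain \<gamma> where \<gamma>: "\<gamma> 0 = (0, 0)" "range \<gamma> \<subseteq> lattice_vertices x" "inj \<gamma>"
    "\<And>k. {\<gamma> k, \<gamma> (Suc k)} \<in> lattice_edges x \<and> \<omega> {\<gamma> k, \<gamma> (Suc k)}"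
    unfolding infinite_open_path_def by blast
  have "\<exists>v. \<gamma> k = place v" for k
  proof -
    have "\<gamma> k \<in> range x \<times> \<nat>" using \<gamma>(2) unfolding lattice_vertices_def by blast
    then obtain i n where "\<gamma> k = (x i, real n)" by (auto elim!: Nats_cases)
    then show ?thesis by (intro exI[of _ "(i, n)"]) (simp add: place_def)
  qed
  then obtain g where g: "\<And>k. \<gamma> k = place (g k)" by metis
  have g0: "g 0 = (0, 0)" using \<gamma>(1) place_inj[of "g 0" "(0, 0)"] by (simp add: g place_def x0)
  have "conn (\<lambda>e. \<omega> (edge e)) UNIV (0, 0) (g k)" for k
  proof (induction k)
    case 0
    then show ?case by (simp add: g0 conn_refl)
  next
    case (Suc k)
    have "linked (\<lambda>e. \<omega> (edge e)) (g k) (g (Suc k))" using \<gamma>(4)[of k] unfolding linked_iff g .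
    then show ?case using Suc by (auto intro: conn_step)
  qed
  then have "range g \<subseteq> {v. conn (\<lambda>e. \<omega> (edge e)) UNIV (0, 0) v}" by blast
  moreover have "inj g" using \<gamma>(3) g by (metis injD injI)
  then have "infinite (range g)" using finite_imageD by blast
  ultimately show "(\<lambda>e. \<omega> (edge e)) \<in> percolates" unfolding percolates_def using finite_subset by blast
next
  assume "(\<lambda>e. \<omega> (edge e)) \<in> percolates"
  then have "infinite {v. conn (\<lambda>e. \<omega> (edge e)) UNIV (0, 0) v}" by (simp add: percolates_def)
  from infinite_cluster_path[OF this] obtain g where g: "g 0 = (0, 0)" "inj g"
    "\<And>k. linked (\<lambda>e. \<omega> (edge e)) (g k) (g (Suc k))" by blast
  have "infinite_open_path x \<omega> (0, 0) (\<lambda>k. place (g k))"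
    unfolding infinite_open_path_def
  proof (intro conjI allI)
    show "place (g 0) = (0, 0)" by (simp add: g place_def x0)
    show "range (\<lambda>k. place (g k)) \<subseteq> lattice_vertices x" by (auto simp: place_def lattice_vertices_def)
    show "inj (\<lambda>k. place (g k))" using g(2) by (auto simp: inj_def place_inj)
    show "{place (g k), place (g (Suc k))} \<in> lattice_edges x" "\<omega> {place (g k), place (g (Suc k))}" for k
      using g(3)[of k] unfolding linked_iff by auto
  qed
  then show "\<exists>\<gamma>. infinite_open_path x \<omega> (0, 0) \<gamma>" by blast
qed

lemma percolation_prob:
  "measure (percolation p x) (connected_to_infinity p x)
    = measure (bern (lattice_probs p (\<lambda>i. x (Suc i) - x i))) percolates"
proof -
  let ?M = "\<lambda>f. measure_pmf (bernoulli_pmf (p powr edge_length f))"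
  have prob: "prob_space (percolation p x)"
    unfolding percolation_def by (rule prob_space_PiM) (rule prob_space_measure_pmf)
  have ne: "lattice_edges x \<noteq> {}" using edge_in by blast
  have ind: "prob_space.indep_vars (percolation p x) (\<lambda>_. count_space UNIV) (\<lambda>e \<omega>. \<omega> (edge e)) UNIV"
  proof -
    have "prob_space.indep_vars (percolation p x) (\<lambda>e. ?M (edge e)) (\<lambda>e \<omega>. \<omega> (edge e)) UNIV"
      unfolding percolation_def
      by (rule PiM_reindexed_coordinates_indep_vars)
         (use ne edge_inj edge_in in \<open>auto intro: prob_space_measure_pmf\<close>)
    from prob_space.indep_vars_compose2[OF prob this, of "\<lambda>_ b. b" "\<lambda>_. count_space UNIV"]
    show ?thesis by simp
  qed
  have comp: "(\<lambda>\<omega>. \<omega> (edge e)) \<in> measurable (percolation p x) (?M (edge e))" for e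
    unfolding percolation_def by (rule measurable_component_singleton) (rule edge_in)
  have pr: "measure (percolation p x) {\<omega> \<in> space (percolation p x). \<omega> (edge e)} = lattice_probs p (\<lambda>i. x (Suc i) - x i) e" for e
  proof -
    have "measure (percolation p x) {\<omega> \<in> space (percolation p x). \<omega> (edge e)}
       = measure (percolation p x) ((\<lambda>\<omega>. \<omega> (edge e)) -` {True} \<inter> space (percolation p x))"
      by (rule arg_cong[where f = "measure (percolation p x)"]) auto
    also have "\<dots> = measure (distr (percolation p x) (?M (edge e)) (\<lambda>\<omega>. \<omega> (edge e))) {True}"
      by (rule measure_distr[OF comp, symmetric]) simp
    also have "distr (percolation p x) (?M (edge e)) (\<lambda>\<omega>. \<omega> (edge e)) = ?M (edge e)"
      unfolding percolation_def by (rule distr_PiM_component) (use edge_in in \<open>auto intro: prob_space_measure_pmf\<close>)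
    also have "measure (?M (edge e)) {True} = p powr edge_length (edge e)"
      using lattice_probs_bounds[OF p, of _ e] by (simp add: measure_pmf_single edge_prob)
    finally show ?thesis by (simp add: edge_prob)
  qed
  have D: "distr (percolation p x) configs (\<lambda>\<omega> e. \<omega> (edge e)) = bern (lattice_probs p (\<lambda>i. x (Suc i) - x i))"
    by (rule distr_bern[OF prob ind pr])
  have m: "(\<lambda>\<omega> e. \<omega> (edge e)) \<in> measurable (percolation p x) configs"
  proof (rule measurable_PiM_single')
    fix e
    show "(\<lambda>\<omega>. \<omega> (edge e)) \<in> measurable (percolation p x) (count_space UNIV)"
      using comp[of e] by (simp cong: measurable_cong_sets)
  qed auto
  have "connected_to_infinity p x = (\<lambda>\<omega> e. \<omega> (edge e)) -` percolates \<inter> space (percolation p x)"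
    unfolding connected_to_infinity_def infinite_open_path_iff by auto
  then show ?thesis using measure_distr[OF m percolates_measurable] unfolding D by simp
qed

end

section \<open>The zero-one law\<close>

definition theta :: "real \<Rightarrow> (nat \<Rightarrow> real) \<Rightarrow> real" where
  "theta p \<xi> = measure (bern (lattice_probs p (\<lambda>i. \<xi> (Suc i)))) percolates"

lemma theta_mono: "0 \<le> p \<Longrightarrow> p \<le> p' \<Longrightarrow> p' \<le> 1 \<Longrightarrow> theta p \<xi> \<le> theta p' \<xi>"
  unfolding theta_def
  by (rule percolation_prob_mono) (meson lattice_probs_bounds lattice_probs_mono order_trans)

lemma theta_measurable:
  assumes p: "0 \<le> p" "p \<le> 1" and m: "\<And>i. (\<lambda>x. f x (Suc i)) \<in> borel_measurable N"
  shows "(\<lambda>x. theta p (f x)) \<in> borel_measurable N"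
  unfolding theta_def
proof (rule bern_prob_measurable)
  fix e :: bond
  obtain i n b where e: "e = (i, n, b)" by (cases e) auto
  note m[of i, measurable]
  show "(\<lambda>x. lattice_probs p (\<lambda>i. f x (Suc i)) e) \<in> borel_measurable N"
    unfolding lattice_probs_def e by (cases b) simp_all
qed (use lattice_probs_bounds p in auto)

fun shift_bond :: "bond \<Rightarrow> bond" where "shift_bond (i, n, b) = (Suc i, n, b)"

text \<open>If the lattice without its first column percolates from \<open>(1, 0)\<close>, it suffices to
  open one more bond.\<close>

lemma theta_shift_pos:
  assumes p: "0 < p" "p \<le> 1" and pos: "0 < theta p (\<lambda>i. \<xi> (Suc i))"
  shows "0 < theta p \<xi>"
proof -
  let ?r = "lattice_probs p (\<lambda>i. \<xi> (Suc i))" and ?r' = "lattice_probs p (\<lambda>i. \<xi> (Suc (Suc i)))"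
  let ?s = "\<lambda>\<omega> e. \<omega> (shift_bond e)"
  have r: "0 \<le> ?r e \<and> ?r e \<le> 1" for e using lattice_probs_bounds p by simp
  have inj: "inj shift_bond"
  proof (rule injI)
    fix x y assume "shift_bond x = shift_bond y"
    then show "x = y" by (cases x; cases y) auto
  qed
  have sm: "?s \<in> measurable configs configs"
    by (rule measurable_PiM_single') auto
  have D: "distr (bern ?r) configs ?s = bern ?r'"
  proof (rule distr_bern[OF prob_space_bern])
    have "prob_space.indep_vars (bern ?r) (\<lambda>e. measure_pmf (bernoulli_pmf (?r (shift_bond e)))) (\<lambda>e \<omega>. \<omega> (shift_bond e)) UNIV"
      unfolding bern_def
      by (rule PiM_reindexed_coordinates_indep_vars) (auto intro: prob_space_measure_pmf inj)
    from prob_space.indep_vars_compose2[OF prob_space_bern this, of "\<lambda>_ b. b" "\<lambda>_. count_space UNIV"]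
    show "prob_space.indep_vars (bern ?r) (\<lambda>_. count_space UNIV) (\<lambda>e \<omega>. \<omega> (shift_bond e)) UNIV" by simp
    show "measure (bern ?r) {\<omega> \<in> space (bern ?r). \<omega> (shift_bond e)} = ?r' e" for e
    proof -
      have "?r (shift_bond e) = ?r' e" by (cases e) (simp add: lattice_probs_def)
      then show ?thesis using bern_bond_prob[of ?r "shift_bond e" True] r[of "shift_bond e"] by simp
    qed
  qed
  let ?A = "{\<omega> :: bond \<Rightarrow> bool. \<omega> (0, 0, True) = True}" and ?B = "?s -` percolates"
  have A: "?A \<in> sets configs" by (rule bond_event_measurable)
  have B: "?B \<in> sets configs" using measurable_sets[OF sm percolates_measurable] by simp
  have sm': "?s \<in> measurable (bern ?r) configs" using sm by (simp cong: measurable_cong_sets)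
  have PB: "measure (bern ?r) ?B = theta p (\<lambda>i. \<xi> (Suc i))"
    using measure_distr[OF sm' percolates_measurable] unfolding D theta_def by simp
  have PA: "0 < measure (bern ?r) ?A"
  proof -
    have "0 < ?r (0, 0, True)" using p by (simp add: lattice_probs_def)
    then show ?thesis using bern_bond_prob[of ?r "(0, 0, True)" True] r[of "(0, 0, True)"] by simp
  qed
  have "determined_by {(0, 0, True)} ?A" unfolding determined_by_def by simp
  moreover have "determined_by (range shift_bond) ?B"
    unfolding determined_by_def
  proof (intro allI impI)
    fix \<omega> \<omega>' :: "bond \<Rightarrow> bool"
    assume eq: "\<forall>e\<in>range shift_bond. \<omega> e = \<omega>' e" and \<omega>: "\<omega> \<in> ?B"
    have "?s \<omega> = ?s \<omega>'" by (rule ext) (rule bspec[OF eq rangeI])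
    then show "\<omega>' \<in> ?B" using \<omega> by (simp only: vimage_eq)
  qed
  moreover have "{(0, 0, True)} \<inter> range shift_bond = {}" by auto
  ultimately have "measure (bern ?r) (?A \<inter> ?B) = measure (bern ?r) ?A * measure (bern ?r) ?B"
    by (intro bern_prob_Int A B)
  moreover have "?A \<inter> ?B \<subseteq> percolates"
  proof
    fix \<omega> assume \<omega>: "\<omega> \<in> ?A \<inter> ?B"
    have moved: "linked \<omega> (Suc (fst u), snd u) (Suc (fst v), snd v)" if lk: "linked (?s \<omega>) u v" for u v
    proof -
      obtain e where "\<omega> (shift_bond e)" "bond_start e = u \<and> bond_end e = v \<or> bond_start e = v \<and> bond_end e = u"
        using lk unfolding linked_def by blast
      then show ?thesis
        unfolding linked_def by (intro exI[of _ "shift_bond e"]) (cases e, auto)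
    qed
    have "linked \<omega> (0, 0) (1, 0)"
      using \<omega> unfolding linked_def by (intro exI[of _ "(0, 0, True)"]) simp
    then have start: "conn \<omega> UNIV (0, 0) (1, 0)" by (auto intro: conn_step conn_refl)
    have c: "conn \<omega> UNIV (0, 0) (Suc (fst v), snd v)" if "conn (?s \<omega>) UNIV (0, 0) v" for v
      using that
    proof (induction rule: conn_induct)
      case refl
      then show ?case using start by simp
    next
      case (step v x)
      then show ?case using moved[OF step(2)] by (auto intro: conn_step)
    qed
    have "inj (\<lambda>v :: site. (Suc (fst v), snd v))" by (auto simp: inj_def)
    moreover have "infinite {v. conn (?s \<omega>) UNIV (0, 0) v}" using \<omega> by (simp add: percolates_def)
    ultimately have "infinite ((\<lambda>v. (Suc (fst v), snd v)) ` {v. conn (?s \<omega>) UNIV (0, 0) v})"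
      by (metis finite_imageD inj_on_subset subset_UNIV)
    moreover have "(\<lambda>v. (Suc (fst v), snd v)) ` {v. conn (?s \<omega>) UNIV (0, 0) v} \<subseteq> {v. conn \<omega> UNIV (0, 0) v}"
      using c by blast
    ultimately show "\<omega> \<in> percolates" unfolding percolates_def using finite_subset by blast
  qed
  then have "measure (bern ?r) (?A \<inter> ?B) \<le> theta p \<xi>"
    unfolding theta_def by (intro bern.finite_measure_mono) auto
  moreover have "0 < measure (bern ?r) ?A * measure (bern ?r) ?B"
    using PA PB pos by simp
  ultimately show ?thesis by linarith
qed

context increment_law
begin

lemma AE_coordinates:
  assumes "AE z in \<nu>. P z"
  shows "AE \<xi> in E. \<forall>i. P (\<xi> (Suc i))"
  unfolding AE_all_countable E_def
  by (intro allI AE_PiM_component assms) (auto intro: prob_\<nu>)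

text \<open>\<open>B k\<close> is the event that percolation from \<open>(k, 0)\<close> to the right of
  column \<open>k\<close> has positive probability. These events decrease and have the same probability, so
  their intersection, a tail event, has the probability of \<open>B 0\<close>; Kolmogorov's law applies to
  it.\<close>

theorem theta_zero_one:
  assumes p: "0 < p" "p \<le> 1"
  shows "(AE \<xi> in E. theta p \<xi> = 0) \<or> (AE \<xi> in E. 0 < theta p \<xi>)"
proof -
  let ?sh = "\<lambda>k \<xi> i. \<xi> (i + k)"
  define B where "B k = {\<xi> \<in> space E. 0 < theta p (?sh k \<xi>)}" for k
  define A where "A i = sigma_sets (space E) {(\<lambda>\<xi>. \<xi> (Suc i)) -` S \<inter> space E | S. S \<in> sets \<nu>}" for i
  have A_sub: "A i \<subseteq> Pow (space E)" for i
  proof -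
    have "{(\<lambda>\<xi>. \<xi> (Suc i)) -` S \<inter> space E | S. S \<in> sets \<nu>} \<subseteq> Pow (space E)" by auto
    from sigma_sets_into_sp[OF this] show ?thesis unfolding A_def by blast
  qed
  have indep: "E.indep_sets A UNIV"
  proof -
    have "E.indep_vars (\<lambda>_. \<nu>) (\<lambda>i \<xi>. \<xi> (Suc i)) UNIV"
      unfolding E_def by (rule PiM_reindexed_coordinates_indep_vars) (auto intro: prob_\<nu>)
    then show ?thesis unfolding E.indep_vars_def A_def by simp
  qed
  have B_tail: "B n \<in> sigma_sets (space E) (\<Union>(A ` {n..}))" for n
  proof -
    \<comment> \<open>percolation to the right of column \<open>n\<close> is measurable already with respect to the later increments\<close>
    let ?N = "sigma (space E) (\<Union>(A ` {n..}))"
    have sub: "\<Union>(A ` {n..}) \<subseteq> Pow (space E)" using A_sub by blast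
    have "(\<lambda>\<xi>. ?sh n \<xi> (Suc i)) \<in> borel_measurable ?N" for i
    proof (rule measurableI)
      fix S :: "real set" assume "S \<in> sets borel"
      then have "(\<lambda>\<xi>. \<xi> (Suc (i + n))) -` S \<inter> space E \<in> A (i + n)"
        unfolding A_def sets_\<nu>[symmetric] by (intro sigma_sets.Basic) blast
      then have "(\<lambda>\<xi>. \<xi> (Suc (i + n))) -` S \<inter> space E \<in> \<Union>(A ` {n..})" by auto
      then show "(\<lambda>\<xi>. ?sh n \<xi> (Suc i)) -` S \<inter> space ?N \<in> sets ?N"
        using sub by (simp add: space_measure_of sets_measure_of sigma_sets.Basic)
    qed simp
    from theta_measurable[of p "?sh n" ?N, OF less_imp_le[OF p(1)] p(2) this]
    have "(\<lambda>\<xi>. theta p (?sh n \<xi>)) \<in> borel_measurable ?N" .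
    then have "{\<xi> \<in> space ?N. 0 < theta p (?sh n \<xi>)} \<in> sets ?N" by measurable
    then show ?thesis using sub by (simp add: B_def space_measure_of sets_measure_of)
  qed
  have B_dec: "B (Suc k) \<subseteq> B k" for k
    unfolding B_def using theta_shift_pos[OF p, of "?sh k _"] by auto
  have B_sets: "B k \<in> sets E" for k
  proof -
    have "(\<lambda>\<xi>. theta p (?sh k \<xi>)) \<in> borel_measurable E"
      using theta_measurable[of p "?sh k", OF less_imp_le[OF p(1)] p(2)] coordinate_measurable[of "_ + k"] by simp
    then show ?thesis unfolding B_def by measurable
  qed
  have B_prob: "E.prob (B k) = E.prob (B 0)" for k
  proof -
    let ?t = "\<lambda>\<xi>. \<lambda>i\<in>{1..}. \<xi> (i + k)"
    have D: "distr E E ?t = E"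
      unfolding E_def using distr_PiM_reindex[of "{1..}" "\<lambda>_. \<nu>" "\<lambda>i. i + k" "{1..}"] prob_\<nu>
      by (auto simp: inj_on_def)
    have tm: "?t \<in> measurable E E"
      unfolding E_def by (intro measurable_restrict measurable_component_singleton) auto
    have "E.prob (B 0) = measure (distr E E ?t) (B 0)" by (simp only: D)
    also have "\<dots> = E.prob (?t -` B 0 \<inter> space E)" by (rule measure_distr[OF tm B_sets])
    also have "?t -` B 0 \<inter> space E = B k"
      using measurable_space[OF tm] by (auto simp: B_def theta_def)
    finally show ?thesis by simp
  qed
  have dec: "decseq B" using B_dec by (rule decseq_SucI)
  have "(\<Inter>k. B k) \<in> E.tail_events A"
    unfolding E.tail_events_def
  proof
    fix n
    interpret S: sigma_algebra "space E" "sigma_sets (space E) (\<Union>(A ` {n..}))"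
      using A_sub by (intro sigma_algebra_sigma_sets) blast
    have "(\<Inter>k. B k) = (\<Inter>k. B (k + n))"
    proof
      show "(\<Inter>k. B (k + n)) \<subseteq> (\<Inter>k. B k)"
        using decseqD[OF dec le_add1] by blast
    qed auto
    also have "\<dots> \<in> sigma_sets (space E) (\<Union>(A ` {n..}))"
    proof -
      have "B (k + n) \<in> sigma_sets (space E) (\<Union>(A ` {n..}))" for k
      proof -
        have "sigma_sets (space E) (\<Union>(A ` {k + n..})) \<subseteq> sigma_sets (space E) (\<Union>(A ` {n..}))"
          by (intro sigma_sets_subseteq UN_mono) auto
        then show ?thesis using B_tail by blast
      qed
      then have "range (\<lambda>k. B (k + n)) \<subseteq> sigma_sets (space E) (\<Union>(A ` {n..}))" by blast
      from S.countable_INT[OF this] show ?thesis by simp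
    qed
    finally show "(\<Inter>k. B k) \<in> sigma_sets (space E) (\<Union>(A ` {n..}))" .
  qed
  then have "E.prob (\<Inter>k. B k) = 0 \<or> E.prob (\<Inter>k. B k) = 1"
  proof (rule E.kolmogorov_0_1_law[rotated 2])
    show "sigma_algebra (space E) (A i)" for i
      unfolding A_def by (rule sigma_algebra_sigma_sets) auto
  qed (rule indep)
  note zero_one = this
  have "(\<lambda>k. E.prob (B k)) \<longlonglongrightarrow> E.prob (\<Inter>k. B k)"
    using B_sets by (intro E.finite_Lim_measure_decseq dec) auto
  moreover have "(\<lambda>k. E.prob (B k)) = (\<lambda>k. E.prob (B 0))" by (rule ext) (rule B_prob)
  ultimately have "E.prob (\<Inter>k. B k) = E.prob (B 0)" by (metis LIMSEQ_const_iff)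
  with zero_one consider "E.prob (B 0) = 0" | "E.prob (B 0) = 1" by metis
  then show ?thesis
  proof cases
    case 1
    then have "AE \<xi> in E. \<xi> \<notin> B 0" using B_sets[of 0] by (simp add: E.prob_eq_0)
    then have "AE \<xi> in E. theta p \<xi> = 0"
    proof (rule AE_mp, intro AE_I2 impI)
      fix \<xi> assume "\<xi> \<in> space E" "\<xi> \<notin> B 0"
      then have "\<not> 0 < theta p \<xi>" by (simp add: B_def)
      moreover have "0 \<le> theta p \<xi>" by (simp add: theta_def)
      ultimately show "theta p \<xi> = 0" by linarith
    qed
    then show ?thesis ..
  next
    case 2
    then have "AE \<xi> in E. \<xi> \<in> B 0" using B_sets[of 0] by (simp add: E.prob_eq_1)
    then have "AE \<xi> in E. 0 < theta p \<xi>" by (auto simp: B_def)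
    then show ?thesis ..
  qed
qed

lemma environment_law_eq: "environment_law \<nu> = distr E (Pi\<^sub>M UNIV (\<lambda>_. borel)) partial_sums"
  unfolding environment_law_def E_def ..

lemma partial_sums_measurable_E: "partial_sums \<in> measurable E (Pi\<^sub>M UNIV (\<lambda>_. borel))"
  unfolding E_def by (rule partial_sums_measurable) (rule sets_\<nu>)

lemma percolation_partial_sums:
  assumes "0 \<le> p" "p \<le> 1" "\<forall>i. x i < x (Suc i)" "x 0 = 0"
  shows "measure (percolation p x) (connected_to_infinity p x) = theta p (\<lambda>i. x i - x (i - 1))"
proof -
  interpret lattice x p
    by unfold_locales (use assms in \<open>auto simp: strict_mono_Suc_iff\<close>)
  show ?thesis using percolation_prob by (simp add: theta_def)
qed

lemma theta_increments: "theta p (\<lambda>i. partial_sums \<xi> i - partial_sums \<xi> (i - 1)) = theta p \<xi>"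
  by (simp add: theta_def)

text \<open>The predicate on environments is replaced by a measurable one: on increasing sequences that start
  at 0 the two agree, and almost every environment is such a sequence.\<close>

lemma AE_environment:
  assumes p: "0 \<le> p" "p \<le> 1" and pos: "AE z in \<nu>. 0 < z"
    and P: "Measurable.pred borel P" and AE: "AE \<xi> in E. P (theta p \<xi>)"
  shows "AE x in environment_law \<nu>. P (measure (percolation p x) (connected_to_infinity p x))"
proof -
  let ?Q = "\<lambda>x. (\<forall>i. x i < x (Suc i)) \<and> x 0 = 0 \<and> P (theta p (\<lambda>i. x i - x (i - 1)))"
  let ?N = "Pi\<^sub>M UNIV (\<lambda>_. borel) :: (nat \<Rightarrow> real) measure"
  have th: "(\<lambda>x. theta p (\<lambda>i. x i - x (i - 1))) \<in> borel_measurable ?N"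
    by (rule theta_measurable[OF p]) measurable
  have Q: "{x \<in> space ?N. ?Q x} \<in> sets ?N"
  proof -
    note [measurable] = measurable_compose[OF th P]
    show ?thesis by measurable
  qed
  have "AE \<xi> in E. ?Q (partial_sums \<xi>)"
    using AE AE_coordinates[OF pos]
  proof eventually_elim
    case (elim \<xi>)
    then show ?case unfolding theta_increments by simp
  qed
  then have "AE x in environment_law \<nu>. ?Q x"
    unfolding environment_law_eq by (subst AE_distr_iff[OF partial_sums_measurable_E Q])
  then show ?thesis
    by (rule AE_mp, intro AE_I2 impI) (simp add: percolation_partial_sums[OF p])
qed

lemma AE_environment_zero_iff:
  assumes p: "0 \<le> p" "p \<le> 1" and pos: "AE z in \<nu>. 0 < z"
  shows "(AE x in environment_law \<nu>. measure (percolation p x) (connected_to_infinity p x) = 0)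
    \<longleftrightarrow> (AE \<xi> in E. theta p \<xi> = 0)"
proof
  assume "AE x in environment_law \<nu>. measure (percolation p x) (connected_to_infinity p x) = 0"
  then have 1: "AE \<xi> in E. measure (percolation p (partial_sums \<xi>)) (connected_to_infinity p (partial_sums \<xi>)) = 0"
    unfolding environment_law_eq by (rule AE_distrD[OF partial_sums_measurable_E])
  show "AE \<xi> in E. theta p \<xi> = 0"
    using 1 AE_coordinates[OF pos]
  proof eventually_elim
    case (elim \<xi>)
    have "measure (percolation p (partial_sums \<xi>)) (connected_to_infinity p (partial_sums \<xi>))
      = theta p (\<lambda>i. partial_sums \<xi> i - partial_sums \<xi> (i - 1))"
      by (rule percolation_partial_sums[OF p]) (use elim in auto)
    then show ?case using elim by (simp only: theta_increments)
  qed
next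
  assume "AE \<xi> in E. theta p \<xi> = 0"
  then show "AE x in environment_law \<nu>. measure (percolation p x) (connected_to_infinity p x) = 0"
    by (rule AE_environment[OF p pos, of "\<lambda>t. t = 0", rotated]) measurable
qed

end

section \<open>The critical point\<close>

context random_columns
begin

lemma AE_theta_zero:
  assumes eq: "\<And>\<xi>. column_probs (cw \<xi>) (cX \<xi>) = lattice_probs p (\<lambda>i. \<xi> (Suc i))"
  shows "AE \<xi> in E. theta p \<xi> = 0"
  using AE_escape_prob
proof eventually_elim
  case (elim \<xi>)
  then obtain m0 where m0: "\<And>m. m0 \<le> m \<Longrightarrow> measure (bern (column_probs (cw \<xi>) (cX \<xi>))) (escape n0 m) \<le> (1 / 2) ^ (n0 + m)"
    by blast
  have "theta p \<xi> \<le> (1 / 2) ^ m" if "m0 \<le> m" for m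
  proof -
    have "theta p \<xi> \<le> measure (bern (column_probs (cw \<xi>) (cX \<xi>))) (escape n0 m)"
      unfolding theta_def eq by (intro bern.finite_measure_mono percolates_subset_escape) simp
    also have "\<dots> \<le> (1 / 2) ^ (n0 + m)" by (rule m0[OF that])
    also have "\<dots> \<le> (1 / 2) ^ m" by (intro power_decreasing) auto
    finally show ?thesis .
  qed
  moreover have "(\<lambda>m. (1 / 2 :: real) ^ m) \<longlonglongrightarrow> 0" by (intro LIMSEQ_power_zero) simp
  ultimately have "theta p \<xi> \<le> 0" by (intro LIMSEQ_le_const) auto
  moreover have "0 \<le> theta p \<xi>" by (simp add: theta_def)
  ultimately show "theta p \<xi> = 0" by linarith
qed

lemma AE_theta_pos:
  assumes eq: "\<And>\<xi>. column_probs (cw \<xi>) (cX \<xi>) = (\<lambda>e. 1 - lattice_probs p (\<lambda>i. \<xi> (Suc i)) (dual_bond e))"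
    and p: "0 < p" "p \<le> 1"
  shows "AE \<xi> in E. 0 < theta p \<xi>"
  using AE_escape_prob
proof eventually_elim
  case (elim \<xi>)
  then obtain m0 where m0: "\<And>m. m0 \<le> m \<Longrightarrow> measure (bern (column_probs (cw \<xi>) (cX \<xi>))) (escape n0 m) \<le> (1 / 2) ^ (n0 + m)"
    by blast
  show ?case unfolding theta_def
  proof (rule percolates_pos_if_dual_escape_summable)
    show "measure (bern (\<lambda>e. 1 - lattice_probs p (\<lambda>i. \<xi> (Suc i)) (dual_bond e))) (escape n0 m) \<le> (1 / 2) ^ (n0 + m)"
      if "m0 \<le> m" for m using m0[OF that] unfolding eq .
    show "0 < lattice_probs p (\<lambda>i. \<xi> (Suc i)) (0, m, False)" for m using p by (simp add: lattice_probs_def)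
  qed (use lattice_probs_bounds p n0 in auto)
qed

end

locale heavy_increments = increment_law \<nu> for \<nu> :: "real measure" +
  fixes c :: real
  assumes pos: "AE z in \<nu>. 0 < z" and c: "8 * sqrt (ln 96) < c"
    and moment: "integrable \<nu> (\<lambda>z. z * exp (c * sqrt (ln z)) * indicator {z. 1 \<le> z} z)"
begin

lemma law_measurable: "f \<in> borel_measurable borel \<Longrightarrow> f \<in> borel_measurable \<nu>" for f :: "real \<Rightarrow> real"
  using measurable_cong_sets[OF sets_\<nu> refl] by blast

definition C :: real where "C = (\<integral>z. z * exp (c * sqrt (ln z)) * indicator {z. 1 \<le> z} z \<partial>\<nu>)"

lemma c_pos: "0 < c"
proof -
  have "0 \<le> 8 * sqrt (ln 96)" by simp
  then show ?thesis using c by linarith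
qed

lemma C_nonneg: "0 \<le> C"
  unfolding C_def by (intro integral_nonneg_AE AE_I2) (auto simp: indicator_def)

lemma abs_integrable: "integrable \<nu> (\<lambda>z. \<bar>z\<bar>)"
proof (rule Bochner_Integration.integrable_bound)
  interpret prob_space \<nu> by (rule prob_\<nu>)
  show "integrable \<nu> (\<lambda>z. 1 + z * exp (c * sqrt (ln z)) * indicator {z. 1 \<le> z} z)"
    using moment by simp
  show "AE z in \<nu>. norm \<bar>z\<bar> \<le> norm (1 + z * exp (c * sqrt (ln z)) * indicator {z. 1 \<le> z} z)"
    using pos
  proof eventually_elim
    case (elim z)
    show ?case
    proof (cases "1 \<le> z")
      case True
      have "z * 1 \<le> z * exp (c * sqrt (ln z))" using c_pos True by (intro mult_left_mono) auto
      then have "z \<le> 1 + z * exp (c * sqrt (ln z))" by linarith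
      then show ?thesis using True by simp
    qed (use elim in simp)
  qed
qed (rule law_measurable, measurable)

text \<open>Beyond the level \<open>2 ^ n\<^sup>2\<close> the weight
  \<open>exp (c * sqrt (ln z))\<close> is at least \<open>2 ^ (18 * n)\<close>; this is where the
  size of \<open>c\<close> is used, as \<open>c * sqrt (ln 2) \<ge> 18 * ln 2\<close>.\<close>

lemma tail_bound:
  assumes \<kappa>: "0 \<le> \<kappa>" "\<kappa> \<le> 1"
  shows "(\<integral>z. \<kappa> * \<bar>z\<bar> * indicator {z. 2 ^ n\<^sup>2 < \<kappa> * \<bar>z\<bar>} z \<partial>\<nu>) \<le> C / (2 ^ n) ^ 18"
proof -
  \<comment> \<open>the constant in the hypothesis enters as \<open>8 * sqrt (ln 96) \<ge> 8 * sqrt 6 * sqrt (ln 2) \<ge> 18 * sqrt (ln 2)\<close>\<close>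
  have growth: "(2 ^ n) ^ 18 \<le> exp (c * sqrt (ln z))" if z: "2 ^ n\<^sup>2 \<le> z" for z :: real
  proof -
    have l2: "0 < ln (2::real)" "ln (2::real) \<le> 1" using ln_le_minus_one[of "2::real"] by auto
    have "18 * ln 2 \<le> c * sqrt (ln 2)"
    proof -
      have "6 * ln 2 \<le> ln (96::real)"
      proof -
        have "6 * ln (2::real) = ln (2 ^ 6)" by (subst ln_realpow) auto
        also have "\<dots> \<le> ln 96" by (subst ln_le_cancel_iff) auto
        finally show ?thesis .
      qed
      then have "sqrt (6 * ln 2) \<le> sqrt (ln 96)" by simp
      then have "8 * (sqrt 6 * sqrt (ln 2)) \<le> c" using c by (simp add: real_sqrt_mult)
      moreover have "9 / 4 \<le> sqrt 6" by (rule real_le_rsqrt) (simp add: power2_eq_square)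
      then have "18 * sqrt (ln 2) \<le> 8 * (sqrt 6 * sqrt (ln 2))"
        using l2 mult_right_mono[of "9 / 4" "sqrt 6" "sqrt (ln 2)"] by simp
      ultimately have "18 * sqrt (ln 2) \<le> c" by linarith
      then have "18 * sqrt (ln 2) * sqrt (ln 2) \<le> c * sqrt (ln 2)" using l2 by (intro mult_right_mono) auto
      then show ?thesis using l2 by (simp add: mult.assoc)
    qed
    then have "real n * (18 * ln 2) \<le> real n * (c * sqrt (ln 2))" by (intro mult_left_mono) auto
    also have "\<dots> = c * sqrt (ln (2 ^ n\<^sup>2))"
      by (simp add: ln_realpow real_sqrt_mult)
    also have "\<dots> \<le> c * sqrt (ln z)"
    proof -
      have "(0::real) < 2 ^ n\<^sup>2" by simp
      moreover from this have "0 < z" using z by linarith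
      ultimately have "ln (2 ^ n\<^sup>2) \<le> ln z" using z by (subst ln_le_cancel_iff) auto
      then show ?thesis using c_pos by (intro mult_left_mono) auto
    qed
    finally have "exp (real n * (18 * ln 2)) \<le> exp (c * sqrt (ln z))" by simp
    moreover have "exp (real n * (18 * ln 2)) = (2 ^ n) ^ 18"
    proof -
      have "exp (real n * (18 * ln 2)) = exp (real (n * 18) * ln 2)" by simp
      also have "\<dots> = exp (ln 2) ^ (n * 18)" by (rule exp_of_nat_mult)
      finally show ?thesis by (simp add: power_mult)
    qed
    ultimately show ?thesis by simp
  qed
  have "(\<integral>z. \<kappa> * \<bar>z\<bar> * indicator {z. 2 ^ n\<^sup>2 < \<kappa> * \<bar>z\<bar>} z \<partial>\<nu>)
    \<le> (\<integral>z. (z * exp (c * sqrt (ln z)) * indicator {z. 1 \<le> z} z) / (2 ^ n) ^ 18 \<partial>\<nu>)"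
  proof (rule integral_mono_AE)
    show "integrable \<nu> (\<lambda>z. \<kappa> * \<bar>z\<bar> * indicator {z. 2 ^ n\<^sup>2 < \<kappa> * \<bar>z\<bar>} z)"
    proof (rule Bochner_Integration.integrable_bound[OF abs_integrable])
      show "(\<lambda>z. \<kappa> * \<bar>z\<bar> * indicator {z. 2 ^ n\<^sup>2 < \<kappa> * \<bar>z\<bar>} z) \<in> borel_measurable \<nu>"
        by (rule law_measurable) measurable
      show "AE z in \<nu>. norm (\<kappa> * \<bar>z\<bar> * indicator {z. 2 ^ n\<^sup>2 < \<kappa> * \<bar>z\<bar>} z) \<le> norm \<bar>z\<bar>"
        using \<kappa> by (intro AE_I2) (auto simp: indicator_def abs_mult mult_left_le_one_le)
    qed
    show "integrable \<nu> (\<lambda>z. (z * exp (c * sqrt (ln z)) * indicator {z. 1 \<le> z} z) / (2 ^ n) ^ 18)"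
      using moment by simp
    show "AE z in \<nu>. \<kappa> * \<bar>z\<bar> * indicator {z. 2 ^ n\<^sup>2 < \<kappa> * \<bar>z\<bar>} z
       \<le> (z * exp (c * sqrt (ln z)) * indicator {z. 1 \<le> z} z) / (2 ^ n) ^ 18"
      using pos
    proof eventually_elim
      case (elim z)
      show ?case
      proof (cases "2 ^ n\<^sup>2 < \<kappa> * \<bar>z\<bar>")
        case True
        have "\<kappa> * \<bar>z\<bar> \<le> z" using \<kappa> elim by (simp add: mult_left_le_one_le)
        then have z: "2 ^ n\<^sup>2 \<le> z" using True by linarith
        have "(1::real) \<le> 2 ^ n\<^sup>2" by simp
        then have z1: "1 \<le> z" using z by linarith
        have "\<kappa> * \<bar>z\<bar> * (2 ^ n) ^ 18 \<le> z * exp (c * sqrt (ln z))"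
          using growth[OF z] \<open>\<kappa> * \<bar>z\<bar> \<le> z\<close> \<kappa> elim by (intro mult_mono) auto
        then show ?thesis using True z1 by (simp add: field_simps)
      next
        case False
        then show ?thesis using elim by (auto simp: indicator_def)
      qed
    qed
  qed
  then show ?thesis by (simp add: C_def)
qed

lemma scale_exists: "\<exists>n0\<ge>18. 60 * C * 2 ^ 17 \<le> (2 ^ n0)\<^sup>2"
proof -
  obtain n where n: "60 * C * 2 ^ 17 < 2 ^ n" using real_arch_pow[of 2] by auto
  have "(2::real) ^ n \<le> 2 ^ (n + 18)" by (intro power_increasing) auto
  also have "\<dots> \<le> (2 ^ (n + 18))\<^sup>2" by (intro self_le_power) auto
  finally show ?thesis using n by (intro exI[of _ "n + 18"]) auto
qed

text \<open>With \<open>p = exp (- \<kappa>)\<close> the dual bonds form a column model with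
  \<open>w = 1 - p\<close> and \<open>X = \<kappa> * \<bar>z\<bar>\<close>. All hypotheses hold for
  small \<open>\<kappa>\<close>, as the scale \<open>n0\<close> and hence \<open>\<epsilon>\<close> depend on
  the moment constant \<open>C\<close> only.\<close>

lemma supercritical_exists: "\<exists>p. 0 < p \<and> p < 1 \<and> (AE \<xi> in E. 0 < theta p \<xi>)"
proof -
  obtain n0 where n0: "18 \<le> n0" "60 * C * 2 ^ 17 \<le> (2 ^ n0)\<^sup>2" using scale_exists by blast
  define \<epsilon> where "\<epsilon> = rate n0 / (6 * width n0)"
  define A where "A = (\<integral>z. \<bar>z\<bar> \<partial>\<nu>)"
  define Q where "Q = 2 * real (width n0) * (2 ^ n0) ^ 12"
  define \<kappa> where "\<kappa> = min (min 1 \<epsilon>) (min (1 / (24 * (A + 1))) (\<epsilon> / (Q * (A + 1))))"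
  define p where "p = exp (- \<kappa>)"
  have A: "0 \<le> A" unfolding A_def by (intro integral_nonneg_AE) auto
  have \<epsilon>: "0 < \<epsilon>" by (simp add: \<epsilon>_def rate_def)
  have Q: "0 < Q" by (simp add: Q_def)
  have \<kappa>: "0 < \<kappa>" "\<kappa> \<le> 1" "\<kappa> \<le> \<epsilon>" "\<kappa> \<le> 1 / (24 * (A + 1))" "\<kappa> \<le> \<epsilon> / (Q * (A + 1))"
    using A \<epsilon> Q by (auto simp: \<kappa>_def)
  have p: "0 < p" "p < 1" using \<kappa> by (auto simp: p_def)
  interpret RC: random_columns \<nu> "\<lambda>_. 1 - p" "\<lambda>z. \<kappa> * \<bar>z\<bar>" n0 \<epsilon> C
  proof
    show "integrable \<nu> (\<lambda>z. \<kappa> * \<bar>z\<bar>)" using abs_integrable by simp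
    have "\<kappa> * A \<le> 1 / (24 * (A + 1)) * (A + 1)" using \<kappa> A by (intro mult_mono) auto
    also have "\<dots> = 1 / 24" using A by simp
    finally show "(\<integral>z. \<kappa> * \<bar>z\<bar> \<partial>\<nu>) \<le> 1 / 24" by (simp add: A_def)
    show "(\<integral>z. \<kappa> * \<bar>z\<bar> * indicator {z. 2 ^ n\<^sup>2 < \<kappa> * \<bar>z\<bar>} z \<partial>\<nu>) \<le> C / (2 ^ n) ^ 18" for n
      using \<kappa> by (intro tail_bound) auto
    show "6 * width n0 * \<epsilon> \<le> rate n0" by (simp add: \<epsilon>_def)
    show "2 * width n0 * measure \<nu> {z \<in> space \<nu>. \<epsilon> < 1 - p \<or> \<epsilon> < \<kappa> * \<bar>z\<bar>} \<le> 1 / (2 ^ n0) ^ 12"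
    proof -
      interpret prob_space \<nu> by (rule prob_\<nu>)
      have "1 - p \<le> \<epsilon>" unfolding p_def using exp_ge_add_one_self[of "- \<kappa>"] \<kappa> by linarith
      then have "measure \<nu> {z \<in> space \<nu>. \<epsilon> < 1 - p \<or> \<epsilon> < \<kappa> * \<bar>z\<bar>} \<le> measure \<nu> {z \<in> space \<nu>. \<epsilon> \<le> \<kappa> * \<bar>z\<bar>}"
        by (intro finite_measure_mono) (auto simp: sets_\<nu> space_\<nu>)
      also have "\<dots> \<le> (\<integral>z. \<kappa> * \<bar>z\<bar> \<partial>\<nu>) / \<epsilon>"
        using \<epsilon> \<kappa> abs_integrable by (intro integral_Markov_inequality_measure[where A = "{}"]) auto
      also have "\<dots> = \<kappa> * A / \<epsilon>" by (simp add: A_def)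
      also have "\<dots> \<le> \<epsilon> / (Q * (A + 1)) * (A + 1) / \<epsilon>"
        using \<kappa> A \<epsilon> Q by (intro divide_right_mono mult_mono) auto
      also have "\<dots> = 1 / Q"
      proof -
        have "A + 1 \<noteq> 0" "\<epsilon> \<noteq> 0" "Q \<noteq> 0" using A \<epsilon> Q by auto
        then show ?thesis by simp
      qed
      finally have "2 * real (width n0) * measure \<nu> {z \<in> space \<nu>. \<epsilon> < 1 - p \<or> \<epsilon> < \<kappa> * \<bar>z\<bar>}
         \<le> 2 * real (width n0) * (1 / Q)" by (intro mult_left_mono) auto
      also have "\<dots> = 1 / (2 ^ n0) ^ 12" by (simp add: Q_def)
      finally show ?thesis by simp
    qed
  qed (use n0 p \<kappa> \<epsilon> C_nonneg in auto)
  have "column_probs (RC.cw \<xi>) (RC.cX \<xi>) = (\<lambda>e. 1 - lattice_probs p (\<lambda>i. \<xi> (Suc i)) (dual_bond e))" for \<xi>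
  proof
    fix e
    have "ln p = - \<kappa>" by (simp add: p_def)
    then show "column_probs (RC.cw \<xi>) (RC.cX \<xi>) e = 1 - lattice_probs p (\<lambda>i. \<xi> (Suc i)) (dual_bond e)"
      using p by (cases e) (simp add: column_probs_def RC.cw_def RC.cX_def lattice_probs_def powr_def mult.commute)
  qed
  from RC.AE_theta_pos[OF this] p have "AE \<xi> in E. 0 < theta p \<xi>" by simp
  then show ?thesis using p by blast
qed

text \<open>Increments below some \<open>t > 0\<close> are rare because the law has no mass at 0, and all
  others give horizontal bonds probability at most \<open>p powr t\<close>, which is small with
  \<open>p\<close>.\<close>

lemma subcritical_exists: "\<exists>p. 0 < p \<and> p \<le> 1 \<and> (AE \<xi> in E. theta p \<xi> = 0)"
proof -
  interpret prob_space \<nu> by (rule prob_\<nu>)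
  obtain n0 where n0: "18 \<le> n0" "60 * C * 2 ^ 17 \<le> (2 ^ n0)\<^sup>2" using scale_exists by blast
  define \<epsilon> where "\<epsilon> = rate n0 / (6 * width n0)"
  define Q where "Q = 2 * real (width n0) * (2 ^ n0) ^ 12"
  have \<epsilon>: "0 < \<epsilon>" by (simp add: \<epsilon>_def rate_def)
  have Q: "0 < Q" by (simp add: Q_def)
  obtain t where t: "0 < t" "measure \<nu> {z \<in> space \<nu>. \<bar>z\<bar> < t} \<le> 1 / Q"
  proof -
    let ?B = "\<lambda>k. {z \<in> space \<nu>. \<bar>z\<bar> < 1 / real (Suc k)}"
    have B: "?B k \<in> sets \<nu>" for k by (auto simp: sets_\<nu> space_\<nu>)
    have "decseq ?B"
    proof (rule decseq_SucI, safe)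
      fix k and z :: real assume "\<bar>z\<bar> < 1 / real (Suc (Suc k))"
      also have "\<dots> \<le> 1 / real (Suc k)" by (intro divide_left_mono) auto
      finally show "\<bar>z\<bar> < 1 / real (Suc k)" .
    qed
    then have lim: "(\<lambda>k. measure \<nu> (?B k)) \<longlonglongrightarrow> measure \<nu> (\<Inter>k. ?B k)"
      using B by (intro finite_Lim_measure_decseq) auto
    have "(\<Inter>k. ?B k) \<subseteq> {0}"
    proof
      fix z assume z: "z \<in> (\<Inter>k. ?B k)"
      show "z \<in> {0}"
      proof (rule ccontr)
        assume "z \<notin> {0}"
        then have "0 < \<bar>z\<bar>" by simp
        then obtain k where "inverse (real (Suc k)) < \<bar>z\<bar>" using reals_Archimedean by blast
        moreover have "\<bar>z\<bar> < 1 / real (Suc k)" using z by blast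
        ultimately show False by (simp add: inverse_eq_divide)
      qed
    qed
    moreover have "measure \<nu> {0} = 0"
    proof -
      have "AE z in \<nu>. z \<notin> {0}" using pos by eventually_elim auto
      then show ?thesis by (subst prob_eq_0) (auto simp: sets_\<nu>)
    qed
    ultimately have "measure \<nu> (\<Inter>k. ?B k) \<le> 0"
      using finite_measure_mono[of "\<Inter>k. ?B k" "{0}"] by (auto simp: sets_\<nu>)
    then have "measure \<nu> (\<Inter>k. ?B k) < 1 / Q" using Q by (smt (verit) zero_less_divide_1_iff)
    from order_tendstoD(2)[OF lim this] obtain k where "measure \<nu> (?B k) < 1 / Q"
      unfolding eventually_sequentially by blast
    then show thesis by (intro that[of "1 / real (Suc k)"]) auto
  qed
  define X where "X = min \<epsilon> (1 / 24)"
  define p where "p = min (1 - exp (- X)) (min \<epsilon> 1 powr (1 / t))"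
  have X: "0 < X" "X \<le> \<epsilon>" "X \<le> 1 / 24" using \<epsilon> by (auto simp: X_def)
  have p: "0 < p" "p \<le> 1 - exp (- X)" "p \<le> min \<epsilon> 1 powr (1 / t)"
    using \<epsilon> X by (auto simp: p_def)
  then have p1: "p < 1" using exp_gt_zero[of "- X"] by linarith
  define Y where "Y = - ln (1 - p)"
  have Y: "0 \<le> Y" "Y \<le> X"
  proof -
    show "0 \<le> Y" using p p1 by (simp add: Y_def)
    have "ln (exp (- X)) \<le> ln (1 - p)" using p p1 by (subst ln_le_cancel_iff) auto
    then show "Y \<le> X" by (simp add: Y_def)
  qed
  interpret RC: random_columns \<nu> "\<lambda>z. p powr \<bar>z\<bar>" "\<lambda>_. Y" n0 \<epsilon> C
  proof
    show "integrable \<nu> (\<lambda>_. Y)" by simp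
    show "(\<integral>z. Y \<partial>\<nu>) \<le> 1 / 24" using Y X by (simp add: prob_space)
    show "(\<integral>z. Y * indicator {z. 2 ^ n\<^sup>2 < Y} z \<partial>\<nu>) \<le> C / (2 ^ n) ^ 18" for n
    proof -
      have "(1::real) \<le> 2 ^ n\<^sup>2" by simp
      then have "\<not> 2 ^ n\<^sup>2 < Y" using Y X by linarith
      then show ?thesis using C_nonneg by simp
    qed
    show "6 * width n0 * \<epsilon> \<le> rate n0" by (simp add: \<epsilon>_def)
    show "0 \<le> p powr \<bar>z\<bar> \<and> p powr \<bar>z\<bar> \<le> 1" for z using p p1 by (simp add: powr_le1)
    show "2 * width n0 * measure \<nu> {z \<in> space \<nu>. \<epsilon> < p powr \<bar>z\<bar> \<or> \<epsilon> < Y} \<le> 1 / (2 ^ n0) ^ 12"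
    proof -
      have "\<bar>z\<bar> < t" if "\<epsilon> < p powr \<bar>z\<bar>" for z
      proof (rule ccontr)
        assume "\<not> \<bar>z\<bar> < t"
        then have "p powr \<bar>z\<bar> \<le> p powr t" using p p1 by (intro powr_mono') auto
        also have "\<dots> \<le> (min \<epsilon> 1 powr (1 / t)) powr t" using p t by (intro powr_mono2) auto
        also have "\<dots> = min \<epsilon> 1" using t \<epsilon> by (simp add: powr_powr)
        finally show False using that by simp
      qed
      then have "measure \<nu> {z \<in> space \<nu>. \<epsilon> < p powr \<bar>z\<bar> \<or> \<epsilon> < Y} \<le> measure \<nu> {z \<in> space \<nu>. \<bar>z\<bar> < t}"
        using Y X by (intro finite_measure_mono) (auto simp: sets_\<nu> space_\<nu>)
      also have "\<dots> \<le> 1 / Q" by (rule t)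
      finally have "2 * real (width n0) * measure \<nu> {z \<in> space \<nu>. \<epsilon> < p powr \<bar>z\<bar> \<or> \<epsilon> < Y}
         \<le> 2 * real (width n0) * (1 / Q)" by (intro mult_left_mono) auto
      also have "\<dots> = 1 / (2 ^ n0) ^ 12" by (simp add: Q_def)
      finally show ?thesis by simp
    qed
  qed (use n0 Y \<epsilon> C_nonneg in auto)
  have "column_probs (RC.cw \<xi>) (RC.cX \<xi>) = lattice_probs p (\<lambda>i. \<xi> (Suc i))" for \<xi>
  proof -
    have "exp (- Y) = 1 - p" using p1 by (simp add: Y_def)
    then show ?thesis
      by (simp add: fun_eq_iff column_probs_def RC.cw_def RC.cX_def lattice_probs_def)
  qed
  from RC.AE_theta_zero[OF this] show ?thesis using p p1 by (intro exI[of _ p]) auto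
qed

end

definition critical_point :: "real measure \<Rightarrow> real" where
  "critical_point \<nu> = Sup {p. 0 \<le> p \<and> p \<le> 1 \<and>
     (AE x in environment_law \<nu>. measure (percolation p x) (connected_to_infinity p x) = 0)}"

context heavy_increments
begin

lemma critical_point:
  shows "0 < critical_point \<nu>" "critical_point \<nu> < 1"
    and "0 \<le> p \<Longrightarrow> p < critical_point \<nu> \<Longrightarrow>
      AE x in environment_law \<nu>. measure (percolation p x) (connected_to_infinity p x) = 0"
    and "critical_point \<nu> < p \<Longrightarrow> p \<le> 1 \<Longrightarrow>
      AE x in environment_law \<nu>. 0 < measure (percolation p x) (connected_to_infinity p x)"
proof -
  define Z where "Z = {p. 0 \<le> p \<and> p \<le> 1 \<and> (AE \<xi> in E. theta p \<xi> = 0)}"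
  have cp: "critical_point \<nu> = Sup Z"
  proof -
    have "{p. 0 \<le> p \<and> p \<le> 1 \<and> (AE x in environment_law \<nu>. measure (percolation p x) (connected_to_infinity p x) = 0)} = Z"
      unfolding Z_def using AE_environment_zero_iff[OF _ _ pos] by blast
    then show ?thesis unfolding critical_point_def by simp
  qed
  obtain p1 where p1: "0 < p1" "p1 \<in> Z" using subcritical_exists unfolding Z_def by auto
  obtain p2 where p2: "0 < p2" "p2 < 1" "AE \<xi> in E. 0 < theta p2 \<xi>" using supercritical_exists by blast
  have bdd: "bdd_above Z" by (intro bdd_aboveI[of _ 1]) (auto simp: Z_def)
  have Z_le: "p \<le> p2" if "p \<in> Z" for p
  proof (rule ccontr)
    assume "\<not> p \<le> p2"
    moreover have "AE \<xi> in E. theta p \<xi> = 0" "p \<le> 1" using that by (auto simp: Z_def)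
    ultimately have "AE \<xi> in E. False"
      using p2(3)
    proof -
      assume p: "\<not> p \<le> p2" "p \<le> 1"
      assume "AE \<xi> in E. theta p \<xi> = 0"
      with p2(3) show "AE \<xi> in E. False"
      proof eventually_elim
        case (elim \<xi>)
        have "theta p2 \<xi> \<le> theta p \<xi>" using p p2 by (intro theta_mono) auto
        then show ?case using elim by simp
      qed
    qed
    then show False using E.AE_False by simp
  qed
  show "0 < critical_point \<nu>" unfolding cp using p1 cSup_upper[OF p1(2) bdd] by linarith
  have "Sup Z \<le> p2" using p1 Z_le by (intro cSup_least) auto
  then show "critical_point \<nu> < 1" unfolding cp using p2 by linarith
  show "AE x in environment_law \<nu>. measure (percolation p x) (connected_to_infinity p x) = 0"
    if p: "0 \<le> p" "p < critical_point \<nu>"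
  proof -
    have "Z \<noteq> {}" using p1 by blast
    then obtain p' where p': "p' \<in> Z" "p < p'" using p(2) bdd unfolding cp by (metis less_cSup_iff)
    then have "AE \<xi> in E. theta p' \<xi> = 0" "p' \<le> 1" by (auto simp: Z_def)
    then have "AE \<xi> in E. theta p \<xi> = 0"
    proof -
      assume "AE \<xi> in E. theta p' \<xi> = 0" "p' \<le> 1"
      from this(1) show ?thesis
      proof eventually_elim
        case (elim \<xi>)
        have "theta p \<xi> \<le> theta p' \<xi>" using p p' \<open>p' \<le> 1\<close> by (intro theta_mono) auto
        moreover have "0 \<le> theta p \<xi>" by (simp add: theta_def)
        ultimately show ?case using elim by simp
      qed
    qed
    then show ?thesis using AE_environment_zero_iff[OF _ _ pos] p p' \<open>p' \<le> 1\<close> by simp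
  qed
  show "AE x in environment_law \<nu>. 0 < measure (percolation p x) (connected_to_infinity p x)"
    if p: "critical_point \<nu> < p" "p \<le> 1"
  proof -
    have p0: "0 < p" using p \<open>0 < critical_point \<nu>\<close> by linarith
    have "p \<notin> Z" using p cSup_upper[OF _ bdd, of p] unfolding cp by (meson not_le)
    then have "\<not> (AE \<xi> in E. theta p \<xi> = 0)" using p p0 by (auto simp: Z_def)
    then have "AE \<xi> in E. 0 < theta p \<xi>" using theta_zero_one[OF p0 p(2)] by blast
    then show ?thesis
      by (intro AE_environment[of p "\<lambda>t. 0 < t", OF less_imp_le[OF p0] p(2) pos]) measurable
  qed
qed

end

theorem theorem1:
  shows "\<exists>p\<^sub>c :: real measure \<Rightarrow> real.
    \<forall>(M :: 'a measure) (\<xi> :: 'a \<Rightarrow> real) (c :: real).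
      prob_space M \<longrightarrow>
      \<xi> \<in> borel_measurable M \<longrightarrow>
      (AE \<omega> in M. 0 < \<xi> \<omega>) \<longrightarrow>
      8 * sqrt (ln 96) < c \<longrightarrow>
      integrable M (\<lambda>\<omega>. \<xi> \<omega> * exp (c * sqrt (ln (\<xi> \<omega>))) * indicator {\<omega>. 1 \<le> \<xi> \<omega>} \<omega>) \<longrightarrow>
      (let \<nu> = distr M borel \<xi> in
         0 < p\<^sub>c \<nu> \<and> p\<^sub>c \<nu> < 1 \<and>
         (\<forall>p. 0 \<le> p \<and> p < p\<^sub>c \<nu> \<longrightarrow>
            (AE x in environment_law \<nu>.
               measure (percolation p x) (connected_to_infinity p x) = 0)) \<and>
         (\<forall>p. p\<^sub>c \<nu> < p \<and> p \<le> 1 \<longrightarrow>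
            (AE x in environment_law \<nu>.
               0 < measure (percolation p x) (connected_to_infinity p x))))"
proof (intro exI[of _ critical_point] allI impI)
  fix M :: "'a measure" and \<xi> :: "'a \<Rightarrow> real" and c :: real
  assume M: "prob_space M" and \<xi> [measurable]: "\<xi> \<in> borel_measurable M"
    and pos: "AE \<omega> in M. 0 < \<xi> \<omega>" and c: "8 * sqrt (ln 96) < c"
    and moment: "integrable M (\<lambda>\<omega>. \<xi> \<omega> * exp (c * sqrt (ln (\<xi> \<omega>))) * indicator {\<omega>. 1 \<le> \<xi> \<omega>} \<omega>)"
  interpret D: prob_space "distr M borel \<xi>" by (rule prob_space.prob_space_distr[OF M \<xi>])
  interpret heavy_increments "distr M borel \<xi>" c
  proof
    show "AE z in distr M borel \<xi>. 0 < z" using pos by (subst AE_distr_iff) auto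
    have "(\<lambda>z. z * exp (c * sqrt (ln z)) * indicator {z. 1 \<le> z} z) \<in> borel_measurable borel" by measurable
    from integrable_distr_eq[OF \<xi> this] moment
    show "integrable (distr M borel \<xi>) (\<lambda>z. z * exp (c * sqrt (ln z)) * indicator {z. 1 \<le> z} z)"
      by (simp add: indicator_def)
  qed (use c in simp_all)
  show "let \<nu> = distr M borel \<xi> in
         0 < critical_point \<nu> \<and> critical_point \<nu> < 1 \<and>
         (\<forall>p. 0 \<le> p \<and> p < critical_point \<nu> \<longrightarrow>
            (AE x in environment_law \<nu>.
               measure (percolation p x) (connected_to_infinity p x) = 0)) \<and>
         (\<forall>p. critical_point \<nu> < p \<and> p \<le> 1 \<longrightarrow>
            (AE x in environment_law \<nu>.
               0 < measure (percolation p x) (connected_to_infinity p x)))"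
    unfolding Let_def using critical_point by blast
qed

end
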